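(* Let $Q$ be a free abelian group of rank $n$ and $G<\operatorname{GL}(Q)$ a finite group. Identify $\mathcal{D}(\mathsf{k}[Q])$ with $\mathsf{k}[t_1,\ldots,t_n]*\mathbb{Z}^n$ as described in the context. If $G(\mathsf{k}[t_1,\ldots,t_n])\subset\mathsf{k}[t_1,\ldots,t_n]$, then the invariant ring $\mathcal{D}(\mathsf{k}[Q])^G$ of the ring of differential operators on the torus is a principal Galois order in $(\mathsf{k}(t_1,\ldots,t_n)*\mathbb{Z}^n)^G$, with Harish-Chandra subalgebra $\Gamma=\mathsf{k}[t_1,\ldots,t_n]^G$.
   Context: $\mathsf{k}$ is an algebraically closed field of characteristic zero. The group algebra $\mathsf{k}[Q]$ is a Laurent polynomial ring $\mathsf{k}[x_1^{\pm1},\ldots,x_n^{\pm1}]$ (the $x_i$ corresponding to a basis of $Q$), on which $G$ acts by $\mathsf{k}$-algebra automorphisms; $G$ acts on the ring of differential operators $\mathcal{D}(\mathsf{k}[Q])$ by $(g.D)(f)=g(D(g^{-1}f))$. Put $t_i=\partial_ix_i$. There is an isomorphism $\mathcal{D}(\mathsf{k}[x_1^{\pm1},\ldots,x_n^{\pm1}])\simeq\mathsf{k}[t_1,\ldots,t_n]*\mathbb{Z}^n$ sending $x_i\mapsto\varepsilon_i$, $x_i^{-1}\mapsto\varepsilon_i^{-1}$, $t_i\mapsto t_i$, where $\varepsilon_1,\ldots,\varepsilon_n$ is the standard basis of $\mathbb{Z}^n$ acting by $\varepsilon_i(t_j)=t_j-\delta_{ij}$; the $G$-action is transported along it, $G$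 preserves $\mathbb{Z}^n$ and acts on it by conjugation. Galois rings: let $U$ be an associative algebra, $\Gamma\subset U$ a commutative Noetherian domain with $U$ finitely generated as a $\Gamma$-algebra; $K=\operatorname{Frac}\Gamma$; $L/K$ finite Galois with group $G$; $\mathcal{M}\subset\operatorname{Aut}_{\mathsf{k}}L$ a submonoid which is separating (elements with the same restriction to $K$ coincide) and stable under conjugation by $G$. $L*\mathcal{M}$ is the skew monoid ring ($m\,l=m(l)m$), $G$ acts by $g(lm)=g(l)\,gmg^{-1}$, and $\mathcal{K}=(L*\mathcal{M})^G$. $U$ is a Galois $\Gamma$-ring in $\mathcal{K}$ if $\Gamma\subset U\subset\mathcal{K}$ and $UK=KU=\mathcal{K}$. For $u=\sum_ma_mm$ and $a\in L$ put $u(a)=\sum_ma_mm(a)$. $U$ is a principal Galois order (over $\Gamma$) if it is a Galois $\Gamma$-ring and $u(\gamma)\in\Gamma$ for all $u\in U$, $\gamma\in\Gamma$. A subalgebra $\Gamma\subset U$ is a Harish-Chandra subalgebra if $\Gamma u\Gamma$ is a finitely generated left and right $\Gamma$-module for all $u\in U$ and $\operatorname{Ext}^1_\Gamma$ between simple modules attached to distinct maximal ideals of finite codimension vanishes (automatic for commutative $\Gamma$). Here $L=\mathsf{k}(t_1,\ldots,t_n)$, $K=L^G$, $\mathcal{M}=\mathbb{Z}^n$. *)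

theory Defs
  imports
    "HOL-Algebra.Algebra"
    "HOL-Algebra.Algebraic_Closure_Type"
    "HOL-Library.Poly_Mapping"
begin

section \<open>Automorphisms of a field and finite Galois extensions\<close>

text \<open>The big field \<open>L\<close> is a type \<open>'l\<close>; its subrings and subfields are sets.\<close>

abbreviation type_ring :: "'a::comm_ring_1 ring"
  where "type_ring \<equiv> ring_of_type_algebra"

definition field_auts :: "'l::field set \<Rightarrow> ('l \<Rightarrow> 'l) set"
  where "field_auts F =
    {f. bij f \<and> f 1 = 1 \<and> (\<forall>x y. f (x + y) = f x + f y) \<and> (\<forall>x y. f (x * y) = f x * f y)
        \<and> (\<forall>c\<in>F. f c = c)}"

definition aut_group :: "'l::field set \<Rightarrow> ('l \<Rightarrow> 'l) monoid"
  where "aut_group F = \<lparr>carrier = field_auts F, monoid.mult = (\<circ>), one = id\<rparr>"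

definition fixed_elems :: "'g set \<Rightarrow> ('g \<Rightarrow> 'x \<Rightarrow> 'x) \<Rightarrow> 'x set"
  where "fixed_elems G act = {x. \<forall>g\<in>G. act g x = x}"

text \<open>\<open>L/K\<close> is finite Galois with group \<open>G\<close>, where \<open>G\<close> acts on \<open>L\<close> through \<open>\<alpha>\<close>:
  \<open>\<alpha>\<close> identifies \<open>G\<close> with the group of all \<open>K\<close>-automorphisms of \<open>L\<close>, and \<open>K\<close> is its fixed field.\<close>

definition finite_galois ::
    "'l::field set \<Rightarrow> ('g, 'z) monoid_scheme \<Rightarrow> ('g \<Rightarrow> 'l \<Rightarrow> 'l) \<Rightarrow> bool"
  where "finite_galois K G \<alpha> \<longleftrightarrow>
    subfield K type_ring \<and>
    ring.finite_dimension type_ring K UNIV \<and>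
    group G \<and> finite (carrier G) \<and>
    \<alpha> \<in> iso G (aut_group K) \<and>
    fixed_elems (carrier G) \<alpha> = K"

section \<open>Skew monoid rings\<close>

text \<open>\<open>L * M\<close> for a monoid \<open>M\<close> of automorphisms of \<open>L\<close>: the sum of the \<open>a\<^sub>m m\<close> is the finitely
  supported function sending \<open>m\<close> to \<open>a\<^sub>m\<close>.\<close>

type_synonym 'l skew = "('l \<Rightarrow> 'l) \<Rightarrow>\<^sub>0 'l"

definition skew_mult :: "'l::field skew \<Rightarrow> 'l skew \<Rightarrow> 'l skew"
  where "skew_mult u v =
    (\<Sum>m\<in>Poly_Mapping.keys u. \<Sum>m'\<in>Poly_Mapping.keys v.
       Poly_Mapping.single (m \<circ> m') (Poly_Mapping.lookup u m * m (Poly_Mapping.lookup v m')))"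

definition skew_ring :: "('l \<Rightarrow> 'l) set \<Rightarrow> 'l::field skew ring"
  where "skew_ring M =
    \<lparr>carrier = {u. Poly_Mapping.keys u \<subseteq> M}, monoid.mult = skew_mult,
     one = Poly_Mapping.single id 1, ring.zero = 0, add = (+)\<rparr>"

definition skew_const :: "'l::field \<Rightarrow> 'l skew"
  where "skew_const a = Poly_Mapping.single id a"

text \<open>\<open>g(l m) = g(l) (g m g\<inverse>)\<close>\<close>

definition skew_act :: "('g \<Rightarrow> 'l \<Rightarrow> 'l) \<Rightarrow> 'g \<Rightarrow> 'l::field skew \<Rightarrow> 'l skew"
  where "skew_act \<alpha> g u =
    (\<Sum>m\<in>Poly_Mapping.keys u.
       Poly_Mapping.single (\<alpha> g \<circ> m \<circ> inv_into UNIV (\<alpha> g)) (\<alpha> g (Poly_Mapping.lookup u m)))"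

definition skew_invariants ::
    "('l \<Rightarrow> 'l) set \<Rightarrow> ('g, 'z) monoid_scheme \<Rightarrow> ('g \<Rightarrow> 'l \<Rightarrow> 'l) \<Rightarrow> 'l::field skew set"
  where "skew_invariants M G \<alpha> =
    carrier (skew_ring M) \<inter> fixed_elems (carrier G) (skew_act \<alpha>)"

definition skew_eval :: "'l::field skew \<Rightarrow> 'l \<Rightarrow> 'l"
  where "skew_eval u a = (\<Sum>m\<in>Poly_Mapping.keys u. Poly_Mapping.lookup u m * m a)"

section \<open>Galois rings and principal Galois orders\<close>

text \<open>\<open>A B\<close>: the additive subgroup spanned by the products.\<close>

definition span_prod :: "('a, 'z) ring_scheme \<Rightarrow> 'a set \<Rightarrow> 'a set \<Rightarrow> 'a set"
  where "span_prod R A B = generate (add_monoid R) {a \<otimes>\<^bsub>R\<^esub> b | a b. a \<in> A \<and> b \<in> B}"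

text \<open>\<open>F\<close> is the image of the ground field in \<open>L\<close>.\<close>

definition galois_ring ::
    "'l::field set \<Rightarrow> 'l set \<Rightarrow> ('l \<Rightarrow> 'l) set \<Rightarrow> ('g, 'z) monoid_scheme \<Rightarrow> ('g \<Rightarrow> 'l \<Rightarrow> 'l)
      \<Rightarrow> 'l skew set \<Rightarrow> bool"
  where "galois_ring F \<Gamma> M G \<alpha> U \<longleftrightarrow>
    (let R = skew_ring M; K = {a / b | a b. a \<in> \<Gamma> \<and> b \<in> \<Gamma> \<and> b \<noteq> 0} in
      \<comment> \<open>the ground data \<open>\<Gamma>\<close>, \<open>K = Frac \<Gamma>\<close>, \<open>L\<close>, \<open>G\<close>\<close>
      F \<subseteq> \<Gamma> \<and> noetherian_domain (type_ring\<lparr>carrier := \<Gamma>\<rparr>) \<and> finite_galois K G \<alpha> \<and>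
      \<comment> \<open>\<open>M\<close> is a separating submonoid of \<open>Aut\<^sub>k L\<close>, stable under conjugation by \<open>G\<close>\<close>
      M \<subseteq> field_auts F \<and> id \<in> M \<and> (\<forall>m\<in>M. \<forall>m'\<in>M. m \<circ> m' \<in> M) \<and>
      (\<forall>m\<in>M. \<forall>m'\<in>M. (\<forall>x\<in>K. m x = m' x) \<longrightarrow> m = m') \<and>
      (\<forall>g\<in>carrier G. \<forall>m\<in>M. \<alpha> g \<circ> m \<circ> inv_into UNIV (\<alpha> g) \<in> M) \<and>
      \<comment> \<open>\<open>U\<close> is an algebra containing \<open>\<Gamma>\<close> and finitely generated over it\<close>
      subring U R \<and> skew_const ` \<Gamma> \<subseteq> U \<and>
      (\<exists>S. finite S \<and> S \<subseteq> U \<and> generate_ring R (skew_const ` \<Gamma> \<union> S) = U) \<and>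
      U \<subseteq> skew_invariants M G \<alpha> \<and>
      span_prod R U (skew_const ` K) = skew_invariants M G \<alpha> \<and>
      span_prod R (skew_const ` K) U = skew_invariants M G \<alpha>)"

definition principal_galois_order ::
    "'l::field set \<Rightarrow> 'l set \<Rightarrow> ('l \<Rightarrow> 'l) set \<Rightarrow> ('g, 'z) monoid_scheme \<Rightarrow> ('g \<Rightarrow> 'l \<Rightarrow> 'l)
      \<Rightarrow> 'l skew set \<Rightarrow> bool"
  where "principal_galois_order F \<Gamma> M G \<alpha> U \<longleftrightarrow>
    galois_ring F \<Gamma> M G \<alpha> U \<and> (\<forall>u\<in>U. \<forall>\<gamma>\<in>\<Gamma>. skew_eval u \<gamma> \<in> \<Gamma>)"

section \<open>Harish-Chandra subalgebras\<close>

definition module_homs ::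
    "('a, 'r) ring_scheme \<Rightarrow> ('a, 'b, 'm) module_scheme \<Rightarrow> ('a, 'c, 'n) module_scheme
      \<Rightarrow> ('b \<Rightarrow> 'c) set"
  where "module_homs R M N =
    {f \<in> carrier M \<rightarrow> carrier N.
       (\<forall>x\<in>carrier M. \<forall>y\<in>carrier M. f (x \<oplus>\<^bsub>M\<^esub> y) = f x \<oplus>\<^bsub>N\<^esub> f y) \<and>
       (\<forall>a\<in>carrier R. \<forall>x\<in>carrier M. f (a \<odot>\<^bsub>M\<^esub> x) = a \<odot>\<^bsub>N\<^esub> f x)}"

text \<open>\<open>Ext\<^sup>1(S, T) = 0\<close> in the sense of Yoneda: every extension of \<open>S\<close> by \<open>T\<close> splits.
  The middle term of such an extension is equipotent to \<open>T \<times> S\<close>, so it loses no generality to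
  let its elements be pairs.\<close>

definition ext1_vanishes ::
    "('a, 'r) ring_scheme \<Rightarrow> ('a, 'b) module \<Rightarrow> ('a, 'c) module \<Rightarrow> bool"
  where "ext1_vanishes R S T \<longleftrightarrow>
    (\<forall>(E :: ('a, 'c \<times> 'b) module) i p.
       module R E \<and> i \<in> module_homs R T E \<and> p \<in> module_homs R E S \<and>
       inj_on i (carrier T) \<and> p ` carrier E = carrier S \<and>
       i ` carrier T = {x \<in> carrier E. p x = \<zero>\<^bsub>S\<^esub>} \<longrightarrow>
       (\<exists>s\<in>module_homs R S E. \<forall>x\<in>carrier S. p (s x) = x))"

text \<open>\<open>A / I\<close> as an \<open>A\<close>-module.\<close>

definition quot_module :: "('a, 'r) ring_scheme \<Rightarrow> 'a set \<Rightarrow> ('a, 'a set) module"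
  where "quot_module A I =
    ring.extend (A Quot I) (module.fields (\<lambda>a Y. rcoset_mult A I (I +>\<^bsub>A\<^esub> a) Y))"

text \<open>A commutative subalgebra \<open>\<Gamma>\<close> of \<open>U\<close>, with \<open>F\<close> the image of the ground field in \<open>U\<close>. As \<open>\<Gamma>\<close> is
  commutative, the simple module attached to a maximal ideal \<open>I\<close> is \<open>\<Gamma> / I\<close>.\<close>

definition harish_chandra_subalgebra ::
    "('a, 'r) ring_scheme \<Rightarrow> 'a set \<Rightarrow> 'a set \<Rightarrow> bool"
  where "harish_chandra_subalgebra U F \<Gamma> \<longleftrightarrow>
    (let A = U\<lparr>carrier := \<Gamma>\<rparr>;
         cofinite = (\<lambda>I. ring.finite_dimension (A Quot I) ((\<lambda>c. I +>\<^bsub>A\<^esub> c) ` F) (carrier (A Quot I)))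
     in
      ring U \<and> subring \<Gamma> U \<and> cring A \<and> F \<subseteq> \<Gamma> \<and>
      (\<forall>u\<in>carrier U.
         let B = span_prod U (span_prod U \<Gamma> {u}) \<Gamma> in
         (\<exists>S. finite S \<and> S \<subseteq> B \<and> span_prod U \<Gamma> S = B) \<and>
         (\<exists>S. finite S \<and> S \<subseteq> B \<and> span_prod U S \<Gamma> = B)) \<and>
      (\<forall>I J. maximalideal I A \<and> maximalideal J A \<and> cofinite I \<and> cofinite J \<and> I \<noteq> J \<longrightarrow>
         ext1_vanishes A (quot_module A I) (quot_module A J)))"

section \<open>Differential operators\<close>

text \<open>Grothendieck's differential operators of order at most \<open>r\<close> on a commutative algebra \<open>'a\<close> with
  structure map \<open>\<kappa>\<close>.\<close>

definition scalar_linear :: "('k \<Rightarrow> 'a) \<Rightarrow> ('a::comm_ring_1 \<Rightarrow> 'a) \<Rightarrow> bool"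
  where "scalar_linear \<kappa> D \<longleftrightarrow>
    (\<forall>f h. D (f + h) = D f + D h) \<and> (\<forall>c f. D (\<kappa> c * f) = \<kappa> c * D f)"

fun diffop_order :: "('k \<Rightarrow> 'a) \<Rightarrow> nat \<Rightarrow> ('a::comm_ring_1 \<Rightarrow> 'a) \<Rightarrow> bool"
  where
    "diffop_order \<kappa> 0 D \<longleftrightarrow> scalar_linear \<kappa> D \<and> (\<forall>a f. D (a * f) - a * D f = 0)"
  | "diffop_order \<kappa> (Suc r) D \<longleftrightarrow>
       scalar_linear \<kappa> D \<and> (\<forall>a. diffop_order \<kappa> r (\<lambda>f. D (a * f) - a * D f))"

definition diffop_ring :: "('k \<Rightarrow> 'a) \<Rightarrow> ('a::comm_ring_1 \<Rightarrow> 'a) ring"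
  where "diffop_ring \<kappa> =
    \<lparr>carrier = {D. \<exists>r. diffop_order \<kappa> r D}, monoid.mult = (\<circ>), one = id,
     ring.zero = (\<lambda>_. 0), add = (\<lambda>D E f. D f + E f)\<rparr>"

section \<open>The torus\<close>

text \<open>The group algebra \<open>k[Q]\<close> is \<open>'q \<Rightarrow>\<^sub>0 'k\<close> with the convolution product of
  \<^theory>\<open>HOL-Library.Poly_Mapping\<close>; \<open>x\<^sup>q\<close> is \<^term>\<open>Poly_Mapping.single q 1\<close>.\<close>

definition type_group :: "'q::ab_group_add monoid"
  where "type_group = \<lparr>carrier = UNIV, monoid.mult = (+), one = 0\<rparr>"

abbreviation group_algebra_const :: "'k \<Rightarrow> ('q::ab_group_add \<Rightarrow>\<^sub>0 'k::field)"
  where "group_algebra_const \<equiv> Poly_Mapping.single 0"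

abbreviation torus_diffops :: "(('q::ab_group_add \<Rightarrow>\<^sub>0 'k::field) \<Rightarrow> ('q \<Rightarrow>\<^sub>0 'k)) ring"
  where "torus_diffops \<equiv> diffop_ring group_algebra_const"

definition algebra_act ::
    "('q \<Rightarrow> 'q) \<Rightarrow> ('q::ab_group_add \<Rightarrow>\<^sub>0 'k::field) \<Rightarrow> ('q \<Rightarrow>\<^sub>0 'k)"
  where "algebra_act g f =
    (\<Sum>q\<in>Poly_Mapping.keys f. Poly_Mapping.single (g q) (Poly_Mapping.lookup f q))"

definition diffop_act ::
    "('q \<Rightarrow> 'q) \<Rightarrow> (('q::ab_group_add \<Rightarrow>\<^sub>0 'k::field) \<Rightarrow> ('q \<Rightarrow>\<^sub>0 'k))
      \<Rightarrow> (('q \<Rightarrow>\<^sub>0 'k) \<Rightarrow> ('q \<Rightarrow>\<^sub>0 'k))"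
  where "diffop_act g D f = algebra_act g (D (algebra_act (inv_into UNIV g) f))"

text \<open>A choice of basis of \<open>Q\<close> is an isomorphism \<open>\<beta>\<close> from \<open>\<int>\<^sup>n\<close>,
  i.e. \<^term>\<open>free_Abelian_group {..<n}\<close>.\<close>

definition coordinate ::
    "nat \<Rightarrow> ((nat \<Rightarrow>\<^sub>0 int) \<Rightarrow> 'q) \<Rightarrow> nat \<Rightarrow> 'q::ab_group_add \<Rightarrow> int"
  where "coordinate n \<beta> i q =
    Poly_Mapping.lookup (inv_into (carrier (free_Abelian_group {..<n})) \<beta> q) i"

definition torus_var ::
    "((nat \<Rightarrow>\<^sub>0 int) \<Rightarrow> 'q) \<Rightarrow> nat \<Rightarrow> ('q::ab_group_add \<Rightarrow>\<^sub>0 'k::field)"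
  where "torus_var \<beta> i = Poly_Mapping.single (\<beta> (frag_of i)) 1"

definition torus_var_inv ::
    "((nat \<Rightarrow>\<^sub>0 int) \<Rightarrow> 'q) \<Rightarrow> nat \<Rightarrow> ('q::ab_group_add \<Rightarrow>\<^sub>0 'k::field)"
  where "torus_var_inv \<beta> i = Poly_Mapping.single (- \<beta> (frag_of i)) 1"

text \<open>\<open>\<partial>\<^sub>i x\<^sup>q = q\<^sub>i x\<^sup>q / x\<^sub>i\<close>\<close>

definition torus_deriv ::
    "nat \<Rightarrow> ((nat \<Rightarrow>\<^sub>0 int) \<Rightarrow> 'q) \<Rightarrow> nat \<Rightarrow> ('q::ab_group_add \<Rightarrow>\<^sub>0 'k::field) \<Rightarrow> ('q \<Rightarrow>\<^sub>0 'k)"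
  where "torus_deriv n \<beta> i f =
    (\<Sum>q\<in>Poly_Mapping.keys f.
       Poly_Mapping.single (q - \<beta> (frag_of i))
         (of_int (coordinate n \<beta> i q) * Poly_Mapping.lookup f q))"

text \<open>\<open>t\<^sub>i = \<partial>\<^sub>i x\<^sub>i\<close>, the composite with multiplication by \<open>x\<^sub>i\<close> (so \<open>x\<^sup>q\<close> has eigenvalue \<open>q\<^sub>i + 1\<close>).\<close>

definition torus_t ::
    "nat \<Rightarrow> ((nat \<Rightarrow>\<^sub>0 int) \<Rightarrow> 'q) \<Rightarrow> nat \<Rightarrow> ('q::ab_group_add \<Rightarrow>\<^sub>0 'k::field) \<Rightarrow> ('q \<Rightarrow>\<^sub>0 'k)"
  where "torus_t n \<beta> i f = torus_deriv n \<beta> i (torus_var \<beta> i * f)"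

section \<open>Rational functions, shifts, and the identification of differential operators\<close>

text \<open>\<open>k[t\<^sub>1,\<dots>,t\<^sub>n]\<close> inside \<open>L\<close>, where \<open>\<iota>\<close> embeds \<open>k\<close> into \<open>L\<close>. Indices run over \<open>{..<n}\<close>.\<close>

definition poly_subring :: "('k::field \<Rightarrow> 'l::field) \<Rightarrow> nat \<Rightarrow> (nat \<Rightarrow> 'l) \<Rightarrow> 'l set"
  where "poly_subring \<iota> n t = generate_ring type_ring (range \<iota> \<union> t ` {..<n})"

text \<open>\<open>L = k(t\<^sub>1,\<dots>,t\<^sub>n)\<close> with \<open>t\<^sub>1,\<dots>,t\<^sub>n\<close> algebraically independent over \<open>k\<close>; this determines \<open>L\<close> with
  its generators up to a unique \<open>k\<close>-isomorphism.\<close>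

definition rational_function_field ::
    "('k::field \<Rightarrow> 'l::field) \<Rightarrow> nat \<Rightarrow> (nat \<Rightarrow> 'l) \<Rightarrow> bool"
  where "rational_function_field \<iota> n t \<longleftrightarrow>
    \<iota> \<in> ring_hom type_ring type_ring \<and>
    (\<forall>E c. finite E \<and> E \<subseteq> ({..<n} \<rightarrow>\<^sub>E (UNIV :: nat set)) \<and>
       (\<Sum>e\<in>E. \<iota> (c e) * (\<Prod>i<n. t i ^ e i)) = 0 \<longrightarrow> (\<forall>e\<in>E. c e = 0)) \<and>
    generate_field type_ring (range \<iota> \<union> t ` {..<n}) = UNIV"

text \<open>\<open>v \<in> \<int>\<^sup>n\<close> acts by \<open>t\<^sub>j \<mapsto> t\<^sub>j - v\<^sub>j\<close>; in particular \<open>\<epsilon>\<^sub>i\<close> sends \<open>t\<^sub>j\<close> to \<open>t\<^sub>j - \<delta>\<^sub>i\<^sub>j\<close>.\<close>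

definition shift ::
    "('k::field \<Rightarrow> 'l::field) \<Rightarrow> nat \<Rightarrow> (nat \<Rightarrow> 'l) \<Rightarrow> (nat \<Rightarrow>\<^sub>0 int) \<Rightarrow> 'l \<Rightarrow> 'l"
  where "shift \<iota> n t v =
    (THE f. f \<in> field_auts (range \<iota>) \<and> (\<forall>j<n. f (t j) = t j - of_int (Poly_Mapping.lookup v j)))"

definition shifts ::
    "('k::field \<Rightarrow> 'l::field) \<Rightarrow> nat \<Rightarrow> (nat \<Rightarrow> 'l) \<Rightarrow> ('l \<Rightarrow> 'l) set"
  where "shifts \<iota> n t = shift \<iota> n t ` carrier (free_Abelian_group {..<n})"

text \<open>\<open>k[t\<^sub>1,\<dots>,t\<^sub>n] * \<int>\<^sup>n\<close> as a subring of \<open>L * \<int>\<^sup>n\<close>\<close>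

definition poly_skew_ring ::
    "('k::field \<Rightarrow> 'l::field) \<Rightarrow> nat \<Rightarrow> (nat \<Rightarrow> 'l) \<Rightarrow> 'l skew ring"
  where "poly_skew_ring \<iota> n t = (skew_ring (shifts \<iota> n t))
    \<lparr>carrier := {u \<in> carrier (skew_ring (shifts \<iota> n t)).
                   \<forall>m. Poly_Mapping.lookup u m \<in> poly_subring \<iota> n t}\<rparr>"

text \<open>The isomorphism of \<open>k\<close>-algebras sending \<open>x\<^sub>i\<close>, \<open>x\<^sub>i\<inverse>\<close>, \<open>t\<^sub>i\<close> to \<open>\<epsilon>\<^sub>i\<close>, \<open>\<epsilon>\<^sub>i\<inverse>\<close>, \<open>t\<^sub>i\<close>; elements of
  \<open>k[Q]\<close> are the operators of multiplication. It is unique on \<open>D(k[Q])\<close>, which these elements and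
  the constants generate.\<close>

definition torus_identification ::
    "('k::field \<Rightarrow> 'l::field) \<Rightarrow> nat \<Rightarrow> (nat \<Rightarrow> 'l) \<Rightarrow> ((nat \<Rightarrow>\<^sub>0 int) \<Rightarrow> 'q)
      \<Rightarrow> ((('q::ab_group_add \<Rightarrow>\<^sub>0 'k) \<Rightarrow> ('q \<Rightarrow>\<^sub>0 'k)) \<Rightarrow> 'l skew) \<Rightarrow> bool"
  where "torus_identification \<iota> n t \<beta> \<phi> \<longleftrightarrow>
    \<phi> \<in> ring_iso torus_diffops (poly_skew_ring \<iota> n t) \<and>
    (\<forall>c. \<phi> (\<lambda>f. group_algebra_const c * f) = skew_const (\<iota> c)) \<and>
    (\<forall>i<n. \<phi> (\<lambda>f. torus_var \<beta> i * f) = Poly_Mapping.single (shift \<iota> n t (frag_of i)) 1 \<and>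
           \<phi> (\<lambda>f. torus_var_inv \<beta> i * f) = Poly_Mapping.single (shift \<iota> n t (- frag_of i)) 1 \<and>
           \<phi> (torus_t n \<beta> i) = skew_const (t i))"

text \<open>The action of \<open>G\<close> on \<open>k[t\<^sub>1,\<dots>,t\<^sub>n] * \<int>\<^sup>n\<close> transported along \<open>\<phi>\<close>.\<close>

definition transported_act ::
    "((('q::ab_group_add \<Rightarrow>\<^sub>0 'k::field) \<Rightarrow> ('q \<Rightarrow>\<^sub>0 'k)) \<Rightarrow> 'l::field skew)
      \<Rightarrow> ('q \<Rightarrow> 'q) \<Rightarrow> 'l skew \<Rightarrow> 'l skew"
  where "transported_act \<phi> g u =
    \<phi> (diffop_act g (inv_into (carrier torus_diffops) \<phi> u))"

text \<open>The action on \<open>L\<close> by fractions, assuming that \<open>G\<close> preserves \<open>k[t\<^sub>1,\<dots>,t\<^sub>n]\<close>; on \<open>L * \<int>\<^sup>n\<close>,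
  \<open>l\<close> is the coefficient at \<^term>\<open>id\<close> of \<^term>\<open>skew_const l\<close>.\<close>

definition field_act ::
    "('k::field \<Rightarrow> 'l::field) \<Rightarrow> nat \<Rightarrow> (nat \<Rightarrow> 'l)
      \<Rightarrow> ((('q::ab_group_add \<Rightarrow>\<^sub>0 'k) \<Rightarrow> ('q \<Rightarrow>\<^sub>0 'k)) \<Rightarrow> 'l skew)
      \<Rightarrow> ('q \<Rightarrow> 'q) \<Rightarrow> 'l \<Rightarrow> 'l"
  where "field_act \<iota> n t \<phi> g l =
    (let P = poly_subring \<iota> n t;
         act = (\<lambda>p. Poly_Mapping.lookup (transported_act \<phi> g (skew_const p)) id)
     in THE y. \<exists>p\<in>P. \<exists>q\<in>P. q \<noteq> 0 \<and> l = p / q \<and> y = act p / act q)"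

definition torus_diffop_invariants ::
    "('q \<Rightarrow> 'q) set \<Rightarrow> (('q::ab_group_add \<Rightarrow>\<^sub>0 'k::field) \<Rightarrow> ('q \<Rightarrow>\<^sub>0 'k)) set"
  where "torus_diffop_invariants G = carrier torus_diffops \<inter> fixed_elems G diffop_act"

end

theory Submission
  imports Defs
begin

text \<open>Write \<open>P = k[t\<^sub>1,\<dots>,t\<^sub>n]\<close>. Transporting conjugation by \<open>x\<^sup>q\<close> and the action of \<open>G\<close> on
  differential operators along \<open>\<phi>\<close> gives automorphisms of \<open>P\<close>, which extend to \<open>L\<close>; so the shifts
  exist, and \<open>D(k[Q])\<^sup>G\<close> becomes the ring \<open>U\<close> of \<open>G\<close>-invariants of \<open>P * \<int>\<^sup>n\<close>. Each \<open>p \<in> P\<close> is a root of the monic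
  polynomial over \<open>\<Gamma> = P\<^sup>G\<close> with roots \<open>g p\<close>, so \<open>P\<close> is finite over \<open>\<Gamma>\<close>, and averaging over \<open>G\<close> shows that
  \<open>\<Gamma>\<close> is a finitely generated algebra, hence Noetherian; \<open>L/K\<close> is Galois by Artin's theorem.
  Similarly \<open>k[Q]\<close> is finite over a finitely generated ring \<open>B\<close> of \<open>G\<close>-invariants. Hence
  \<open>P * \<int>\<^sup>n = P \<otimes> k[Q]\<close> is spanned by finitely many elements over \<open>\<Gamma>\<close> on the left and \<open>B\<close> on the right,
  and averaging, which is linear for both, yields finitely many generators of \<open>U\<close> over \<open>\<Gamma>\<close>.
  Common denominators can be chosen in \<open>\<Gamma>\<close>, so \<open>K U = U K = (L * \<int>\<^sup>n)\<^sup>G\<close>. On \<open>u = \<Sum> a\<^sub>m m\<close>, right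
  multiplication by \<open>\<gamma> \<in> \<Gamma>\<close> satisfies the monic polynomial over \<open>\<Gamma>\<close> with roots \<open>g (m \<gamma>)\<close>, which makes
  \<open>\<Gamma> u \<Gamma>\<close> finitely generated on the left, and similarly on the right. Finally, distinct maximal ideals
  of \<open>\<Gamma>\<close> are comaximal, so extensions between their residue fields split.\<close>


text \<open>The ring \<open>\<Gamma>\<close> is not central in \<open>U\<close>, so Noether's
  argument over a central base does not give finite generation of \<open>U\<close>. A pair of
  coefficient rings, one on each side, replaces it: elements of \<open>U\<close> pass through the
  trace from either side, and k[Q], being commutative, lets its invariants be moved to the right
  end. Spans are therefore taken under sets of additive maps, which covers both sides at once. Skew
  multiplication is well behaved only on elements supported in a monoid of automorphisms, which is
  why module axioms are stated on subsets of types. The shifts are given by a definite description,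
  and no hypothesis says that they exist; until this has been extracted from \<open>\<phi>\<close>,
  the general facts about skew rings cannot be applied to them. Characteristic zero makes the order
  of G invertible, k infinite, and the shifts by distinct integer vectors distinct. That K separates
  the shifts is a consequence of Artin's theorem, because Q is torsion free.\<close>

section \<open>Subrings of a ring that is a whole type\<close>

lemma type_ring_simps [simp]:
  "carrier type_ring = (UNIV :: 'a::comm_ring_1 set)"
  "x \<otimes>\<^bsub>type_ring\<^esub> y = (x * y :: 'a)"
  "\<one>\<^bsub>type_ring\<^esub> = (1 :: 'a)"
  "\<zero>\<^bsub>type_ring\<^esub> = (0 :: 'a)"
  "x \<oplus>\<^bsub>type_ring\<^esub> y = (x + y :: 'a)"
  by (simp_all add: ring_of_type_algebra_def)

lemma type_ring_uminus [simp]: "\<ominus>\<^bsub>type_ring\<^esub> x = (- x :: 'a::comm_ring_1)"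
proof -
  interpret ring "type_ring :: 'a ring" by (rule ring_from_type_algebra)
  show ?thesis by (rule minus_equality) simp_all
qed

lemma subring_type_iff:
  "subring S (type_ring :: 'a::comm_ring_1 ring) \<longleftrightarrow>
    1 \<in> S \<and> (\<forall>x\<in>S. - x \<in> S) \<and> (\<forall>x\<in>S. \<forall>y\<in>S. x + y \<in> S) \<and> (\<forall>x\<in>S. \<forall>y\<in>S. x * y \<in> S)"
proof -
  interpret ring "type_ring :: 'a ring" by (rule ring_from_type_algebra)
  show ?thesis
  proof
    assume "subring S (type_ring :: 'a ring)"
    from subringE[OF this] show "1 \<in> S \<and> (\<forall>x\<in>S. - x \<in> S) \<and> (\<forall>x\<in>S. \<forall>y\<in>S. x + y \<in> S) \<and> (\<forall>x\<in>S. \<forall>y\<in>S. x * y \<in> S)"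
      by auto
  next
    assume "1 \<in> S \<and> (\<forall>x\<in>S. - x \<in> S) \<and> (\<forall>x\<in>S. \<forall>y\<in>S. x + y \<in> S) \<and> (\<forall>x\<in>S. \<forall>y\<in>S. x * y \<in> S)"
    then show "subring S type_ring" by (intro subringI) auto
  qed
qed

lemma subring_typeD:
  assumes "subring S (type_ring :: 'a::comm_ring_1 ring)"
  shows "1 \<in> S" "0 \<in> S" "\<And>x. x \<in> S \<Longrightarrow> - x \<in> S" "\<And>x y. x \<in> S \<Longrightarrow> y \<in> S \<Longrightarrow> x + y \<in> S"
    "\<And>x y. x \<in> S \<Longrightarrow> y \<in> S \<Longrightarrow> x - y \<in> S"
    "\<And>x y. x \<in> S \<Longrightarrow> y \<in> S \<Longrightarrow> x * y \<in> S" "\<And>x n. x \<in> S \<Longrightarrow> x ^ n \<in> S"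
    "\<And>f V. (\<And>x. x \<in> V \<Longrightarrow> f x \<in> S) \<Longrightarrow> sum f V \<in> S"
    "\<And>f V. (\<And>x. x \<in> V \<Longrightarrow> f x \<in> S) \<Longrightarrow> prod f V \<in> S"
proof -
  note a = assms[unfolded subring_type_iff]
  show one: "1 \<in> S" and neg: "\<And>x. x \<in> S \<Longrightarrow> - x \<in> S"
    and add: "\<And>x y. x \<in> S \<Longrightarrow> y \<in> S \<Longrightarrow> x + y \<in> S"
    and mul: "\<And>x y. x \<in> S \<Longrightarrow> y \<in> S \<Longrightarrow> x * y \<in> S" using a by auto
  show zero: "0 \<in> S" using add[OF one neg[OF one]] by simp
  show "x - y \<in> S" if "x \<in> S" "y \<in> S" for x y using add[OF that(1) neg[OF that(2)]] by simp
  show "x ^ n \<in> S" if "x \<in> S" for x n by (induction n) (auto intro: one mul that)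
  show "sum f V \<in> S" if "\<And>x. x \<in> V \<Longrightarrow> f x \<in> S" for f :: "'b \<Rightarrow> 'a" and V using that
    by (induction V rule: infinite_finite_induct) (auto intro: zero add)
  show "prod f V \<in> S" if "\<And>x. x \<in> V \<Longrightarrow> f x \<in> S" for f :: "'c \<Rightarrow> 'a" and V using that
    by (induction V rule: infinite_finite_induct) (auto intro: one mul)
qed

lemma subring_generate_type: "subring (generate_ring type_ring H) (type_ring :: 'a::comm_ring_1 ring)"
  by (rule ring.generate_ring_is_subring) (auto intro: ring_from_type_algebra)

lemma generate_type_least:
  assumes "subring S (type_ring :: 'a::comm_ring_1 ring)" "H \<subseteq> S"
  shows "generate_ring type_ring H \<subseteq> S"
  by (rule ring.generate_ring_min_subring1) (use assms in \<open>auto intro: ring_from_type_algebra\<close>)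

section \<open>Spans under monoids of operators\<close>

text \<open>An additive subgroup; taking arbitrary maps as coefficients lets one notion serve left
  modules, right modules and ideals. Closure under \<open>A\<close> is not built in: it holds once
  \<open>A\<close> is a monoid of additive maps.\<close>

inductive_set lspan :: "('w::ab_group_add \<Rightarrow> 'w) set \<Rightarrow> 'w set \<Rightarrow> 'w set" for A S where
    zero: "0 \<in> lspan A S"
  | gen: "a \<in> A \<Longrightarrow> s \<in> S \<Longrightarrow> a s \<in> lspan A S"
  | add: "x \<in> lspan A S \<Longrightarrow> y \<in> lspan A S \<Longrightarrow> x + y \<in> lspan A S"
  | uminus: "x \<in> lspan A S \<Longrightarrow> - x \<in> lspan A S"

lemma lspan_least:
  assumes "0 \<in> W" "\<And>x y. x \<in> W \<Longrightarrow> y \<in> W \<Longrightarrow> x + y \<in> W" "\<And>x. x \<in> W \<Longrightarrow> - x \<in> W"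
    and "\<And>a s. a \<in> A \<Longrightarrow> s \<in> S \<Longrightarrow> a s \<in> W"
  shows "lspan A S \<subseteq> W"
proof
  fix x assume "x \<in> lspan A S" then show "x \<in> W" by induction (use assms in auto)
qed

text \<open>Additivity of \<open>f\<close> is asked only on the span, because multiplications of a
  skew ring may be additive on a subset only. It already forces \<open>f 0 = 0\<close> and
  compatibility with negation.\<close>

lemma lspan_map:
  assumes add: "\<And>x y. x \<in> lspan A S \<Longrightarrow> y \<in> lspan A S \<Longrightarrow> f (x + y) = f x + f y"
    and gen: "\<And>a s. a \<in> A \<Longrightarrow> s \<in> S \<Longrightarrow> f (a s) \<in> lspan B T" and x: "x \<in> lspan A S"
  shows "f x \<in> lspan B T"
  using x
proof induction
  case zero show ?case using add[OF lspan.zero lspan.zero] by (simp add: lspan.zero)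
next
  case (uminus x)
  have "f 0 = 0" using add[OF lspan.zero lspan.zero] by simp
  then have "f (- x) = - f x"
    using add[OF uminus(1) lspan.uminus[OF uminus(1)]] by (simp add: eq_neg_iff_add_eq_0 add.commute)
  then show ?case using uminus(2) by (simp add: lspan.uminus)
qed (auto simp: add gen intro: lspan.add)

lemma lspan_vimage:
  assumes f: "additive f" and gen: "\<And>a s. a \<in> A \<Longrightarrow> s \<in> S \<Longrightarrow> f (a s) \<in> V"
    and V: "0 \<in> V" "\<And>x y. x \<in> V \<Longrightarrow> y \<in> V \<Longrightarrow> x + y \<in> V" "\<And>x. x \<in> V \<Longrightarrow> - x \<in> V"
    and x: "x \<in> lspan A S"
  shows "f x \<in> V"
  using x by induction (simp_all add: additive.zero[OF f] additive.add[OF f] additive.minus[OF f] gen V)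

lemma lspan_sum: "(\<And>i. i \<in> I \<Longrightarrow> f i \<in> lspan A S) \<Longrightarrow> sum f I \<in> lspan A S"
  by (induction I rule: infinite_finite_induct) (auto intro: lspan.intros)

lemma lspan_mono: "A \<subseteq> B \<Longrightarrow> S \<subseteq> T \<Longrightarrow> lspan A S \<subseteq> lspan B T"
  by (rule lspan_least) (auto intro: lspan.intros)

text \<open>The operators form a monoid only up to agreement on \<open>W\<close>: outside
  \<open>W\<close> a skew multiplication need not be unital or associative.\<close>

locale op_monoid =
  fixes W :: "'w::ab_group_add set" and A :: "('w \<Rightarrow> 'w) set"
  assumes zero_W: "0 \<in> W" and add_W: "x \<in> W \<Longrightarrow> y \<in> W \<Longrightarrow> x + y \<in> W"
    and uminus_W: "x \<in> W \<Longrightarrow> - x \<in> W"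
    and closed_W: "a \<in> A \<Longrightarrow> x \<in> W \<Longrightarrow> a x \<in> W"
    and id_in: "\<exists>a\<in>A. \<forall>x\<in>W. a x = x"
    and comp_in: "a \<in> A \<Longrightarrow> b \<in> A \<Longrightarrow> \<exists>c\<in>A. \<forall>x\<in>W. a (b x) = c x"
    and add_in: "a \<in> A \<Longrightarrow> x \<in> W \<Longrightarrow> y \<in> W \<Longrightarrow> a (x + y) = a x + a y"
begin

lemma lspan_W: "S \<subseteq> W \<Longrightarrow> lspan A S \<subseteq> W"
  by (rule lspan_least) (auto intro: zero_W add_W uminus_W closed_W)

lemma lspan_closed:
  assumes "S \<subseteq> W" "a \<in> A" "x \<in> lspan A S"
  shows "a x \<in> lspan A S"
proof (rule lspan_map[OF _ _ assms(3)])
  show "a (x + y) = a x + a y" if "x \<in> lspan A S" "y \<in> lspan A S" for x y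
    using add_in assms(2) lspan_W[OF assms(1)] that by blast
  fix b s assume b: "b \<in> A" "s \<in> S"
  then obtain c where "c \<in> A" "a (b s) = c s" using comp_in[OF assms(2)] assms(1) by blast
  then show "a (b s) \<in> lspan A S" using lspan.gen[of c A s S] b by simp
qed

lemma lspan_base:
  assumes "S \<subseteq> W"
  shows "S \<subseteq> lspan A S"
proof
  fix x assume x: "x \<in> S"
  obtain a where "a \<in> A" "a x = x" using id_in x assms by blast
  then show "x \<in> lspan A S" using lspan.gen[of a A x S] x by simp
qed

lemma lspan_trans:
  assumes "T \<subseteq> W" "S \<subseteq> lspan A T"
  shows "lspan A S \<subseteq> lspan A T"
  by (rule lspan_least) (use assms in \<open>auto intro: lspan.intros lspan_closed\<close>)

text \<open>The module form of ``adjoining finitely many commuting integral elements gives a finite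
  extension''.\<close>

lemma integral_span:
  assumes "\<And>y x x'. y \<in> set ys \<Longrightarrow> x \<in> W \<Longrightarrow> x' \<in> W \<Longrightarrow> y (x + x') = y x + y x'"
    and "\<And>y a w. y \<in> set ys \<Longrightarrow> a \<in> A \<Longrightarrow> w \<in> W \<Longrightarrow> y (a w) = a (y w)"
    and "\<And>y z w. y \<in> set ys \<Longrightarrow> z \<in> set ys \<Longrightarrow> w \<in> W \<Longrightarrow> y (z w) = z (y w)"
    and "\<And>y w. y \<in> set ys \<Longrightarrow> w \<in> W \<Longrightarrow> y w \<in> W"
    and "\<And>y w. y \<in> set ys \<Longrightarrow> w \<in> W \<Longrightarrow> \<exists>D. (y ^^ D) w \<in> lspan A ((\<lambda>j. (y ^^ j) w) ` {..<D})"
    and "u \<in> W"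
  shows "\<exists>S. finite S \<and> S \<subseteq> W \<and> u \<in> lspan A S \<and> (\<forall>y\<in>set ys. \<forall>x\<in>lspan A S. y x \<in> lspan A S)"
  using assms(1-5)
proof (induction ys)
  case Nil
  show ?case by (rule exI[of _ "{u}"]) (use assms(6) lspan_base[of "{u}"] in auto)
next
  case (Cons y ys)
  have "\<exists>S. finite S \<and> S \<subseteq> W \<and> u \<in> lspan A S \<and> (\<forall>y\<in>set ys. \<forall>x\<in>lspan A S. y x \<in> lspan A S)"
    by (rule Cons.IH) (auto intro: Cons.prems)
  then obtain S where S: "finite S" "S \<subseteq> W" "u \<in> lspan A S"
    "\<And>z x. z \<in> set ys \<Longrightarrow> x \<in> lspan A S \<Longrightarrow> z x \<in> lspan A S" by blast
  have "\<forall>w\<in>W. \<exists>D. (y ^^ D) w \<in> lspan A ((\<lambda>j. (y ^^ j) w) ` {..<D})"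
    using Cons.prems(5) by auto
  then obtain D where D: "\<And>w. w \<in> W \<Longrightarrow> (y ^^ D w) w \<in> lspan A ((\<lambda>j. (y ^^ j) w) ` {..<D w})"
    by metis
  \<comment> \<open>Each generator \<open>w\<close> of the span for \<open>ys\<close> is replaced by
    its iterates under \<open>y\<close> below the degree of its relation; that degree may depend on
    \<open>w\<close>.\<close>
  define S' where "S' = (\<Union>w\<in>S. (\<lambda>j. (y ^^ j) w) ` {..<D w})"
  have pow_W: "(y ^^ j) w \<in> W" if "w \<in> W" for w j
    by (induction j) (use that Cons.prems(4)[of y] in auto)
  have S'_W: "S' \<subseteq> W" unfolding S'_def using S(2) pow_W by auto
  note base = lspan_base[OF S'_W] and span_W = lspan_W[OF S'_W]
  have top: "(y ^^ D w) w \<in> lspan A S'" if "w \<in> S" for w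
    using D[of w] lspan_mono[of A A "(\<lambda>j. (y ^^ j) w) ` {..<D w}" S'] that S(2)
    unfolding S'_def by blast
  have S_sub: "S \<subseteq> lspan A S'"
  proof
    fix w assume w: "w \<in> S"
    show "w \<in> lspan A S'"
    proof (cases "D w")
      \<comment> \<open>In degree zero the relation itself places \<open>w\<close> in a span, while
        \<open>S'\<close> lists no iterate of \<open>w\<close>.\<close>
      case 0 then show ?thesis using top[OF w] by simp
    next
      case (Suc d)
      then have "(y ^^ 0) w \<in> S'"
        unfolding S'_def by (intro UN_I[OF w] imageI) simp
      then show ?thesis using base by auto
    qed
  qed
  have closed_y: "y x \<in> lspan A S'" if "x \<in> lspan A S'" for x
  proof (rule lspan_map[OF _ _ that])
    show "y (u + v) = y u + y v" if "u \<in> lspan A S'" "v \<in> lspan A S'" for u v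
      using Cons.prems(1) span_W that by auto
    fix a s assume a: "a \<in> A" and "s \<in> S'"
    then obtain w j where wj: "w \<in> S" "j < D w" "s = (y ^^ j) w" unfolding S'_def by auto
    \<comment> \<open>Applying \<open>y\<close> leaves the listed iterates only at the top, where
      the relation of \<open>w\<close> brings the result back.\<close>
    have "(y ^^ Suc j) w \<in> lspan A S'"
    proof (cases "Suc j < D w")
      case True
      then have "(y ^^ Suc j) w \<in> S'" unfolding S'_def using wj(1) by blast
      then show ?thesis using base by auto
    next
      case False then have "Suc j = D w" using wj(2) by simp
      then show ?thesis using top[OF wj(1)] by simp
    qed
    then have "a (y s) \<in> lspan A S'" using a lspan_closed[OF S'_W] wj(3) by simp
    then show "y (a s) \<in> lspan A S'" using Cons.prems(2)[of y a s] a wj pow_W S(2) by auto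
  qed
  have closed_pow: "(y ^^ j) x \<in> lspan A S'" if "x \<in> lspan A S'" for x j
    by (induction j) (use that closed_y in auto)
  have closed_ys: "z x \<in> lspan A S'" if z: "z \<in> set ys" and x: "x \<in> lspan A S'" for z x
  proof (rule lspan_map[OF _ _ x])
    show "z (u + v) = z u + z v" if "u \<in> lspan A S'" "v \<in> lspan A S'" for u v
      using Cons.prems(1) span_W that z by auto
    fix a s assume a: "a \<in> A" and "s \<in> S'"
    then obtain w j where wj: "w \<in> S" "j < D w" "s = (y ^^ j) w" unfolding S'_def by auto
    have wW: "w \<in> W" using wj(1) S(2) by auto
    \<comment> \<open>\<open>z\<close> is moved past the powers of \<open>y\<close> down to
      \<open>w\<close>, where the stability of the span of \<open>S\<close> applies.\<close>
    have comm: "z ((y ^^ j) w) = (y ^^ j) (z w)" for j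
      by (induction j) (use Cons.prems(3)[of z y] z pow_W[OF wW] in auto)
    have "z w \<in> lspan A S'"
      using S(4)[OF z] lspan_base[OF S(2)] wj(1) lspan_trans[OF S'_W S_sub] by blast
    then have "a (z s) \<in> lspan A S'" using a lspan_closed[OF S'_W] wj(3) comm closed_pow by simp
    then show "z (a s) \<in> lspan A S'" using Cons.prems(2)[of z a s] a z wj(3) pow_W[OF wW] by auto
  qed
  show ?case
  proof (intro exI[of _ S'] conjI)
    show "finite S'" unfolding S'_def using S(1) by auto
    show "S' \<subseteq> W" by (rule S'_W)
    show "u \<in> lspan A S'" using S(3) lspan_trans[OF S'_W S_sub] by blast
    show "\<forall>z\<in>set (y # ys). \<forall>x\<in>lspan A S'. z x \<in> lspan A S'" using closed_y closed_ys by auto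
  qed
qed

end

section \<open>Modules over a commutative ring, and the finiteness criterion for cyclic
  bimodules\<close>

text \<open>The module axioms on a subset \<open>W\<close> of a type. As the coefficient ring is
  commutative, right multiplication is an instance too, so left and right modules share all
  results.\<close>

locale ring_action =
  fixes \<Gamma> :: "'a::comm_ring_1 set" and W :: "'w::ab_group_add set" and l :: "'a \<Rightarrow> 'w \<Rightarrow> 'w"
  assumes subring: "subring \<Gamma> type_ring"
    and zero: "0 \<in> W" and add: "x \<in> W \<Longrightarrow> y \<in> W \<Longrightarrow> x + y \<in> W" and uminus: "x \<in> W \<Longrightarrow> - x \<in> W"
    and act_closed: "\<gamma> \<in> \<Gamma> \<Longrightarrow> x \<in> W \<Longrightarrow> l \<gamma> x \<in> W"
    and act_one: "x \<in> W \<Longrightarrow> l 1 x = x"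
    and act_mult: "\<gamma> \<in> \<Gamma> \<Longrightarrow> \<delta> \<in> \<Gamma> \<Longrightarrow> x \<in> W \<Longrightarrow> l (\<gamma> * \<delta>) x = l \<gamma> (l \<delta> x)"
    and act_add_right: "\<gamma> \<in> \<Gamma> \<Longrightarrow> x \<in> W \<Longrightarrow> y \<in> W \<Longrightarrow> l \<gamma> (x + y) = l \<gamma> x + l \<gamma> y"
    and act_add_left: "\<gamma> \<in> \<Gamma> \<Longrightarrow> \<delta> \<in> \<Gamma> \<Longrightarrow> x \<in> W \<Longrightarrow> l (\<gamma> + \<delta>) x = l \<gamma> x + l \<delta> x"
begin

sublocale op_monoid W "l ` \<Gamma>"
proof
  show "\<exists>a\<in>l ` \<Gamma>. \<forall>x\<in>W. a x = x" using act_one subring_typeD(1)[OF subring] by blast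
  show "\<exists>c\<in>l ` \<Gamma>. \<forall>x\<in>W. a (b x) = c x" if ab: "a \<in> l ` \<Gamma>" "b \<in> l ` \<Gamma>" for a b
  proof -
    obtain \<gamma> \<delta> where g: "\<gamma> \<in> \<Gamma>" "\<delta> \<in> \<Gamma>" "a = l \<gamma>" "b = l \<delta>" using ab by blast
    then show ?thesis
      using subring_typeD(6)[OF subring g(1,2)] act_mult by (intro bexI[of _ "l (\<gamma> * \<delta>)"]) auto
  qed
qed (auto simp: zero add uminus act_closed act_add_right)

lemma act_power: "\<gamma> \<in> \<Gamma> \<Longrightarrow> x \<in> W \<Longrightarrow> (l \<gamma> ^^ j) x = l (\<gamma> ^ j) x"
  by (induction j) (auto simp: act_one act_mult subring_typeD(7)[OF subring])

lemma act_uminus: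
  assumes "\<gamma> \<in> \<Gamma>" "x \<in> W"
  shows "l (- \<gamma>) x = - l \<gamma> x"
proof -
  note D = subring_typeD[OF subring]
  have "l 0 x = 0" using act_add_left[OF D(2) D(2) assms(2)] by (metis add_0 add_cancel_right_right)
  then show ?thesis
    using act_add_left[OF assms(1) D(3)[OF assms(1)] assms(2)] by (simp add: eq_neg_iff_add_eq_0 add.commute)
qed

lemma restrict:
  assumes "V \<subseteq> W" "0 \<in> V" "\<And>x y. x \<in> V \<Longrightarrow> y \<in> V \<Longrightarrow> x + y \<in> V" "\<And>x. x \<in> V \<Longrightarrow> - x \<in> V"
    "\<And>\<gamma> x. \<gamma> \<in> \<Gamma> \<Longrightarrow> x \<in> V \<Longrightarrow> l \<gamma> x \<in> V"
  shows "ring_action \<Gamma> V l"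
proof (rule ring_action.intro)
  have W: "x \<in> W" if "x \<in> V" for x using assms(1) that by blast
  show "l 1 x = x" if "x \<in> V" for x using act_one W[OF that] .
  show "l (\<gamma> * \<delta>) x = l \<gamma> (l \<delta> x)" "l (\<gamma> + \<delta>) x = l \<gamma> x + l \<delta> x"
    if "\<gamma> \<in> \<Gamma>" "\<delta> \<in> \<Gamma>" "x \<in> V" for \<gamma> \<delta> x using that act_mult act_add_left W by auto
  show "l \<gamma> (x + y) = l \<gamma> x + l \<gamma> y" if "\<gamma> \<in> \<Gamma>" "x \<in> V" "y \<in> V" for \<gamma> x y
    by (rule act_add_right[OF that(1) W[OF that(2)] W[OF that(3)]])
qed (use assms subring in auto)

end

definition lmults :: "'a::comm_ring_1 set \<Rightarrow> ('a \<Rightarrow> 'a) set"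
  where "lmults B = (*) ` B"

lemma op_monoid_lmults:
  assumes "subring B type_ring" "subring C type_ring" "B \<subseteq> C"
  shows "op_monoid C (lmults B)"
proof -
  interpret ring_action B C "(*)"
    by (rule ring_action.intro)
       (use assms subring_typeD(2-4,6)[OF assms(2)] in \<open>auto simp: distrib_left distrib_right mult.assoc\<close>)
  show ?thesis unfolding lmults_def by (rule op_monoid_axioms)
qed

lemma lspan_lmults_subset:
  assumes "subring C type_ring" "B \<subseteq> C" "S \<subseteq> C"
  shows "lspan (lmults B) S \<subseteq> C"
  by (rule lspan_least)
     (use assms(2,3) subring_typeD(2-4)[OF assms(1)] in \<open>auto simp: lmults_def intro!: subring_typeD(6)[OF assms(1)]\<close>)

text \<open>Right multiplications by the finitely many generators of \<open>\<Gamma>\<close> commute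
  with each other and with the left action, and they are integral over it. So \<open>u\<close> lies
  in a finitely spanned left module stable under these generators, and then under all of
  \<open>\<Gamma>\<close> because \<open>k\<close> acts alike on both sides; minimality of
  \<open>B\<close> makes it all of \<open>B\<close>. The roles of \<open>l\<close> and
  \<open>r\<close> can be exchanged, which gives the other side.\<close>

lemma cyclic_bimodule_span:
  assumes l: "ring_action \<Gamma> B l" and r: "ring_action \<Gamma> B r"
    and comm: "\<And>\<gamma> \<delta> x. \<gamma> \<in> \<Gamma> \<Longrightarrow> \<delta> \<in> \<Gamma> \<Longrightarrow> x \<in> B \<Longrightarrow> l \<gamma> (r \<delta> x) = r \<delta> (l \<gamma> x)"
    and central: "\<And>c x. c \<in> k \<Longrightarrow> x \<in> B \<Longrightarrow> l c x = r c x"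
    and T: "finite T" "\<Gamma> = generate_ring type_ring (k \<union> T)"
    and u: "u \<in> B"
    and least: "\<And>V. 0 \<in> V \<Longrightarrow> (\<And>x y. x \<in> V \<Longrightarrow> y \<in> V \<Longrightarrow> x + y \<in> V) \<Longrightarrow> (\<And>x. x \<in> V \<Longrightarrow> - x \<in> V) \<Longrightarrow> u \<in> V \<Longrightarrow>
      (\<And>\<gamma> x. \<gamma> \<in> \<Gamma> \<Longrightarrow> x \<in> V \<Longrightarrow> l \<gamma> x \<in> V) \<Longrightarrow> (\<And>\<gamma> x. \<gamma> \<in> \<Gamma> \<Longrightarrow> x \<in> V \<Longrightarrow> r \<gamma> x \<in> V) \<Longrightarrow> B \<subseteq> V"
    and integral: "\<And>\<gamma>. \<gamma> \<in> \<Gamma> \<Longrightarrow> \<exists>D c. range c \<subseteq> \<Gamma> \<and>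
      (\<forall>w\<in>B. r (\<gamma> ^ D) w = - (\<Sum>j<D. l (c j) (r (\<gamma> ^ j) w)))"
  shows "\<exists>S. finite S \<and> S \<subseteq> B \<and> lspan (l ` \<Gamma>) S = B"
proof -
  interpret L: ring_action \<Gamma> B l by (rule l)
  interpret R: ring_action \<Gamma> B r by (rule r)
  have T_\<Gamma>: "\<gamma> \<in> \<Gamma>" if "\<gamma> \<in> k \<union> T" for \<gamma> unfolding T(2) using that by (rule generate_ring.incl)
  obtain ts where ts: "set ts = T" using finite_list[OF T(1)] by blast
  have "\<exists>S. finite S \<and> S \<subseteq> B \<and> u \<in> lspan (l ` \<Gamma>) S \<and>
      (\<forall>y\<in>set (map r ts). \<forall>x\<in>lspan (l ` \<Gamma>) S. y x \<in> lspan (l ` \<Gamma>) S)"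
  proof (rule L.integral_span[OF _ _ _ _ _ u])
    fix y assume "y \<in> set (map r ts)"
    then obtain \<gamma> where \<gamma>: "\<gamma> \<in> \<Gamma>" "y = r \<gamma>" using ts T_\<Gamma> by auto
    show "y (x + x') = y x + y x'" if "x \<in> B" "x' \<in> B" for x x' using that \<gamma> R.act_add_right by simp
    show "y (a w) = a (y w)" if "a \<in> l ` \<Gamma>" "w \<in> B" for a w using that \<gamma> comm by auto
    show "y w \<in> B" if "w \<in> B" for w using that \<gamma> R.act_closed by simp
    show "y (z w) = z (y w)" if z: "z \<in> set (map r ts)" and w: "w \<in> B" for z w
    proof -
      obtain \<delta> where \<delta>: "\<delta> \<in> \<Gamma>" "z = r \<delta>" using z ts T_\<Gamma> by auto
      then show ?thesis
        using R.act_mult[OF \<gamma>(1) \<delta>(1) w] R.act_mult[OF \<delta>(1) \<gamma>(1) w] \<gamma>(2) by (simp add: mult.commute)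
    qed
    fix w assume w: "w \<in> B"
    obtain D c where c: "range c \<subseteq> \<Gamma>" and eq: "\<forall>w\<in>B. r (\<gamma> ^ D) w = - (\<Sum>j<D. l (c j) (r (\<gamma> ^ j) w))"
      using integral[OF \<gamma>(1)] by blast
    have "(y ^^ D) w = - (\<Sum>j<D. l (c j) ((y ^^ j) w))"
      unfolding \<gamma>(2) R.act_power[OF \<gamma>(1) w] by (rule bspec[OF eq w])
    also have "\<dots> \<in> lspan (l ` \<Gamma>) ((\<lambda>j. (y ^^ j) w) ` {..<D})"
      using c by (intro lspan.uminus lspan_sum lspan.gen imageI) auto
    finally show "\<exists>D. (y ^^ D) w \<in> lspan (l ` \<Gamma>) ((\<lambda>j. (y ^^ j) w) ` {..<D})" by blast
  qed
  then obtain S where S: "finite S" "S \<subseteq> B" "u \<in> lspan (l ` \<Gamma>) S"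
    "\<And>\<gamma> x. \<gamma> \<in> T \<Longrightarrow> x \<in> lspan (l ` \<Gamma>) S \<Longrightarrow> r \<gamma> x \<in> lspan (l ` \<Gamma>) S" using ts by auto
  have SB: "lspan (l ` \<Gamma>) S \<subseteq> B" by (rule L.lspan_W[OF S(2)])
  have left: "l \<gamma> x \<in> lspan (l ` \<Gamma>) S" if "\<gamma> \<in> \<Gamma>" "x \<in> lspan (l ` \<Gamma>) S" for \<gamma> x
    using L.lspan_closed[OF S(2) imageI[OF that(1)] that(2)] .
  \<comment> \<open>Membership in \<open>\<Gamma>\<close> is carried through the induction, since
    the module axioms for \<open>r\<close> hold only for such coefficients.\<close>
  have right: "\<gamma> \<in> \<Gamma> \<and> (\<forall>x\<in>lspan (l ` \<Gamma>) S. r \<gamma> x \<in> lspan (l ` \<Gamma>) S)" if "\<gamma> \<in> \<Gamma>" for \<gamma>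
    using that unfolding T(2)
  proof (induction \<gamma>)
    case one
    then show ?case using SB R.act_one subring_typeD(1)[OF L.subring] by (auto simp: T(2)[symmetric] subset_iff)
  next
    case (incl h)
    then have "h \<in> \<Gamma>" by (rule T_\<Gamma>)
    moreover have "r h x \<in> lspan (l ` \<Gamma>) S" if x: "x \<in> lspan (l ` \<Gamma>) S" for x
    proof (cases "h \<in> T")
      case False
      then have "r h x = l h x" using central[of h x] incl SB x by auto
      then show ?thesis using left[OF \<open>h \<in> \<Gamma>\<close> x] by simp
    qed (use S(4) x in simp)
    ultimately show ?case by (simp add: T(2)[symmetric])
  next
    case (a_inv h)
    then show ?case using SB R.act_uminus subring_typeD(3)[OF L.subring]
      by (auto simp: T(2)[symmetric] subset_iff intro: lspan.uminus)
  next
    case (eng_add h1 h2)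
    then show ?case using SB R.act_add_left subring_typeD(4)[OF L.subring]
      by (auto simp: T(2)[symmetric] subset_iff intro: lspan.add)
  next
    case (eng_mult h1 h2)
    then show ?case using SB R.act_mult subring_typeD(6)[OF L.subring]
      by (auto simp: T(2)[symmetric] subset_iff)
  qed
  have "B \<subseteq> lspan (l ` \<Gamma>) S"
    by (rule least) (use S(3) left right in \<open>auto intro: lspan.intros\<close>)
  then show ?thesis using S(1,2) SB by blast
qed

section \<open>Polynomials with prescribed roots\<close>

text \<open>The roots are an indexed family and not a set: the degree is \<open>card V\<close> even
  if values coincide, and a permutation of \<open>V\<close> only reorders the factors.\<close>

definition rootpoly :: "'x set \<Rightarrow> ('x \<Rightarrow> 'a::comm_ring_1) \<Rightarrow> 'a poly"
  where "rootpoly V f = (\<Prod>x\<in>V. [:- f x, 1:])"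

lemma coeff_linear_mult:
  "coeff ([:a, 1:] * p) i = a * coeff p i + (if i = 0 then 0 else coeff p (i - 1))"
  for p :: "'a::comm_ring_1 poly"
  by (cases i) (auto simp: coeff_pCons)

lemma rootpoly_empty [simp]: "rootpoly {} f = 1"
  by (simp add: rootpoly_def)

lemma rootpoly_insert:
  "finite V \<Longrightarrow> x \<notin> V \<Longrightarrow> rootpoly (insert x V) f = [:- f x, 1:] * rootpoly V f"
  by (simp add: rootpoly_def)

lemma rootpoly_monic:
  assumes "finite V"
  shows "coeff (rootpoly V f) (card V) = 1 \<and> (\<forall>i>card V. coeff (rootpoly V f) i = 0)"
  using assms
proof (induction V)
  case (insert x V)
  then show ?case
    unfolding rootpoly_insert[OF insert.hyps(1,2)] coeff_linear_mult card_insert_disjoint[OF insert.hyps(1,2)]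
    by auto
qed (auto simp: coeff_1)

lemma rootpoly_coeff_in:
  assumes "subring C type_ring" "f ` V \<subseteq> C" "finite V"
  shows "coeff (rootpoly V f) i \<in> C"
  using assms(3,2)
proof (induction V arbitrary: i)
  case empty then show ?case using subring_typeD[OF assms(1)] by (simp add: coeff_1)
next
  case (insert x V)
  then show ?case using subring_typeD[OF assms(1)]
    unfolding rootpoly_insert[OF insert.hyps(1,2)] coeff_linear_mult by simp
qed

lemma rootpoly_coeff_hom:
  assumes "finite V" "additive g" "\<And>x y. g (x * y) = g x * g y" "g 1 = 1"
  shows "g (coeff (rootpoly V f) i) = coeff (rootpoly V (\<lambda>x. g (f x))) i"
  using assms(1)
proof (induction V arbitrary: i)
  case empty then show ?case using additive.zero[OF assms(2)] by (auto simp: coeff_1 assms)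
next
  case (insert x V)
  then show ?case using additive.zero[OF assms(2)]
    unfolding rootpoly_insert[OF insert.hyps(1,2)] coeff_linear_mult
    by (simp add: additive.add[OF assms(2)] assms(3) additive.minus[OF assms(2)] additive.diff[OF assms(2)])
qed

lemma rootpoly_relation:
  assumes "finite V" "x \<in> V"
  shows "(\<Sum>j\<le>card V. coeff (rootpoly V f) j * f x ^ j) = 0"
proof -
  have "poly (rootpoly V f) (f x) = 0"
    unfolding rootpoly_def poly_prod by (rule prod_zero) (use assms in auto)
  moreover have "poly (rootpoly V f) (f x) = (\<Sum>j\<le>card V. coeff (rootpoly V f) j * f x ^ j)"
    unfolding poly_altdef
  proof (rule sum.mono_neutral_left)
    show "{..degree (rootpoly V f)} \<subseteq> {..card V}"
      using rootpoly_monic[OF assms(1), of f] by (auto intro: degree_le order_trans)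
  qed (auto simp: coeff_eq_0)
  ultimately show ?thesis by simp
qed

lemma rootpoly_power:
  assumes "finite V" "x \<in> V"
  shows "f x ^ card V = - (\<Sum>j<card V. coeff (rootpoly V f) j * f x ^ j)"
  using rootpoly_relation[OF assms, of f] rootpoly_monic[OF assms(1), of f]
  by (simp add: lessThan_Suc_atMost[symmetric] eq_neg_iff_add_eq_0 add.commute)

section \<open>Invariants of a finite group of ring automorphisms\<close>

text \<open>A finite set of injective maps that contains \<open>id\<close> and is closed under
  composition is a group: composing with one member permutes the set. This is how inverses come
  in.\<close>

locale finite_ring_auts =
  fixes Gs :: "('c::comm_ring_1 \<Rightarrow> 'c) set"
  assumes finite_Gs: "finite Gs" and id_Gs: "id \<in> Gs"
    and comp_Gs: "g \<in> Gs \<Longrightarrow> h \<in> Gs \<Longrightarrow> g \<circ> h \<in> Gs"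
    and inj_Gs: "g \<in> Gs \<Longrightarrow> inj g"
    and additive_Gs: "g \<in> Gs \<Longrightarrow> additive g"
    and mult_Gs: "g \<in> Gs \<Longrightarrow> g (x * y) = g x * g y"
    and one_Gs: "g \<in> Gs \<Longrightarrow> g 1 = 1"
begin

definition Inv :: "'c set" where "Inv = {c. \<forall>g\<in>Gs. g c = c}"

definition tr :: "'c \<Rightarrow> 'c" where "tr c = (\<Sum>g\<in>Gs. g c)"

lemma bij_comp: "g \<in> Gs \<Longrightarrow> bij_betw ((\<circ>) g) Gs Gs"
proof -
  assume g: "g \<in> Gs"
  have inj: "inj_on ((\<circ>) g) Gs"
    by (rule inj_onI) (use inj_Gs[OF g] in \<open>auto simp: fun_eq_iff inj_def\<close>)
  moreover have "(\<circ>) g ` Gs = Gs"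
    by (rule endo_inj_surj) (use finite_Gs comp_Gs g inj in auto)
  ultimately show ?thesis by (simp add: bij_betw_def)
qed

lemma subring_Inv: "subring Inv type_ring"
  unfolding subring_type_iff Inv_def
  by (simp add: one_Gs mult_Gs additive.add[OF additive_Gs] additive.minus[OF additive_Gs])
    metis

text \<open>Composition with a group element permutes \<open>Z \<times> Gs\<close>, hence the
  factors. The index set \<open>Z\<close> is there because one relation will have to serve several
  elements at once, one for each point of a support.\<close>

lemma rootpoly_coeff_Inv:
  assumes "finite Z"
  shows "coeff (rootpoly (Z \<times> Gs) (\<lambda>(z, h). h (c z))) i \<in> Inv"
proof -
  have "g (coeff (rootpoly (Z \<times> Gs) (\<lambda>(z, h). h (c z))) i) =
      coeff (rootpoly (Z \<times> Gs) (\<lambda>(z, h). h (c z))) i" if g: "g \<in> Gs" for g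
  proof -
    have "g (coeff (rootpoly (Z \<times> Gs) (\<lambda>(z, h). h (c z))) i) =
        coeff (rootpoly (Z \<times> Gs) (\<lambda>x. g (case x of (z, h) \<Rightarrow> h (c z)))) i"
      by (rule rootpoly_coeff_hom) (use assms finite_Gs g in \<open>auto simp: additive_Gs mult_Gs one_Gs\<close>)
    also have "rootpoly (Z \<times> Gs) (\<lambda>x. g (case x of (z, h) \<Rightarrow> h (c z))) =
        (\<Prod>x\<in>Z\<times>Gs. (\<lambda>(z, h). [:- h (c z), 1:]) (map_prod id ((\<circ>) g) x))"
      unfolding rootpoly_def by (rule prod.cong) auto
    also have "\<dots> = (\<Prod>x\<in>Z\<times>Gs. (\<lambda>(z, h). [:- h (c z), 1:]) x)"
      by (rule prod.reindex_bij_betw)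
         (use bij_betw_map_prod[OF bij_betw_id[of Z] bij_comp[OF g]] in auto)
    also have "\<dots> = rootpoly (Z \<times> Gs) (\<lambda>(z, h). h (c z))"
      unfolding rootpoly_def by (rule prod.cong) auto
    finally show ?thesis .
  qed
  then show ?thesis unfolding Inv_def by auto
qed

lemma tr_Inv: "tr c \<in> Inv"
proof -
  have "g (tr c) = tr c" if "g \<in> Gs" for g
  proof -
    have "g (tr c) = (\<Sum>h\<in>Gs. (\<lambda>h. h c) (g \<circ> h))"
      unfolding tr_def additive.sum[OF additive_Gs[OF that]] by simp
    also have "\<dots> = tr c" unfolding tr_def by (rule sum.reindex_bij_betw[OF bij_comp[OF that]])
    finally show ?thesis .
  qed
  then show ?thesis by (auto simp: Inv_def)
qed

lemma additive_tr: "additive tr"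
proof
  show "tr (x + y) = tr x + tr y" for x y
    unfolding tr_def sum.distrib[symmetric] by (rule sum.cong) (auto simp: additive.add[OF additive_Gs])
qed

lemma tr_mult: "b \<in> Inv \<Longrightarrow> tr (b * c) = b * tr c"
  unfolding tr_def sum_distrib_left by (rule sum.cong) (auto simp: mult_Gs Inv_def)

lemma tr_of_Inv: "b \<in> Inv \<Longrightarrow> tr b = of_nat (card Gs) * b"
proof -
  assume "b \<in> Inv"
  then have "tr b = (\<Sum>g\<in>Gs. b)" unfolding tr_def by (intro sum.cong) (auto simp: Inv_def)
  then show ?thesis by simp
qed

text \<open>Every \<open>y\<close> is a root of the monic polynomial with roots \<open>g y\<close>, so \<open>C\<close> is finite over the ring
  generated by the coefficients of these polynomials.\<close>

theorem finite_over_invariants: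
  assumes C: "C = generate_ring type_ring (k \<union> Y)" and Y: "finite Y"
    and GsC: "\<And>g c. g \<in> Gs \<Longrightarrow> c \<in> C \<Longrightarrow> g c \<in> C" and k: "k \<subseteq> Inv"
  shows "\<exists>T S. finite T \<and> T \<subseteq> C \<inter> Inv \<and> finite S \<and> S \<subseteq> C \<and>
    C = lspan (lmults (generate_ring type_ring (k \<union> T))) S"
proof -
  have subC: "subring C type_ring" unfolding C by (rule subring_generate_type)
  have kYC: "k \<subseteq> C" "Y \<subseteq> C" unfolding C by (auto intro: generate_ring.incl)
  define F where "F y = rootpoly ({()} \<times> Gs) (\<lambda>(z, h). h y)" for y
  define N where "N = card ({()} \<times> Gs)"
  define T where "T = (\<Union>y\<in>Y. coeff (F y) ` {..<N})"
  define B where "B = generate_ring type_ring (k \<union> T)"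
  have fin: "finite ({()} \<times> Gs)" using finite_Gs by simp
  have T_Inv: "T \<subseteq> Inv"
    unfolding T_def F_def using rootpoly_coeff_Inv[of "{()}" "\<lambda>_. _"] by auto
  have T_C: "T \<subseteq> C"
    unfolding T_def F_def using GsC kYC(2) by (auto intro!: rootpoly_coeff_in[OF subC] fin)
  have subB: "subring B type_ring" unfolding B_def by (rule subring_generate_type)
  have BC: "B \<subseteq> C" unfolding B_def by (rule generate_type_least[OF subC]) (use kYC T_C in auto)
  interpret opB: op_monoid C "lmults B" by (rule op_monoid_lmults[OF subB subC BC])
  obtain yl where yl: "set yl = Y" using finite_list[OF Y] by blast
  have pow: "(((*) y) ^^ j) w = y ^ j * w" for y w :: 'c and j by (induction j) (auto simp: mult.assoc)
  have "\<exists>S. finite S \<and> S \<subseteq> C \<and> 1 \<in> lspan (lmults B) S \<and>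
      (\<forall>y\<in>set (map (*) yl). \<forall>x\<in>lspan (lmults B) S. y x \<in> lspan (lmults B) S)"
  proof (rule opB.integral_span)
    fix f w assume "f \<in> set (map (*) yl)" and w: "w \<in> C"
    then obtain y where y: "y \<in> Y" "f = (*) y" using yl by auto
    show "f w \<in> C" using y w kYC subring_typeD(6)[OF subC] by auto
    \<comment> \<open>The root indexed by \<open>id\<close> is \<open>y\<close> itself.\<close>
    have "y ^ N = - (\<Sum>j<N. coeff (F y) j * y ^ j)"
      using rootpoly_power[OF fin, of "((), id)" "\<lambda>(z, h). h y"] id_Gs by (simp add: F_def N_def)
    then have "y ^ N * w = - (\<Sum>j<N. coeff (F y) j * (y ^ j * w))"
      by (simp add: sum_distrib_right mult.assoc)
    also have "\<dots> \<in> lspan (lmults B) ((\<lambda>j. y ^ j * w) ` {..<N})"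
    proof (intro lspan.uminus lspan_sum)
      fix j assume j: "j \<in> {..<N}"
      have "coeff (F y) j \<in> B" unfolding B_def T_def using y j by (auto intro!: generate_ring.incl)
      then show "coeff (F y) j * (y ^ j * w) \<in> lspan (lmults B) ((\<lambda>j. y ^ j * w) ` {..<N})"
        using lspan.gen[of "(*) (coeff (F y) j)" "lmults B" "y ^ j * w" "(\<lambda>j. y ^ j * w) ` {..<N}"] j
        by (auto simp: lmults_def)
    qed
    finally show "\<exists>D. (f ^^ D) w \<in> lspan (lmults B) ((\<lambda>j. (f ^^ j) w) ` {..<D})"
      using y(2) pow by (intro exI[of _ N]) simp
  next
    show "1 \<in> C" by (rule subring_typeD(1)[OF subC])
  qed (auto simp: lmults_def distrib_left mult.left_commute)
  then obtain S where S: "finite S" "S \<subseteq> C" "1 \<in> lspan (lmults B) S"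
    "\<And>y x. y \<in> Y \<Longrightarrow> x \<in> lspan (lmults B) S \<Longrightarrow> y * x \<in> lspan (lmults B) S" using yl by auto
  have "c * x \<in> lspan (lmults B) S" if "c \<in> C" "x \<in> lspan (lmults B) S" for c x
    using that unfolding C
  proof (induction arbitrary: x)
    case (incl h)
    show ?case
    proof (cases "h \<in> k")
      case True
      then have "(*) h \<in> lmults B" by (auto simp: lmults_def B_def intro: generate_ring.incl)
      from opB.lspan_closed[OF S(2) this incl(2)] show ?thesis .
    qed (use S(4) incl in auto)
  qed (auto simp: distrib_right mult.assoc intro: lspan.intros)
  \<comment> \<open>As 1 lies in the span, stability under multiplication by \<open>C\<close>
    exhausts \<open>C\<close>.\<close>
  from this[OF _ S(3)] have "C \<subseteq> lspan (lmults B) S" by auto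
  moreover have "lspan (lmults B) S \<subseteq> C" by (rule lspan_lmults_subset[OF subC BC S(2)])
  moreover have "finite T" unfolding T_def using Y by auto
  ultimately have "finite T \<and> T \<subseteq> C \<inter> Inv \<and> finite S \<and> S \<subseteq> C \<and>
      C = lspan (lmults (generate_ring type_ring (k \<union> T))) S"
    using S(1,2) T_C T_Inv unfolding B_def by simp
  then show ?thesis by (intro exI)
qed

text \<open>Noether's argument: \<open>tr\<close> is linear over the ring generated by
  \<open>k\<close> and \<open>T\<close>, and it maps \<open>C\<close> onto the invariants because
  \<open>r\<close> inverts the group order. Hence the traces of the finite spanning set
  \<open>S\<close> span the invariants over that ring, and adjoining them to \<open>T\<close> gives
  algebra generators.\<close>

corollary invariants_finitely_generated:
  assumes C: "C = generate_ring type_ring (k \<union> Y)" and Y: "finite Y"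
    and GsC: "\<And>g c. g \<in> Gs \<Longrightarrow> c \<in> C \<Longrightarrow> g c \<in> C" and k: "k \<subseteq> Inv"
    and r: "r \<in> k" "r * of_nat (card Gs) = 1"
  shows "\<exists>T. finite T \<and> T \<subseteq> C \<inter> Inv \<and> C \<inter> Inv = generate_ring type_ring (k \<union> T)"
proof -
  obtain T S where T: "finite T" "T \<subseteq> C \<inter> Inv" and S: "finite S" "S \<subseteq> C"
    and CS: "C = lspan (lmults (generate_ring type_ring (k \<union> T))) S"
    using finite_over_invariants[of C k Y] C Y GsC k by auto
  define T' where "T' = T \<union> tr ` S"
  define B where "B = generate_ring type_ring (k \<union> T')"
  have subC: "subring C type_ring" unfolding C by (rule subring_generate_type)
  have subB: "subring B type_ring" unfolding B_def by (rule subring_generate_type)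
  have subCI: "subring (C \<inter> Inv) type_ring"
    using subC subring_Inv unfolding subring_type_iff by auto
  have kC: "k \<subseteq> C" unfolding C by (auto intro: generate_ring.incl)
  have trC: "tr c \<in> C" if "c \<in> C" for c
    unfolding tr_def by (rule subring_typeD(8)[OF subC]) (use GsC that in auto)
  have T': "T' \<subseteq> C \<inter> Inv" unfolding T'_def using T(2) trC tr_Inv S(2) by auto
  have BCI: "B \<subseteq> C \<inter> Inv"
    unfolding B_def by (rule generate_type_least[OF subCI]) (use kC k T' in auto)
  have T_B: "generate_ring type_ring (k \<union> T) \<subseteq> B"
    by (rule generate_type_least[OF subB]) (auto simp: B_def T'_def intro: generate_ring.incl)
  have S_B: "tr ` S \<subseteq> B" by (auto simp: B_def T'_def intro: generate_ring.incl)
  have tr_B: "tr c \<in> B" if "c \<in> C" for c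
  proof (rule lspan_vimage[OF additive_tr])
    show "c \<in> lspan (lmults (generate_ring type_ring (k \<union> T))) S" using that CS by simp
    fix a s assume "a \<in> lmults (generate_ring type_ring (k \<union> T))" and s: "s \<in> S"
    then obtain b where b: "b \<in> B" "a = (*) b" using T_B by (auto simp: lmults_def)
    then have "tr (b * s) = b * tr s" using BCI by (intro tr_mult) auto
    moreover have "b * tr s \<in> B" using S_B s b(1) subring_typeD(6)[OF subB] by auto
    ultimately show "tr (a s) \<in> B" using b by simp
  qed (use subring_typeD[OF subB] in auto)
  have "C \<inter> Inv \<subseteq> B"
  proof
    fix c assume c: "c \<in> C \<inter> Inv"
    have "c = r * tr c" using tr_of_Inv[of c] c r(2) by (simp add: mult.assoc[symmetric])
    also have "\<dots> \<in> B"
      by (rule subring_typeD(6)[OF subB]) (use r(1) tr_B c in \<open>auto simp: B_def intro: generate_ring.incl\<close>)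
    finally show "c \<in> B" .
  qed
  moreover have "finite T'" unfolding T'_def using T(1) S(1) by simp
  ultimately have "finite T' \<and> T' \<subseteq> C \<inter> Inv \<and> C \<inter> Inv = generate_ring type_ring (k \<union> T')"
    using BCI T' unfolding B_def by auto
  then show ?thesis by (rule exI)
qed

end

section \<open>Hilbert's basis theorem\<close>

definition ideal_of :: "'a::comm_ring_1 set \<Rightarrow> 'a set \<Rightarrow> bool"
  where "ideal_of A I \<longleftrightarrow> I \<subseteq> A \<and> 0 \<in> I \<and> (\<forall>x\<in>I. \<forall>y\<in>I. x + y \<in> I) \<and> (\<forall>a\<in>A. \<forall>x\<in>I. a * x \<in> I)"

definition noeth :: "'a::comm_ring_1 set \<Rightarrow> bool"
  where "noeth A \<longleftrightarrow> (\<forall>I. ideal_of A I \<longrightarrow> (\<exists>F. finite F \<and> F \<subseteq> I \<and> I = lspan (lmults A) F))"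

lemma ideal_of_uminus: "subring A type_ring \<Longrightarrow> ideal_of A I \<Longrightarrow> x \<in> I \<Longrightarrow> - x \<in> I"
  using subring_typeD(1,3)[of A] unfolding ideal_of_def by (metis mult_minus1)

lemma ideal_of_lspan: "subring A type_ring \<Longrightarrow> ideal_of A I \<Longrightarrow> F \<subseteq> I \<Longrightarrow> lspan (lmults A) F \<subseteq> I"
  by (rule lspan_least) (use ideal_of_uminus[of A I] in \<open>auto simp: ideal_of_def lmults_def\<close>)

lemma noeth_field:
  assumes "subring A type_ring" "\<And>a. a \<in> A \<Longrightarrow> a \<noteq> 0 \<Longrightarrow> \<exists>b\<in>A. b * a = 1"
  shows "noeth A"
  unfolding noeth_def
proof (intro allI impI)
  fix I assume I: "ideal_of A I"
  show "\<exists>F. finite F \<and> F \<subseteq> I \<and> I = lspan (lmults A) F"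
  proof (cases "I = {0}")
    case True
    have "lspan (lmults A) {} \<subseteq> {0::'a}" by (rule lspan_least) auto
    then show ?thesis using True lspan.zero[of "lmults A" "{}"] by (intro exI[of _ "{}"]) auto
  next
    case False
    then obtain a where a: "a \<in> I" "a \<noteq> 0" using I unfolding ideal_of_def by auto
    have "a \<in> A" using I a(1) unfolding ideal_of_def by auto
    then obtain b where b: "b \<in> A" "b * a = 1" using assms(2) a(2) by auto
    have one: "1 \<in> I" using I a b unfolding ideal_of_def by metis
    have "I \<subseteq> lspan (lmults A) {1}"
    proof
      fix x assume "x \<in> I"
      then have "(*) x \<in> lmults A" using I unfolding ideal_of_def lmults_def by auto
      from lspan.gen[OF this, of 1 "{1}"] show "x \<in> lspan (lmults A) {1}" by simp
    qed
    then show ?thesis using ideal_of_lspan[OF assms(1) I, of "{1}"] one by (intro exI[of _ "{1}"]) auto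
  qed
qed

lemma generate_ring_adjoin:
  assumes A: "subring A (type_ring :: 'a::comm_ring_1 ring)"
  shows "generate_ring type_ring (A \<union> {x}) = {poly p x | p. \<forall>i. coeff p i \<in> A}"
    (is "?L = ?R")
proof
  note AD = subring_typeD[OF A]
  have "subring ?R type_ring"
    unfolding subring_type_iff
  proof (intro conjI ballI)
    show "1 \<in> ?R" by (rule CollectI, rule exI[of _ 1]) (auto simp: coeff_1 AD)
    show "- u \<in> ?R" if u: "u \<in> ?R" for u
    proof -
      obtain p where "u = poly p x" "\<forall>i. coeff p i \<in> A" using u by auto
      then show ?thesis by (intro CollectI exI[of _ "- p"]) (auto simp: AD)
    qed
    show "u + v \<in> ?R" if uv: "u \<in> ?R" "v \<in> ?R" for u v
    proof -
      obtain p q where "u = poly p x" "\<forall>i. coeff p i \<in> A" "v = poly q x" "\<forall>i. coeff q i \<in> A"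
        using uv by auto
      then show ?thesis by (intro CollectI exI[of _ "p + q"]) (auto simp: AD)
    qed
    show "u * v \<in> ?R" if uv: "u \<in> ?R" "v \<in> ?R" for u v
    proof -
      obtain p q where "u = poly p x" "\<forall>i. coeff p i \<in> A" "v = poly q x" "\<forall>i. coeff q i \<in> A"
        using uv by auto
      then show ?thesis by (intro CollectI exI[of _ "p * q"]) (auto simp: coeff_mult intro!: AD)
    qed
  qed
  moreover have "A \<union> {x} \<subseteq> ?R"
  proof -
    have "a \<in> ?R" if "a \<in> A" for a
      by (intro CollectI exI[of _ "[:a:]"]) (auto simp: coeff_pCons AD that split: nat.splits)
    moreover have "x \<in> ?R"
      by (intro CollectI exI[of _ "[:0, 1:]"]) (auto simp: coeff_pCons AD split: nat.splits)
    ultimately show ?thesis by auto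
  qed
  ultimately show "?L \<subseteq> ?R" by (rule generate_type_least)
  note LD = subring_typeD[OF subring_generate_type[of "A \<union> {x}"]]
  show "?R \<subseteq> ?L"
  proof safe
    fix p assume "\<forall>i. coeff p i \<in> A"
    then show "poly p x \<in> ?L"
      unfolding poly_altdef by (intro LD(8) LD(6) LD(7)) (auto intro: generate_ring.incl)
  qed
qed

text \<open>Choose generators of the ideals of leading coefficients of the members of \<open>I\<close> of degree at
  most \<open>n\<close>; these ideals increase and so stabilise at some \<open>N\<close>.\<close>

theorem noeth_adjoin:
  assumes A: "subring A (type_ring :: 'a::comm_ring_1 ring)" and noeth: "noeth A"
  shows "noeth (generate_ring type_ring (A \<union> {x}))"
  unfolding noeth_def
proof (intro allI impI)
  note AD = subring_typeD[OF A]
  define R where "R = generate_ring type_ring (A \<union> {x})"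
  have Rsub: "subring R type_ring" unfolding R_def by (rule subring_generate_type)
  interpret opR: op_monoid R "lmults R" by (rule op_monoid_lmults[OF Rsub Rsub subset_refl])
  have R_eq: "R = {poly p x | p. \<forall>i. coeff p i \<in> A}" unfolding R_def by (rule generate_ring_adjoin[OF A])
  fix I assume "ideal_of (generate_ring type_ring (A \<union> {x})) I"
  then have I: "ideal_of R I" unfolding R_def .
  \<comment> \<open>Membership in \<open>I\<close> is tested on the value at \<open>x\<close>, which
    may be algebraic over \<open>A\<close>, so a polynomial is not determined by its value. Bounding
    the degree instead of fixing it lets the coefficient at \<open>n\<close> vanish, which makes
    \<open>J n\<close> an ideal.\<close>
  define Q where "Q n p \<longleftrightarrow> (\<forall>i. coeff p i \<in> A) \<and> degree p \<le> n \<and> poly p x \<in> I" for n p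
  define J where "J n = {coeff p n | p. Q n p}" for n
  have AR: "A \<subseteq> R" "x \<in> R" unfolding R_def by (auto intro: generate_ring.incl)
  have Q_zero: "Q n 0" for n using I AD unfolding Q_def ideal_of_def by auto
  have Q_add: "Q n (p + q)" if "Q n p" "Q n q" for n p q
    using that I AD unfolding Q_def ideal_of_def by (auto intro: degree_add_le)
  have Q_smult: "Q n (smult a p)" if "Q n p" "a \<in> A" for n p a
    using that I AD AR unfolding Q_def ideal_of_def by (auto intro: order_trans[OF degree_smult_le])
  have Q_uminus: "Q n (- p)" if "Q n p" for n p
    using Q_smult[OF that, of "- 1"] AD by simp
  have Q_shift: "Q (n + d) (monom 1 d * p)" if "Q n p" for n d p
  proof -
    have "x ^ d * poly p x \<in> I"
      using that I AR subring_typeD(7)[OF Rsub] unfolding Q_def ideal_of_def by auto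
    moreover have "degree (monom 1 d * p) \<le> n + d"
      using degree_mult_le[of "monom 1 d" p] degree_monom_le[of "1::'a" d] that unfolding Q_def by linarith
    moreover have "coeff (monom 1 d * p) i \<in> A" for i
      using that AD(2) unfolding Q_def by (simp add: coeff_monom_mult)
    ultimately show ?thesis unfolding Q_def by (simp add: poly_monom)
  qed
  have J_mono: "J n \<subseteq> J (n + d)" for n d
  proof
    fix a assume "a \<in> J n"
    then obtain p where "a = coeff p n" "Q n p" unfolding J_def by blast
    then show "a \<in> J (n + d)" unfolding J_def using Q_shift[of n p d]
      by (intro CollectI exI[of _ "monom 1 d * p"]) (auto simp: coeff_monom_mult)
  qed
  have J_ideal: "ideal_of A (J n)" for n
    unfolding ideal_of_def
  proof (intro conjI ballI)
    show "J n \<subseteq> A" unfolding J_def Q_def by auto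
    show "0 \<in> J n" unfolding J_def using Q_zero by (intro CollectI exI[of _ 0]) auto
    show "u + v \<in> J n" if uv: "u \<in> J n" "v \<in> J n" for u v
    proof -
      obtain p q where "u = coeff p n" "Q n p" "v = coeff q n" "Q n q" using uv unfolding J_def by blast
      then show ?thesis unfolding J_def using Q_add by (intro CollectI exI[of _ "p + q"]) auto
    qed
    show "a * u \<in> J n" if a: "a \<in> A" and u: "u \<in> J n" for a u
    proof -
      obtain p where "u = coeff p n" "Q n p" using u unfolding J_def by blast
      then show ?thesis unfolding J_def using Q_smult a by (intro CollectI exI[of _ "smult a p"]) auto
    qed
  qed
  have J_mono': "J n \<subseteq> J m" if "n \<le> m" for n m using J_mono[of n "m - n"] that by simp
  have "ideal_of A (\<Union>n. J n)"
    unfolding ideal_of_def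
  proof (intro conjI ballI)
    show "(\<Union>n. J n) \<subseteq> A" using J_ideal unfolding ideal_of_def by (intro UN_least) blast
    show "0 \<in> (\<Union>n. J n)" using J_ideal unfolding ideal_of_def by auto
    show "u + v \<in> (\<Union>n. J n)" if uv: "u \<in> (\<Union>n. J n)" "v \<in> (\<Union>n. J n)" for u v
    proof -
      obtain n m where "u \<in> J n" "v \<in> J m" using uv by auto
      then have "u \<in> J (max n m)" "v \<in> J (max n m)" using J_mono'[of n "max n m"] J_mono'[of m "max n m"] by auto
      then have "u + v \<in> J (max n m)" using J_ideal unfolding ideal_of_def by blast
      then show ?thesis by blast
    qed
    show "a * u \<in> (\<Union>n. J n)" if "a \<in> A" "u \<in> (\<Union>n. J n)" for a u
      using that J_ideal unfolding ideal_of_def by blast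
  qed
  from noeth[unfolded noeth_def, rule_format, OF this]
  obtain E where E: "finite E" "E \<subseteq> (\<Union>n. J n)" "(\<Union>n. J n) = lspan (lmults A) E"
    by (elim exE conjE)
  have "\<exists>N. E \<subseteq> J N" using E(1,2)
  proof (induction E)
    case (insert e E)
    then obtain n m where "E \<subseteq> J n" "e \<in> J m" by auto
    then show ?case using J_mono'[of n "max n m"] J_mono'[of m "max n m"] by (intro exI[of _ "max n m"]) auto
  qed auto
  then obtain N where N: "E \<subseteq> J N" by blast
  have J_N: "J n \<subseteq> J N" for n
    using E(3) ideal_of_lspan[OF A J_ideal N] by blast
  have "\<forall>n. \<exists>F. finite F \<and> F \<subseteq> J n \<and> J n = lspan (lmults A) F"
    using noeth J_ideal unfolding noeth_def by blast
  then obtain F where F: "\<And>n. finite (F n)" "\<And>n. F n \<subseteq> J n" "\<And>n. J n = lspan (lmults A) (F n)" by metis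
  have "\<forall>n. \<forall>a\<in>F n. \<exists>p. a = coeff p n \<and> Q n p" using F(2) unfolding J_def by blast
  then obtain P where P: "\<And>n a. a \<in> F n \<Longrightarrow> a = coeff (P n a) n \<and> Q n (P n a)" by metis
  define T where "T = (\<Union>n\<le>N. (\<lambda>a. poly (P n a) x) ` F n)"
  have T_I: "T \<subseteq> I" unfolding T_def using P unfolding Q_def by auto
  then have T_R: "T \<subseteq> R" using I unfolding ideal_of_def by auto
  \<comment> \<open>A possible leading coefficient is attained by a polynomial whose value already
    lies in the span of \<open>T\<close>; this is clear for the generators \<open>F n\<close> and
    passes to their combinations.\<close>
  have lift: "\<exists>q. Q n q \<and> coeff q n = a \<and> poly q x \<in> lspan (lmults R) T"
    if "n \<le> N" "a \<in> J n" for n a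
  proof -
    have "a \<in> lspan (lmults A) (F n)" using that F(3) by blast
    then show ?thesis
    proof induction
      case zero show ?case by (rule exI[of _ 0]) (auto simp: Q_zero lspan.zero)
    next
      case (gen b s)
      then obtain c where c: "c \<in> A" "b = (*) c" by (auto simp: lmults_def)
      have "poly (P n s) x \<in> T" unfolding T_def using gen that by blast
      then have "c * poly (P n s) x \<in> lspan (lmults R) T"
        using c AR lspan.gen[of "(*) c" "lmults R"] by (auto simp: lmults_def)
      then show ?case using P[OF gen(2)] c Q_smult by (intro exI[of _ "smult c (P n s)"]) auto
    next
      case (add u v)
      then obtain p q where "Q n p \<and> coeff p n = u \<and> poly p x \<in> lspan (lmults R) T"
        "Q n q \<and> coeff q n = v \<and> poly q x \<in> lspan (lmults R) T" by blast
      then show ?case using Q_add by (intro exI[of _ "p + q"]) (auto intro: lspan.add)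
    next
      case (uminus u)
      then obtain p where "Q n p \<and> coeff p n = u \<and> poly p x \<in> lspan (lmults R) T" by blast
      then show ?case using Q_uminus by (intro exI[of _ "- p"]) (auto intro: lspan.uminus)
    qed
  qed
  have lift': "\<exists>q. Q n q \<and> coeff q n = a \<and> poly q x \<in> lspan (lmults R) T" if a: "a \<in> J n" for n a
  proof (cases "n \<le> N")
    case False
    \<comment> \<open>Since \<open>J n\<close> is contained in \<open>J N\<close>, a polynomial
      found for \<open>N\<close> can be multiplied by the \<open>d\<close>-th power of the
      variable.\<close>
    then obtain d where d: "n = N + d" by (metis le_Suc_ex nat_le_linear)
    obtain q where q: "Q N q" "coeff q N = a" "poly q x \<in> lspan (lmults R) T"
      using lift[of N a] J_N a by blast
    have "x ^ d * poly q x \<in> lspan (lmults R) T"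
      by (rule opR.lspan_closed[OF T_R, of "(*) (x ^ d)"])
         (use q AR subring_typeD(7)[OF Rsub] in \<open>auto simp: lmults_def\<close>)
    then show ?thesis using Q_shift[OF q(1)] q(2) d
      by (intro exI[of _ "monom 1 d * q"]) (auto simp: coeff_monom_mult poly_monom)
  qed (use lift a in blast)
  have main: "poly p x \<in> lspan (lmults R) T" if "Q n p" for n p
    using that
  proof (induction n arbitrary: p rule: less_induct)
    case (less n)
    have "coeff p n \<in> J n" using less.prems unfolding J_def by blast
    then obtain q where q: "Q n q" "coeff q n = coeff p n" "poly q x \<in> lspan (lmults R) T"
      using lift' by blast
    \<comment> \<open>Subtracting \<open>q\<close> cancels the coefficient at \<open>n\<close>, so
      the degree drops unless the difference is zero.\<close>
    have diff: "Q n (p - q)" using Q_add[OF less.prems Q_uminus[OF q(1)]] by simp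
    have "poly (p - q) x \<in> lspan (lmults R) T"
    proof (cases "p - q = 0")
      case False
      then have "degree (p - q) < n"
        using diff q(2) leading_coeff_neq_0[of "p - q"] unfolding Q_def
        by (metis coeff_diff diff_self le_neq_implies_less)
      moreover from this have "Q (degree (p - q)) (p - q)" using diff unfolding Q_def by auto
      ultimately show ?thesis using less.IH by blast
    qed (simp add: lspan.zero)
    then show ?case using lspan.add[OF _ q(3)] by fastforce
  qed
  have "finite T" unfolding T_def using F(1) by auto
  moreover note T_I
  moreover have "I \<subseteq> lspan (lmults R) T"
  proof
    fix u assume u: "u \<in> I"
    then obtain p where "u = poly p x" "\<forall>i. coeff p i \<in> A" using I R_eq unfolding ideal_of_def by blast
    then show "u \<in> lspan (lmults R) T" using main[of "degree p" p] u unfolding Q_def by auto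
  qed
  ultimately show "\<exists>F. finite F \<and> F \<subseteq> I \<and> I = lspan (lmults (generate_ring type_ring (A \<union> {x}))) F"
    using ideal_of_lspan[OF Rsub I, of T] unfolding R_def by blast
qed

lemma noeth_generate:
  assumes "subring A (type_ring :: 'a::comm_ring_1 ring)" "noeth A" "finite T"
  shows "noeth (generate_ring type_ring (A \<union> T))"
  using assms(3)
proof (induction T)
  case empty
  have "generate_ring type_ring (A \<union> {}) = A"
    using generate_type_least[OF assms(1), of A] by (auto intro: generate_ring.incl)
  then show ?case using assms(2) by simp
next
  case (insert x T)
  let ?g = "generate_ring (type_ring :: 'a ring)"
  have "?g (A \<union> insert x T) = ?g (?g (A \<union> T) \<union> {x})"
  proof
    show "?g (A \<union> insert x T) \<subseteq> ?g (?g (A \<union> T) \<union> {x})"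
      by (rule generate_type_least[OF subring_generate_type]) (auto intro: generate_ring.incl)
    have "?g (A \<union> T) \<subseteq> ?g (A \<union> insert x T)"
      by (rule generate_type_least[OF subring_generate_type]) (auto intro: generate_ring.incl)
    then show "?g (?g (A \<union> T) \<union> {x}) \<subseteq> ?g (A \<union> insert x T)"
      by (intro generate_type_least[OF subring_generate_type]) (auto intro: generate_ring.incl)
  qed
  then show ?case using noeth_adjoin[OF subring_generate_type insert.IH] by simp
qed

lemma domain_subring_type:
  assumes "subring A (type_ring :: 'a::idom ring)"
  shows "domain (type_ring\<lparr>carrier := A\<rparr>)"
proof -
  have "cring (type_ring :: 'a ring)" by (rule cring_from_type_algebra)
  then have "domain (type_ring :: 'a ring)" by (simp add: domain_def domain_axioms_def)
  then show ?thesis using domain.subring_is_domain[OF _ assms] by blast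
qed

lemma noetherian_domainI:
  assumes A: "subring A (type_ring :: 'a::idom ring)" and noeth: "noeth A"
  shows "noetherian_domain (type_ring\<lparr>carrier := A\<rparr>)"
proof -
  interpret A: domain "type_ring\<lparr>carrier := A\<rparr>" by (rule domain_subring_type[OF A])
  have "noetherian_ring (type_ring\<lparr>carrier := A\<rparr>)"
  proof (rule A.noetherian_ringI)
    fix I assume I: "ideal I (type_ring\<lparr>carrier := A\<rparr>)"
    then interpret I: ideal I "type_ring\<lparr>carrier := A\<rparr>" .
    have ID: "ideal_of A I"
      unfolding ideal_of_def using I.a_subset additive_subgroup.zero_closed[OF I.is_additive_subgroup] I.a_closed I.I_l_closed by auto
    then obtain F where F: "finite F" "F \<subseteq> I" "I = lspan (lmults A) F"
      using noeth unfolding noeth_def by blast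
    have FA: "F \<subseteq> carrier (type_ring\<lparr>carrier := A\<rparr>)" using F(2) I.a_subset by auto
    have "ideal (genideal (type_ring\<lparr>carrier := A\<rparr>) F) (type_ring\<lparr>carrier := A\<rparr>)"
      by (rule A.genideal_ideal[OF FA])
    then interpret J: ideal "genideal (type_ring\<lparr>carrier := A\<rparr>) F" "type_ring\<lparr>carrier := A\<rparr>" .
    have "ideal_of A (genideal (type_ring\<lparr>carrier := A\<rparr>) F)"
      unfolding ideal_of_def using J.a_subset additive_subgroup.zero_closed[OF J.is_additive_subgroup] J.a_closed J.I_l_closed by auto
    then have "I \<subseteq> genideal (type_ring\<lparr>carrier := A\<rparr>) F"
      using ideal_of_lspan[OF A] A.genideal_self[OF FA] F(3) by blast
    moreover have "genideal (type_ring\<lparr>carrier := A\<rparr>) F \<subseteq> I" by (rule A.genideal_minimal[OF I F(2)])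
    ultimately show "\<exists>F\<subseteq>carrier (type_ring\<lparr>carrier := A\<rparr>). finite F \<and> I = genideal (type_ring\<lparr>carrier := A\<rparr>) F"
      using F(1) FA by blast
  qed
  then show ?thesis using A.domain_axioms by (simp add: noetherian_domain_def)
qed


section \<open>Skew monoid rings\<close>

abbreviation lookup where "lookup \<equiv> Poly_Mapping.lookup"
abbreviation single where "single \<equiv> Poly_Mapping.single"
abbreviation keys where "keys \<equiv> Poly_Mapping.keys"

lemma poly_mapping_expand:
  fixes u :: "'a \<Rightarrow>\<^sub>0 'b::comm_monoid_add"
  shows "finite A \<Longrightarrow> keys u \<subseteq> A \<Longrightarrow> u = (\<Sum>m\<in>A. single m (lookup u m))"
  by (rule poly_mapping_eqI)
     (auto simp: lookup_sum lookup_single when_def in_keys_iff subset_iff)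

lemma poly_mapping_additive_induct [case_names zero single add]:
  fixes u :: "'a \<Rightarrow>\<^sub>0 'b::comm_monoid_add"
  assumes "P 0" "\<And>m a. m \<in> keys u \<Longrightarrow> P (single m a)" "\<And>u v. P u \<Longrightarrow> P v \<Longrightarrow> P (u + v)"
  shows "P u"
proof -
  have "P (\<Sum>m\<in>A. single m (lookup u m))" if "A \<subseteq> keys u" "finite A" for A
    using that(2,1) by (induction A) (auto intro: assms)
  from this[OF subset_refl] show ?thesis using poly_mapping_expand[of "keys u" u] by simp
qed

text \<open>Over common index sets the product becomes additive in each factor term by term. Padding
  by zero coefficients is harmless because \<open>m 0 = 0\<close>.\<close>

lemma skew_mult_supset:
  assumes A: "finite A" "keys u \<subseteq> A" and B: "finite B" "keys v \<subseteq> B" and 0: "\<And>m. m \<in> A \<Longrightarrow> m 0 = 0"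
  shows "skew_mult u v = (\<Sum>m\<in>A. \<Sum>m'\<in>B. single (m \<circ> m') (lookup u m * m (lookup v m')))"
proof -
  have 0: "m 0 = 0" if "m \<in> keys u" for m using 0 A(2) that by blast
  have "skew_mult u v = (\<Sum>m\<in>keys u. \<Sum>m'\<in>B. single (m \<circ> m') (lookup u m * m (lookup v m')))"
    unfolding skew_mult_def
    by (intro sum.cong refl sum.mono_neutral_left)
       (use B in \<open>auto simp: 0 in_keys_iff subset_iff\<close>)
  also have "\<dots> = (\<Sum>m\<in>A. \<Sum>m'\<in>B. single (m \<circ> m') (lookup u m * m (lookup v m')))"
    by (rule sum.mono_neutral_left) (use A in \<open>auto simp: in_keys_iff\<close>)
  finally show ?thesis .
qed

lemma skew_act_supset:
  assumes "finite A" "keys u \<subseteq> A" "\<alpha> g 0 = 0"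
  shows "skew_act \<alpha> g u = (\<Sum>m\<in>A. single (\<alpha> g \<circ> m \<circ> inv_into UNIV (\<alpha> g)) (\<alpha> g (lookup u m)))"
  unfolding skew_act_def by (rule sum.mono_neutral_left) (use assms in \<open>auto simp: in_keys_iff\<close>)

lemma skew_eval_supset:
  assumes "finite A" "keys u \<subseteq> A"
  shows "skew_eval u a = (\<Sum>m\<in>A. lookup u m * m a)"
  unfolding skew_eval_def by (rule sum.mono_neutral_left) (use assms in \<open>auto simp: in_keys_iff\<close>)

lemma additive_skew_act:
  fixes \<alpha> :: "'g \<Rightarrow> 'l::field \<Rightarrow> 'l"
  assumes "additive (\<alpha> g)"
  shows "additive (skew_act \<alpha> g)"
proof
  fix u v :: "'l skew"
  note s = skew_act_supset[where A = "keys u \<union> keys v", of _ \<alpha> g, OF _ _ additive.zero[OF assms]]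
  show "skew_act \<alpha> g (u + v) = skew_act \<alpha> g u + skew_act \<alpha> g v"
    using keys_add[of u v]
    by (simp add: s[of u] s[of v] s[of "u + v"] lookup_add additive.add[OF assms] single_add sum.distrib)
qed

lemma skew_act_single:
  "\<alpha> g 0 = 0 \<Longrightarrow> skew_act \<alpha> g (single m a) = single (\<alpha> g \<circ> m \<circ> inv_into UNIV (\<alpha> g)) (\<alpha> g a)"
  by (subst skew_act_supset[of "{m}"]) auto

lemma additive_skew_eval: "additive (\<lambda>u. skew_eval u a)"
proof
  fix u v :: "'a skew"
  note s = skew_eval_supset[where A = "keys u \<union> keys v"]
  show "skew_eval (u + v) a = skew_eval u a + skew_eval v a"
    using keys_add[of u v]
    by (simp add: s[of u] s[of v] s[of "u + v"] lookup_add distrib_right sum.distrib)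
qed

locale aut_monoid =
  fixes M :: "('l::field \<Rightarrow> 'l) set"
  assumes id_M: "id \<in> M" and comp_M: "m \<in> M \<Longrightarrow> m' \<in> M \<Longrightarrow> m \<circ> m' \<in> M"
    and additive_M: "m \<in> M \<Longrightarrow> additive m"
    and mult_M: "m \<in> M \<Longrightarrow> m (x * y) = m x * m y"
    and one_M: "m \<in> M \<Longrightarrow> m 1 = 1"
begin

lemma zero_M: "m \<in> M \<Longrightarrow> m 0 = 0"
  using additive.zero[OF additive_M] .

definition Sk :: "'l skew set" where "Sk = {u. keys u \<subseteq> M}"

lemma Sk_simps: "carrier (skew_ring M) = Sk" "0 \<in> Sk" "u \<in> Sk \<Longrightarrow> - u \<in> Sk"
    "m \<in> M \<Longrightarrow> single m a \<in> Sk" "skew_const a \<in> Sk"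
  by (auto simp: skew_ring_def Sk_def skew_const_def id_M)

lemma Sk_add: "u \<in> Sk \<Longrightarrow> v \<in> Sk \<Longrightarrow> u + v \<in> Sk"
  unfolding Sk_def using keys_add[of u v] by auto

lemma Sk_sum: "(\<And>i. i \<in> I \<Longrightarrow> f i \<in> Sk) \<Longrightarrow> sum f I \<in> Sk"
  by (induction I rule: infinite_finite_induct) (auto intro: Sk_simps Sk_add)

lemma Sk_induct [consumes 1, case_names zero single add]:
  assumes "u \<in> Sk" "P 0" "\<And>m a. m \<in> M \<Longrightarrow> P (single m a)"
    "\<And>u v. u \<in> Sk \<Longrightarrow> v \<in> Sk \<Longrightarrow> P u \<Longrightarrow> P v \<Longrightarrow> P (u + v)"
  shows "P u"
proof -
  have sg: "single m a \<in> Sk \<and> P (single m a)" if "m \<in> keys u" for m a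
    using that assms(1,3) Sk_simps(4) unfolding Sk_def by blast
  have "u \<in> Sk \<and> P u"
  proof (induction u rule: poly_mapping_additive_induct)
    case (add u v)
    then show ?case using assms(4) Sk_add by simp
  qed (use sg assms(2) Sk_simps(2) in auto)
  then show ?thesis by simp
qed

lemma skew_mult_closed: "u \<in> Sk \<Longrightarrow> v \<in> Sk \<Longrightarrow> skew_mult u v \<in> Sk"
  unfolding skew_mult_def by (intro Sk_sum Sk_simps(4) comp_M) (auto simp: Sk_def)

lemma skew_mult_add_left:
  assumes "u \<in> Sk" "v \<in> Sk"
  shows "skew_mult (u + v) w = skew_mult u w + skew_mult v w"
proof -
  have s: "skew_mult z w = (\<Sum>m\<in>keys u \<union> keys v. \<Sum>m'\<in>keys w. single (m \<circ> m') (lookup z m * m (lookup w m')))"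
    if "keys z \<subseteq> keys u \<union> keys v" for z
    by (rule skew_mult_supset) (use that assms zero_M in \<open>auto simp: Sk_def\<close>)
  show ?thesis
    using keys_add[of u v]
    by (simp add: s[of u] s[of v] s[of "u + v"] lookup_add distrib_right single_add sum.distrib)
qed

lemma skew_mult_add_right:
  assumes "u \<in> Sk"
  shows "skew_mult u (v + w) = skew_mult u v + skew_mult u w"
proof -
  have m: "m \<in> M" if "m \<in> keys u" for m using that assms unfolding Sk_def by auto
  have s: "skew_mult u z = (\<Sum>m\<in>keys u. \<Sum>m'\<in>keys v \<union> keys w. single (m \<circ> m') (lookup u m * m (lookup z m')))"
    if "keys z \<subseteq> keys v \<union> keys w" for z
    by (rule skew_mult_supset) (use that m zero_M in auto)
  show ?thesis
    using keys_add[of v w]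
    by (simp add: s[of v] s[of w] s[of "v + w"] m lookup_add distrib_left single_add sum.distrib
        additive.add[OF additive_M])
qed

lemma skew_mult_zero [simp]: "skew_mult 0 v = 0" "skew_mult u 0 = 0"
  by (simp_all add: skew_mult_def)

lemma skew_mult_single:
  "m \<in> M \<Longrightarrow> skew_mult (single m a) (single m' b) = single (m \<circ> m') (a * m b)"
  by (subst skew_mult_supset[of "{m}" _ "{m'}"]) (auto simp: zero_M)

lemma skew_mult_assoc:
  assumes "u \<in> Sk" "v \<in> Sk" "w \<in> Sk"
  shows "skew_mult (skew_mult u v) w = skew_mult u (skew_mult v w)"
  using assms(1)
proof (induction u rule: Sk_induct)
  case (single m a)
  note 1 = single
  show ?case
    using assms(2)
  proof (induction v rule: Sk_induct)
    case (single m' b)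
    note 2 = single
    show ?case
      using assms(3)
    proof (induction w rule: Sk_induct)
      case (single m'' c)
      then show ?case
        using 1 2 by (simp add: skew_mult_single comp_M comp_assoc mult_M mult.assoc)
    next
      case (add u v)
      then show ?case using 1 2
        by (simp add: skew_mult_add_right Sk_simps skew_mult_closed)
    qed simp
  next
    case (add u v)
    then show ?case using 1 assms(3)
      by (simp add: skew_mult_add_right skew_mult_add_left Sk_simps skew_mult_closed)
  qed simp
next
  case (add u v)
  then show ?case using assms(2,3)
    by (simp add: skew_mult_add_left Sk_simps skew_mult_closed)
qed simp

lemma lookup_const_mult: "u \<in> Sk \<Longrightarrow> lookup (skew_mult (skew_const a) u) m = a * lookup u m"
  by (induction u rule: Sk_induct)
     (auto simp: skew_mult_add_right Sk_simps skew_const_def skew_mult_single id_M lookup_add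
       distrib_left lookup_single when_def)

text \<open>A constant moved to the left past \<open>m\<close> turns into \<open>m a\<close>.
  Denominators and integral relations on the right are all reduced to this formula.\<close>

lemma lookup_mult_const: "u \<in> Sk \<Longrightarrow> lookup (skew_mult u (skew_const a)) m = lookup u m * m a"
  by (induction u rule: Sk_induct)
     (auto simp: skew_mult_add_left Sk_simps skew_const_def skew_mult_single id_M lookup_add
       distrib_right lookup_single when_def)

lemma skew_mult_one: "u \<in> Sk \<Longrightarrow> skew_mult (single id 1) u = u" "u \<in> Sk \<Longrightarrow> skew_mult u (single id 1) = u"
  using lookup_const_mult[of u 1] lookup_mult_const[of u 1] one_M
  by (auto intro!: poly_mapping_eqI simp: skew_const_def Sk_def subset_iff in_keys_iff)

lemma skew_ring_simps [simp]:
  "u \<otimes>\<^bsub>skew_ring M\<^esub> v = skew_mult u v" "u \<oplus>\<^bsub>skew_ring M\<^esub> v = u + v"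
  "\<zero>\<^bsub>skew_ring M\<^esub> = 0" "\<one>\<^bsub>skew_ring M\<^esub> = single id 1"
  by (simp_all add: skew_ring_def)

lemma ring_skew_ring: "ring (skew_ring M)"
proof (rule ringI)
  show "abelian_group (skew_ring M)"
  proof (rule abelian_groupI)
    show "\<exists>y\<in>carrier (skew_ring M). y \<oplus>\<^bsub>skew_ring M\<^esub> x = \<zero>\<^bsub>skew_ring M\<^esub>"
      if "x \<in> carrier (skew_ring M)" for x
      by (rule bexI[of _ "- x"]) (use that Sk_simps in auto)
  qed (auto simp: Sk_simps(1,2) Sk_add algebra_simps)
  show "monoid (skew_ring M)"
  proof (rule monoidI)
    show "\<one>\<^bsub>skew_ring M\<^esub> \<in> carrier (skew_ring M)" using id_M by (simp add: Sk_simps)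
  qed (simp_all add: Sk_simps(1) skew_mult_closed skew_mult_assoc skew_mult_one)
qed (simp_all add: Sk_simps(1) skew_mult_add_left skew_mult_add_right)

lemma skew_const_hom:
  fixes a b :: 'l
  shows "skew_const (a * b) = skew_mult (skew_const a) (skew_const b)"
  "skew_const (a + b) = skew_const a + skew_const b" "skew_const (- a) = - skew_const a"
  "skew_const (1 :: 'l) = single id 1" "skew_const (0 :: 'l) = 0"
  by (simp_all add: skew_const_def skew_mult_single id_M single_add single_uminus)


text \<open>By biadditivity monomials suffice; there the conjugated automorphism, applied to a
  conjugated coefficient, cancels \<open>\<alpha> g\<close> against its inverse.\<close>

lemma skew_act_mult:
  assumes "u \<in> Sk" "v \<in> Sk" and \<alpha>: "bij (\<alpha> g)" "additive (\<alpha> g)" "\<And>x y. \<alpha> g (x * y) = \<alpha> g x * \<alpha> g y"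
    and conj: "\<And>m. m \<in> M \<Longrightarrow> \<alpha> g \<circ> m \<circ> inv_into UNIV (\<alpha> g) \<in> M"
  shows "skew_act \<alpha> g (skew_mult u v) = skew_mult (skew_act \<alpha> g u) (skew_act \<alpha> g v)"
proof -
  have 0: "\<alpha> g 0 = 0" using \<alpha>(2) by (rule additive.zero)
  note add = additive.add[OF additive_skew_act[of \<alpha>, OF \<alpha>(2)]]
  have closed: "skew_act \<alpha> g u \<in> Sk" if "u \<in> Sk" for u
    using that by (induction u rule: Sk_induct)
      (auto simp: add skew_act_single[of \<alpha>, OF 0] conj Sk_simps Sk_add additive.zero[OF additive_skew_act[of \<alpha>, OF \<alpha>(2)]])
  have inv: "inv_into UNIV (\<alpha> g) (\<alpha> g x) = x" for x using \<alpha>(1) by (simp add: bij_is_inj)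
  show ?thesis
    using assms(1)
  proof (induction u rule: Sk_induct)
    case zero then show ?case by (simp add: additive.zero[OF additive_skew_act[of \<alpha>, OF \<alpha>(2)]])
  next
    case (single m a)
    note 1 = single
    show ?case
      using assms(2)
    proof (induction v rule: Sk_induct)
      case zero then show ?case by (simp add: additive.zero[OF additive_skew_act[of \<alpha>, OF \<alpha>(2)]])
    next
      case (single m' b)
      then show ?case using 1
        by (simp add: skew_mult_single skew_act_single[of \<alpha>, OF 0] conj \<alpha> inv)
           (simp add: fun_eq_iff inv comp_def)
    next
      case (add u v)
      then show ?case using 1
        by (simp add: skew_mult_add_right Sk_simps closed add.prems \<open>\<And>v u. skew_act \<alpha> g (u + v) = skew_act \<alpha> g u + skew_act \<alpha> g v\<close>)
    qed
  next
    case (add u v)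
    then show ?case
      by (simp add: skew_mult_add_left closed \<open>\<And>v u. skew_act \<alpha> g (u + v) = skew_act \<alpha> g u + skew_act \<alpha> g v\<close>)
  qed
qed

end

text \<open>A product can be read as the left factor operating on \<open>B\<close> or as the right
  factor operating on \<open>A\<close>. This brings the products of sets in the definitions of
  Galois rings and Harish-Chandra subalgebras into the language of \<open>lspan\<close>.\<close>

lemma span_prod_lspan:
  fixes R :: "('w::ab_group_add, 'z) ring_scheme"
  assumes R: "ring R" and add: "\<And>x y. x \<oplus>\<^bsub>R\<^esub> y = x + y" and zero: "\<zero>\<^bsub>R\<^esub> = 0"
    and A: "A \<subseteq> carrier R" and B: "B \<subseteq> carrier R"
  shows "span_prod R A B = lspan ((\<lambda>a b. a \<otimes>\<^bsub>R\<^esub> b) ` A) B" (is ?left)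
    and "span_prod R A B = lspan ((\<lambda>b a. a \<otimes>\<^bsub>R\<^esub> b) ` B) A" (is ?right)
proof -
  interpret ring R by (rule R)
  define H where "H = {a \<otimes>\<^bsub>R\<^esub> b | a b. a \<in> A \<and> b \<in> B}"
  have H: "H \<subseteq> carrier R" unfolding H_def using A B by auto
  have uminus: "inv\<^bsub>add_monoid R\<^esub> x = - x" if "x \<in> carrier R" for x
  proof -
    have "\<ominus>\<^bsub>R\<^esub> x = - x" using l_neg[OF that] by (simp add: add assms(3) eq_neg_iff_add_eq_0)
    then show ?thesis by (simp only: a_inv_def)
  qed
  interpret gen: subgroup "generate (add_monoid R) H" "add_monoid R"
    by (rule add.generate_is_subgroup) (use H in simp)
  have gen_sub: "lspan F S \<subseteq> generate (add_monoid R) H"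
    if "\<And>a s. a \<in> F \<Longrightarrow> s \<in> S \<Longrightarrow> a s \<in> H" for F S
  proof (rule lspan_least)
    show "0 \<in> generate (add_monoid R) H" using gen.one_closed assms(3) by simp
    show "x + y \<in> generate (add_monoid R) H"
      if "x \<in> generate (add_monoid R) H" "y \<in> generate (add_monoid R) H" for x y
      using gen.m_closed[OF that] add by simp
    show "- x \<in> generate (add_monoid R) H" if "x \<in> generate (add_monoid R) H" for x
      using gen.m_inv_closed[OF that] unfolding uminus[OF gen.mem_carrier[OF that, simplified]] .
    show "a s \<in> generate (add_monoid R) H" if "a \<in> F" "s \<in> S" for a s
      using \<open>\<And>s a. a \<in> F \<Longrightarrow> s \<in> S \<Longrightarrow> a s \<in> H\<close>[OF that] by (rule generate.incl)
  qed
  have sub: "generate (add_monoid R) H \<subseteq> lspan F S" if "\<And>h. h \<in> H \<Longrightarrow> h \<in> lspan F S" for F S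
  proof
    fix x assume "x \<in> generate (add_monoid R) H"
    then show "x \<in> lspan F S"
    proof induction
      case (inv h)
      then show ?case using that lspan.uminus[of h] H by (auto simp: uminus subset_iff)
    qed (use that in \<open>auto simp: add assms(3) intro: lspan.intros\<close>)
  qed
  have left: "h \<in> lspan ((\<lambda>a b. a \<otimes>\<^bsub>R\<^esub> b) ` A) B"
    and right: "h \<in> lspan ((\<lambda>b a. a \<otimes>\<^bsub>R\<^esub> b) ` B) A" if "h \<in> H" for h
  proof -
    obtain a b where h: "a \<in> A" "b \<in> B" "h = a \<otimes>\<^bsub>R\<^esub> b" using \<open>h \<in> H\<close> unfolding H_def by auto
    show "h \<in> lspan ((\<lambda>a b. a \<otimes>\<^bsub>R\<^esub> b) ` A) B"
      unfolding h(3) by (rule lspan.gen[OF imageI[OF h(1)] h(2)])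
    show "h \<in> lspan ((\<lambda>b a. a \<otimes>\<^bsub>R\<^esub> b) ` B) A"
      unfolding h(3) using lspan.gen[OF imageI[OF h(2), of "\<lambda>b a. a \<otimes>\<^bsub>R\<^esub> b"] h(1)] .
  qed
  show ?left
    unfolding span_prod_def H_def[symmetric]
    by (rule equalityI[OF sub[OF left] gen_sub]) (auto simp: H_def)
  show ?right
    unfolding span_prod_def H_def[symmetric]
    by (rule equalityI[OF sub[OF right] gen_sub]) (auto simp: H_def)
qed

section \<open>Extensions between distinct simple modules\<close>

lemma quot_module_simps:
  "carrier (quot_module A I) = carrier (A Quot I)"
  "x \<oplus>\<^bsub>quot_module A I\<^esub> y = x \<oplus>\<^bsub>A Quot I\<^esub> y"
  "\<zero>\<^bsub>quot_module A I\<^esub> = \<zero>\<^bsub>A Quot I\<^esub>"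
  "a \<odot>\<^bsub>quot_module A I\<^esub> x = (I +>\<^bsub>A\<^esub> a) \<otimes>\<^bsub>A Quot I\<^esub> x"
  by (simp_all add: quot_module_def ring.defs module.defs FactRing_def)

text \<open>If \<open>e\<close> acts as \<open>1\<close> on the quotient \<open>S\<close> and as \<open>0\<close> on the submodule \<open>T\<close>, then \<open>e y\<close> depends only
  on the image of \<open>y\<close> in \<open>S\<close>, which splits the extension.\<close>

lemma ext1_vanishesI:
  fixes S :: "('a, 'b) module" and T :: "('a, 'c) module"
  assumes e: "e \<in> carrier A"
    and eS: "\<And>x. x \<in> carrier S \<Longrightarrow> e \<odot>\<^bsub>S\<^esub> x = x"
    and eT: "\<And>z. z \<in> carrier T \<Longrightarrow> e \<odot>\<^bsub>T\<^esub> z = \<zero>\<^bsub>T\<^esub>"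
    and T0: "\<zero>\<^bsub>T\<^esub> \<in> carrier T" "\<zero>\<^bsub>T\<^esub> \<oplus>\<^bsub>T\<^esub> \<zero>\<^bsub>T\<^esub> = \<zero>\<^bsub>T\<^esub>"
    and Sc: "\<And>x y. x \<in> carrier S \<Longrightarrow> y \<in> carrier S \<Longrightarrow> x \<oplus>\<^bsub>S\<^esub> y = y \<Longrightarrow> x = \<zero>\<^bsub>S\<^esub>"
  shows "ext1_vanishes A S T"
  unfolding ext1_vanishes_def
proof (intro allI impI, elim conjE)
  fix E :: "('a, 'c \<times> 'b) module" and i p
  assume "Module.module A E" and i: "i \<in> module_homs A T E" and p: "p \<in> module_homs A E S"
    and p_surj: "p ` carrier E = carrier S"
    and ker: "i ` carrier T = {x \<in> carrier E. p x = \<zero>\<^bsub>S\<^esub>}"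
  interpret E: Module.module A E by fact
  have pc: "\<And>y. y \<in> carrier E \<Longrightarrow> p y \<in> carrier S"
    and p_add: "\<And>y z. y \<in> carrier E \<Longrightarrow> z \<in> carrier E \<Longrightarrow> p (y \<oplus>\<^bsub>E\<^esub> z) = p y \<oplus>\<^bsub>S\<^esub> p z"
    and p_smult: "\<And>a y. a \<in> carrier A \<Longrightarrow> y \<in> carrier E \<Longrightarrow> p (a \<odot>\<^bsub>E\<^esub> y) = a \<odot>\<^bsub>S\<^esub> p y"
    using p by (auto simp: module_homs_def)
  have ic: "\<And>z. z \<in> carrier T \<Longrightarrow> i z \<in> carrier E"
    and i_smult: "\<And>a z. a \<in> carrier A \<Longrightarrow> z \<in> carrier T \<Longrightarrow> i (a \<odot>\<^bsub>T\<^esub> z) = a \<odot>\<^bsub>E\<^esub> i z"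
    and i_add: "\<And>y z. y \<in> carrier T \<Longrightarrow> z \<in> carrier T \<Longrightarrow> i (y \<oplus>\<^bsub>T\<^esub> z) = i y \<oplus>\<^bsub>E\<^esub> i z"
    using i by (auto simp: module_homs_def)
  have i0: "i \<zero>\<^bsub>T\<^esub> = \<zero>\<^bsub>E\<^esub>"
    using i_add[OF T0(1) T0(1)] T0 ic[OF T0(1)] E.M.add.l_cancel_one'[of "i \<zero>\<^bsub>T\<^esub>" "i \<zero>\<^bsub>T\<^esub>"] by auto
  have well: "e \<odot>\<^bsub>E\<^esub> y = e \<odot>\<^bsub>E\<^esub> y'" if y: "y \<in> carrier E" "y' \<in> carrier E" "p y = p y'" for y y'
  proof -
    have d: "y \<ominus>\<^bsub>E\<^esub> y' \<in> carrier E" using y by simp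
    have "(y \<ominus>\<^bsub>E\<^esub> y') \<oplus>\<^bsub>E\<^esub> y' = y" using y by (simp add: E.M.minus_eq E.M.a_assoc E.M.l_neg)
    then have "p (y \<ominus>\<^bsub>E\<^esub> y') \<oplus>\<^bsub>S\<^esub> p y' = p y'" using p_add[OF d y(2)] y(3) by simp
    then have "p (y \<ominus>\<^bsub>E\<^esub> y') = \<zero>\<^bsub>S\<^esub>" by (rule Sc[OF pc[OF d] pc[OF y(2)]])
    then obtain z where z: "z \<in> carrier T" "y \<ominus>\<^bsub>E\<^esub> y' = i z" using ker d by blast
    then have "e \<odot>\<^bsub>E\<^esub> (y \<ominus>\<^bsub>E\<^esub> y') = \<zero>\<^bsub>E\<^esub>" using i_smult[OF e z(1)] eT i0 by simp
    then have "e \<odot>\<^bsub>E\<^esub> ((y \<ominus>\<^bsub>E\<^esub> y') \<oplus>\<^bsub>E\<^esub> y') = e \<odot>\<^bsub>E\<^esub> y'"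
      using E.smult_r_distr[OF e d y(2)] e y(2) by simp
    then show ?thesis using \<open>(y \<ominus>\<^bsub>E\<^esub> y') \<oplus>\<^bsub>E\<^esub> y' = y\<close> by simp
  qed
  define s where "s x = e \<odot>\<^bsub>E\<^esub> (SOME y. y \<in> carrier E \<and> p y = x)" for x
  have s_p: "s (p y) = e \<odot>\<^bsub>E\<^esub> y" if "y \<in> carrier E" for y
  proof -
    have "(SOME y'. y' \<in> carrier E \<and> p y' = p y) \<in> carrier E \<and> p (SOME y'. y' \<in> carrier E \<and> p y' = p y) = p y"
      by (rule someI[of "\<lambda>y'. y' \<in> carrier E \<and> p y' = p y" y]) (use that in auto)
    then show ?thesis unfolding s_def by (elim conjE) (rule well[OF _ that])
  qed
  have "s \<in> module_homs A S E"
    unfolding module_homs_def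
  proof (intro CollectI conjI ballI funcsetI)
    fix x assume "x \<in> carrier S"
    then obtain y where y: "y \<in> carrier E" "x = p y" using p_surj by blast
    show "s x \<in> carrier E" using y e s_p by simp
    fix x' assume "x' \<in> carrier S"
    then obtain y' where y': "y' \<in> carrier E" "x' = p y'" using p_surj by blast
    show "s (x \<oplus>\<^bsub>S\<^esub> x') = s x \<oplus>\<^bsub>E\<^esub> s x'"
      using y y' e s_p s_p[of "y \<oplus>\<^bsub>E\<^esub> y'"] by (simp add: p_add E.smult_r_distr)
  next
    fix a x assume a: "a \<in> carrier A" and "x \<in> carrier S"
    then obtain y where y: "y \<in> carrier E" "x = p y" using p_surj by blast
    have "s (a \<odot>\<^bsub>S\<^esub> x) = e \<odot>\<^bsub>E\<^esub> (a \<odot>\<^bsub>E\<^esub> y)" using y a s_p[of "a \<odot>\<^bsub>E\<^esub> y"] by (simp add: p_smult)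
    also have "\<dots> = a \<odot>\<^bsub>E\<^esub> (e \<odot>\<^bsub>E\<^esub> y)" using a e y by (simp add: E.smult_assoc1[symmetric] E.m_comm)
    finally show "s (a \<odot>\<^bsub>S\<^esub> x) = a \<odot>\<^bsub>E\<^esub> s x" using y s_p by simp
  qed
  moreover have "p (s x) = x" if "x \<in> carrier S" for x
  proof -
    obtain y where "y \<in> carrier E" "x = p y" using \<open>x \<in> carrier S\<close> p_surj by blast
    then show ?thesis using e s_p p_smult eS \<open>x \<in> carrier S\<close> by simp
  qed
  ultimately show "\<exists>s\<in>module_homs A S E. \<forall>x\<in>carrier S. p (s x) = x" by blast
qed

text \<open>Comaximality writes 1 as \<open>u \<oplus> e\<close> with \<open>u\<close> in
  \<open>I\<close> and \<open>e\<close> in \<open>J\<close>. Then \<open>e\<close> acts as the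
  identity modulo \<open>I\<close> and as zero modulo \<open>J\<close>, so it splits the
  extension.\<close>

lemma ext1_quot_module_vanishes:
  assumes A: "cring A" and max: "maximalideal I A" "maximalideal J A" "I \<noteq> J"
  shows "ext1_vanishes A (quot_module A I) (quot_module A J)"
proof -
  interpret cring A by (rule A)
  interpret I: maximalideal I A by (rule max(1))
  interpret J: maximalideal J A by (rule max(2))
  interpret QI: ring "A Quot I" by (rule I.quotient_is_ring)
  interpret QJ: ring "A Quot J" by (rule J.quotient_is_ring)
  have sum: "ideal (I <+>\<^bsub>A\<^esub> J) A" by (rule add_ideals[OF I.is_ideal J.is_ideal])
  have "I \<subseteq> I <+>\<^bsub>A\<^esub> J" "J \<subseteq> I <+>\<^bsub>A\<^esub> J"
    using union_genideal[OF I.is_ideal J.is_ideal] genideal_self[of "I \<union> J"] I.a_subset J.a_subset by auto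
  moreover have "I <+>\<^bsub>A\<^esub> J \<subseteq> carrier A" by (rule additive_subgroup.a_subset[OF ideal.axioms(1)[OF sum]])
  ultimately have "I <+>\<^bsub>A\<^esub> J = I \<or> I <+>\<^bsub>A\<^esub> J = carrier A" "I <+>\<^bsub>A\<^esub> J = J \<or> I <+>\<^bsub>A\<^esub> J = carrier A"
    using I.I_maximal[OF sum] J.I_maximal[OF sum] by auto
  then have "I <+>\<^bsub>A\<^esub> J = carrier A" using max(3) by auto
  then have "\<one>\<^bsub>A\<^esub> \<in> I <+>\<^bsub>A\<^esub> J" by simp
  then obtain u e where ue: "u \<in> I" "e \<in> J" "\<one>\<^bsub>A\<^esub> = u \<oplus>\<^bsub>A\<^esub> e" unfolding set_add_def' by blast
  have uc: "u \<in> carrier A" and ec: "e \<in> carrier A" using ue I.a_subset J.a_subset by auto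
  show ?thesis
  proof (rule ext1_vanishesI[OF ec])
    fix x assume "x \<in> carrier (quot_module A I)"
    then have x: "x \<in> carrier (A Quot I)" by (simp add: quot_module_simps)
    have "I +>\<^bsub>A\<^esub> e = I +>\<^bsub>A\<^esub> \<one>\<^bsub>A\<^esub>"
    proof (rule quotient_eq_iff_same_a_r_cos[OF I.is_ideal, THEN iffD1])
      have "e \<ominus>\<^bsub>A\<^esub> \<one>\<^bsub>A\<^esub> = \<ominus>\<^bsub>A\<^esub> u" unfolding ue(3) using uc ec by algebra
      then show "e \<ominus>\<^bsub>A\<^esub> \<one>\<^bsub>A\<^esub> \<in> I" using ue(1) by simp
    qed (use ec in auto)
    then show "e \<odot>\<^bsub>quot_module A I\<^esub> x = x" using x QI.l_one[OF x] by (simp add: quot_module_simps FactRing_def)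
  next
    fix z assume "z \<in> carrier (quot_module A J)"
    then have z: "z \<in> carrier (A Quot J)" by (simp add: quot_module_simps)
    have "J +>\<^bsub>A\<^esub> e = \<zero>\<^bsub>A Quot J\<^esub>" using J.a_rcos_const[OF ue(2)] by (simp add: FactRing_def)
    then show "e \<odot>\<^bsub>quot_module A J\<^esub> z = \<zero>\<^bsub>quot_module A J\<^esub>" using QJ.l_null[OF z] by (simp add: quot_module_simps)
  next
    fix x y assume "x \<in> carrier (quot_module A I)" "y \<in> carrier (quot_module A I)"
      "x \<oplus>\<^bsub>quot_module A I\<^esub> y = y"
    then show "x = \<zero>\<^bsub>quot_module A I\<^esub>" unfolding quot_module_simps
      using QI.add.l_cancel_one[of y x] QI.add.r_cancel_one by auto
  qed (simp_all add: quot_module_simps)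
qed


section \<open>Field automorphisms\<close>

lemma field_autsD:
  assumes "f \<in> field_auts (F :: 'l::field set)"
  shows "bij f" "inj f" "additive f" "f 1 = 1" "f 0 = 0" "f (x + y) = f x + f y" "f (x * y) = f x * f y"
    "f (- x) = - f x" "f (x - y) = f x - f y" "f (x / y) = f x / f y" "f (inverse x) = inverse (f x)"
    "f (x ^ j) = f x ^ j" "f x = 0 \<longleftrightarrow> x = 0" "c \<in> F \<Longrightarrow> f c = c"
proof -
  note f = assms[unfolded field_auts_def, simplified]
  show bij: "bij f" and inj: "inj f" using f by (auto simp: bij_is_inj)
  show add: "additive f" using f by (simp add: additive_def)
  show one: "f 1 = 1" and "f (x + y) = f x + f y" and mult: "f (x * y) = f x * f y" for x y using f by auto
  show zero: "f 0 = 0" using additive.zero[OF add] .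
  show "f (- x) = - f x" "f (x - y) = f x - f y"
    using additive.minus[OF add] additive.diff[OF add] by auto
  show inv: "f (inverse x) = inverse (f x)" for x
  proof (cases "x = 0")
    case False
    then have "f x * f (inverse x) = 1" using mult[of x "inverse x"] one by simp
    then show ?thesis by (metis inverse_unique)
  qed (simp add: zero)
  show "f (x / y) = f x / f y" using inv mult by (simp add: divide_inverse)
  show "f (x ^ j) = f x ^ j" by (induction j) (auto simp: one mult)
  show "f x = 0 \<longleftrightarrow> x = 0" using inj zero by (metis injD)
  show "c \<in> F \<Longrightarrow> f c = c" using f by auto
qed

lemma id_field_auts: "id \<in> field_auts F"
  using bij_id by (auto simp: field_auts_def id_def)

lemma field_auts_comp: "f \<in> field_auts F \<Longrightarrow> h \<in> field_auts F \<Longrightarrow> f \<circ> h \<in> field_auts F"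
  by (auto simp: field_auts_def bij_comp)

lemma field_auts_mono: "F \<subseteq> F' \<Longrightarrow> field_auts F' \<subseteq> field_auts F"
  by (auto simp: field_auts_def)

lemma type_ring_inv: "x \<noteq> 0 \<Longrightarrow> inv\<^bsub>type_ring\<^esub> x = inverse (x :: 'a::field)"
proof -
  assume x: "x \<noteq> 0"
  interpret ring "type_ring :: 'a ring" by (rule ring_from_type_algebra)
  show ?thesis using inv_unique'[of x "inverse x"] x by simp
qed

locale frac_generated =
  fixes \<iota> :: "'k::field_char_0 \<Rightarrow> 'l::field" and Y P :: "'l set"
  assumes iota_1: "\<iota> 1 = 1" and iota_add: "\<iota> (a + b) = \<iota> a + \<iota> b" and iota_mult: "\<iota> (a * b) = \<iota> a * \<iota> b"
    and P_gen: "P = generate_ring type_ring (range \<iota> \<union> Y)" and finite_Y: "finite Y"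
    and frac: "\<exists>p\<in>P. \<exists>q\<in>P. q \<noteq> 0 \<and> x = p / q"
begin

lemma subring_P: "subring P type_ring"
  unfolding P_gen by (rule subring_generate_type)

lemmas P_closed = subring_typeD[OF subring_P]

lemma iota_P: "\<iota> c \<in> P" and Y_P: "y \<in> Y \<Longrightarrow> y \<in> P"
  unfolding P_gen by (auto intro: generate_ring.incl)

lemma iota_0: "\<iota> 0 = 0" and iota_uminus: "\<iota> (- a) = - \<iota> a"
proof -
  have add: "additive \<iota>" by (simp add: additive_def iota_add)
  show "\<iota> 0 = 0" "\<iota> (- a) = - \<iota> a" using additive.zero[OF add] additive.minus[OF add] by auto
qed

lemma inj_iota: "inj \<iota>"
proof (rule injI)
  fix a b assume "\<iota> a = \<iota> b"
  then have 0: "\<iota> (a - b) = 0" using iota_add[of a "- b"] iota_uminus by simp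
  show "a = b"
  proof (rule ccontr)
    assume "a \<noteq> b"
    then have "\<iota> (a - b) * \<iota> (inverse (a - b)) = 1" by (simp add: iota_mult[symmetric] iota_1)
    then show False using 0 by simp
  qed
qed

lemma iota_of_nat: "\<iota> (of_nat j) = of_nat j"
  by (induction j) (auto simp: iota_0 iota_1 iota_add)

lemma iota_of_int: "\<iota> (of_int k) = of_int k"
  by (cases k rule: int_cases2) (simp_all add: iota_of_nat iota_uminus)

lemma of_int_P: "of_int k \<in> P"
  using iota_P[of "of_int k"] by (simp add: iota_of_int)

lemma subring_range_iota: "subring (range \<iota>) type_ring"
  unfolding subring_type_iff
proof (intro conjI ballI)
  show "1 \<in> range \<iota>" by (rule range_eqI[of _ _ 1]) (simp add: iota_1)
  show "x + y \<in> range \<iota>" if "x \<in> range \<iota>" "y \<in> range \<iota>" for x y using that by (auto simp: iota_add[symmetric])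
  show "x * y \<in> range \<iota>" if "x \<in> range \<iota>" "y \<in> range \<iota>" for x y using that by (auto simp: iota_mult[symmetric])
  show "- x \<in> range \<iota>" if "x \<in> range \<iota>" for x using that by (auto simp: iota_uminus[symmetric])
qed

text \<open>An automorphism over k is determined on the generators of \<open>P\<close>, hence on
  fractions. The identities between shifts and the action of G are checked in this way, on
  \<open>Y\<close> only.\<close>

lemma aut_eqI:
  assumes f: "f \<in> field_auts (range \<iota>)" "f' \<in> field_auts (range \<iota>)" and eq: "\<And>y. y \<in> Y \<Longrightarrow> f y = f' y"
  shows "f = f'"
proof
  fix x
  note F = field_autsD[OF f(1)] and F' = field_autsD[OF f(2)]
  have fP: "f p = f' p" if "p \<in> P" for p
    using that unfolding P_gen
  proof induction
    case (incl h) then show ?case using eq F(14)[of h] F'(14)[of h] by auto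
  qed (simp_all add: field_autsD(4,6,7,8)[OF f(1)] field_autsD(4,6,7,8)[OF f(2)])
  obtain p q where "p \<in> P" "q \<in> P" "x = p / q" using frac by blast
  then show "f x = f' x" by (simp add: F(10) F'(10) fP)
qed

end

text \<open>The common situation of the torus: \<open>P\<close> is \<open>k[t\<^sub>1,\<dots>,t\<^sub>n]\<close> with generators \<open>Y\<close>, \<open>s q\<close> is the shift by
  \<open>q \<in> Q\<close>, and \<open>E\<close> generates \<open>Q\<close> as a monoid.\<close>

locale shift_action = frac_generated \<iota> Y P
  for \<iota> :: "'k::field_char_0 \<Rightarrow> 'l::field" and Y P :: "'l set" +
  fixes H :: "('q::ab_group_add \<Rightarrow> 'q, 'z) monoid_scheme"
    and \<alpha> :: "('q \<Rightarrow> 'q) \<Rightarrow> 'l \<Rightarrow> 'l" and s :: "'q \<Rightarrow> 'l \<Rightarrow> 'l" and E :: "'q set"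
  assumes group_H: "group H" and finite_H: "finite (carrier H)"
    and mult_H: "g \<in> carrier H \<Longrightarrow> h \<in> carrier H \<Longrightarrow> g \<otimes>\<^bsub>H\<^esub> h = g \<circ> h" and one_H: "\<one>\<^bsub>H\<^esub> = id"
    and add_H: "g \<in> carrier H \<Longrightarrow> g (a' + b') = g a' + g b'"
    and alpha_aut: "g \<in> carrier H \<Longrightarrow> \<alpha> g \<in> field_auts (range \<iota>)"
    and alpha_comp: "g \<in> carrier H \<Longrightarrow> h \<in> carrier H \<Longrightarrow> \<alpha> (g \<circ> h) = \<alpha> g \<circ> \<alpha> h"
    and alpha_P: "g \<in> carrier H \<Longrightarrow> p \<in> P \<Longrightarrow> \<alpha> g p \<in> P"
    and s_aut: "s q \<in> field_auts (range \<iota>)" and s_add: "s (a' + b') = s a' \<circ> s b'" and inj_s: "inj s"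
    and s_P: "p \<in> P \<Longrightarrow> s q p \<in> P"
    and alpha_s: "g \<in> carrier H \<Longrightarrow> \<alpha> g (s q x) = s (g q) (\<alpha> g x)"
    and torsion_free: "q \<noteq> 0 \<Longrightarrow> inj (\<lambda>j. ((+) q ^^ j) 0)"
    and finite_E: "finite E"
    and E_induct: "0 \<in> V \<Longrightarrow> (\<And>e v. e \<in> E \<Longrightarrow> v \<in> V \<Longrightarrow> e + v \<in> V) \<Longrightarrow> q \<in> V"
begin

section \<open>The Galois extension of K, its group and the ring of invariant polynomials\<close>

lemma id_H: "id \<in> carrier H"
  using group.subgroup_self[OF group_H] monoid.one_closed[OF group.is_monoid[OF group_H]] one_H by simp

lemma comp_H: "g \<in> carrier H \<Longrightarrow> h \<in> carrier H \<Longrightarrow> g \<circ> h \<in> carrier H"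
  using monoid.m_closed[OF group.is_monoid[OF group_H]] mult_H by metis

lemma inv_H: "g \<in> carrier H \<Longrightarrow> \<exists>h\<in>carrier H. h \<circ> g = id \<and> g \<circ> h = id"
  using group.inv_closed[OF group_H] group.l_inv[OF group_H] group.r_inv[OF group_H] mult_H one_H by metis

lemma bij_H: "g \<in> carrier H \<Longrightarrow> bij g"
  using inv_H o_bij by metis

text \<open>An injective idempotent map is the identity; the same argument gives
  \<open>s_0\<close>.\<close>

lemma alpha_id: "\<alpha> id = id"
proof
  fix x
  have "\<alpha> id (\<alpha> id x) = \<alpha> id x" using alpha_comp[OF id_H id_H] by (metis comp_apply id_comp)
  then show "\<alpha> id x = id x" using field_autsD(2)[OF alpha_aut[OF id_H]] by (auto dest: injD)
qed

lemma s_0: "s 0 = id"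
proof
  fix x
  have "s 0 (s 0 x) = s 0 x" using s_add[of 0 0] by (metis comp_apply add_0)
  then show "s 0 x = id x" using field_autsD(2)[OF s_aut[of 0]] by (auto dest: injD)
qed

lemma s_minus: "s (- q) (s q x) = x" "s q (s (- q) x) = x"
  using s_add[of "- q" q] s_add[of q "- q"] s_0 by (metis add.left_inverse add.right_inverse comp_apply id_apply)+

text \<open>Conjugation by \<open>\<alpha> g\<close> sends \<open>s q\<close> to
  \<open>s (g q)\<close>. So \<open>\<alpha> g\<close> determines all \<open>s (g q)\<close>, and
  these determine \<open>g\<close> because \<open>s\<close> is injective.\<close>

lemma inj_alpha: "inj_on \<alpha> (carrier H)"
proof (rule inj_onI)
  fix g h assume gh: "g \<in> carrier H" "h \<in> carrier H" "\<alpha> g = \<alpha> h"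
  have "s (g q) x = s (h q) x" for q x
  proof -
    obtain y where "x = \<alpha> g y" using field_autsD(1)[OF alpha_aut[OF gh(1)]] by (metis bij_pointE)
    then show ?thesis using alpha_s[OF gh(1), of q y] alpha_s[OF gh(2), of q y] gh(3) by simp
  qed
  then have "s (g q) = s (h q)" for q by blast
  then show "g = h" using inj_s by (auto simp: inj_eq)
qed

abbreviation "Gs \<equiv> \<alpha> ` carrier H"

sublocale gs: finite_ring_auts Gs
proof
  show "id \<in> Gs" using alpha_id id_H by (metis image_eqI)
  show "g \<circ> h \<in> Gs" if "g \<in> Gs" "h \<in> Gs" for g h
    using that alpha_comp comp_H by (auto intro!: image_eqI[of _ \<alpha>, OF alpha_comp[symmetric]])
qed (use finite_H field_autsD[OF alpha_aut] in auto)

definition \<Gamma> :: "'l set" where "\<Gamma> = P \<inter> fixed_elems (carrier H) \<alpha>"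

definition K :: "'l set" where "K = {a / b | a b. a \<in> \<Gamma> \<and> b \<in> \<Gamma> \<and> b \<noteq> 0}"

lemma Inv_eq: "gs.Inv = fixed_elems (carrier H) \<alpha>"
  by (auto simp: gs.Inv_def fixed_elems_def)

lemma \<Gamma>_eq: "\<Gamma> = P \<inter> gs.Inv"
  by (simp add: \<Gamma>_def Inv_eq)

lemma range_iota_Inv: "range \<iota> \<subseteq> gs.Inv"
  unfolding gs.Inv_def using field_autsD(14)[OF alpha_aut] by auto

lemma subring_\<Gamma>: "subring \<Gamma> type_ring"
  using subring_P gs.subring_Inv unfolding \<Gamma>_eq subring_type_iff by auto

lemmas \<Gamma>_closed = subring_typeD[OF subring_\<Gamma>]

lemma iota_\<Gamma>: "\<iota> c \<in> \<Gamma>" and \<Gamma>_P: "\<Gamma> \<subseteq> P"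
  using range_iota_Inv iota_P unfolding \<Gamma>_eq by auto

lemma card_Gs_inverse: "\<iota> (inverse (of_nat (card Gs))) * of_nat (card Gs) = 1"
proof -
  have "card Gs \<noteq> 0" using gs.finite_Gs gs.id_Gs by auto
  then show ?thesis by (simp add: iota_of_nat[symmetric] iota_mult[symmetric] iota_1)
qed

lemma P_finite_over_\<Gamma>: "\<exists>S. finite S \<and> S \<subseteq> P \<and> P = lspan (lmults \<Gamma>) S"
proof -
  have "\<exists>T S. finite T \<and> T \<subseteq> P \<inter> gs.Inv \<and> finite S \<and> S \<subseteq> P \<and>
      P = lspan (lmults (generate_ring type_ring (range \<iota> \<union> T))) S"
    by (rule gs.finite_over_invariants[OF P_gen finite_Y _ range_iota_Inv]) (auto intro: alpha_P)
  then obtain T S where T: "T \<subseteq> \<Gamma>" and S: "finite S" "S \<subseteq> P"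
    and PS: "P = lspan (lmults (generate_ring type_ring (range \<iota> \<union> T))) S"
    unfolding \<Gamma>_eq by blast
  have "generate_ring type_ring (range \<iota> \<union> T) \<subseteq> \<Gamma>"
    by (rule generate_type_least[OF subring_\<Gamma>]) (use T iota_\<Gamma> in auto)
  then have "lspan (lmults (generate_ring type_ring (range \<iota> \<union> T))) S \<subseteq> lspan (lmults \<Gamma>) S"
    by (intro lspan_mono) (auto simp: lmults_def)
  then have "P \<subseteq> lspan (lmults \<Gamma>) S" by (rule ord_eq_le_trans[OF PS])
  moreover have "lspan (lmults \<Gamma>) S \<subseteq> P" by (rule lspan_lmults_subset[OF subring_P \<Gamma>_P S(2)])
  ultimately show ?thesis using S by (intro exI[of _ S]) simp
qed

lemma \<Gamma>_finitely_generated: "\<exists>T. finite T \<and> T \<subseteq> \<Gamma> \<and> \<Gamma> = generate_ring type_ring (range \<iota> \<union> T)"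
  unfolding \<Gamma>_eq
  by (rule gs.invariants_finitely_generated[OF P_gen finite_Y _ range_iota_Inv _ card_Gs_inverse])
     (auto intro: alpha_P)

lemma noetherian_\<Gamma>: "noetherian_domain (type_ring\<lparr>carrier := \<Gamma>\<rparr>)"
proof (rule noetherian_domainI[OF subring_\<Gamma>])
  obtain T where T: "finite T" "\<Gamma> = generate_ring type_ring (range \<iota> \<union> T)"
    using \<Gamma>_finitely_generated by blast
  have "\<exists>b\<in>range \<iota>. b * a = 1" if "a \<in> range \<iota>" "a \<noteq> 0" for a
  proof -
    obtain c where c: "a = \<iota> c" using \<open>a \<in> range \<iota>\<close> by blast
    then have "c \<noteq> 0" using that(2) iota_0 by auto
    then have "\<iota> (inverse c) * a = 1" using c by (simp add: iota_mult[symmetric] iota_1)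
    then show ?thesis by blast
  qed
  then have "noeth (range \<iota>)" by (rule noeth_field[OF subring_range_iota])
  then show "noeth \<Gamma>" unfolding T(2) by (rule noeth_generate[OF subring_range_iota _ T(1)])
qed

text \<open>The cofactor \<open>q'\<close> is the product of the other conjugates of
  \<open>q\<close>, which makes \<open>q * q'\<close> the norm. Denominators can thus be moved into
  \<open>\<Gamma>\<close>.\<close>

lemma norm_ex:
  assumes "q \<in> P" "q \<noteq> 0"
  shows "\<exists>q'\<in>P. q * q' \<in> \<Gamma> \<and> q * q' \<noteq> 0"
proof -
  have split: "(\<Prod>g\<in>Gs. g q) = q * (\<Prod>g\<in>Gs - {id}. g q)"
    using prod.remove[OF gs.finite_Gs gs.id_Gs, of "\<lambda>g. g q"] by simp
  have "h (\<Prod>g\<in>Gs. g q) = (\<Prod>g\<in>Gs. g q)" if h: "h \<in> Gs" for h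
  proof -
    have "h (prod f V) = (\<Prod>v\<in>V. h (f v))" for f :: "('l \<Rightarrow> 'l) \<Rightarrow> 'l" and V
      by (induction V rule: infinite_finite_induct) (simp_all add: gs.mult_Gs[OF h] gs.one_Gs[OF h])
    then have "h (\<Prod>g\<in>Gs. g q) = (\<Prod>g\<in>Gs. (\<lambda>g. g q) (h \<circ> g))" by simp
    also have "\<dots> = (\<Prod>g\<in>Gs. g q)" by (rule prod.reindex_bij_betw[OF gs.bij_comp[OF h]])
    finally show ?thesis .
  qed
  moreover have "(\<Prod>g\<in>Gs. g q) \<in> P" "(\<Prod>g\<in>Gs - {id}. g q) \<in> P"
    by (rule P_closed(9), use assms alpha_P in auto)+
  moreover have "(\<Prod>g\<in>Gs. g q) \<noteq> 0"
    using gs.finite_Gs field_autsD(13)[OF alpha_aut] assms(2) by auto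
  ultimately show ?thesis unfolding \<Gamma>_eq gs.Inv_def split by (intro bexI[of _ "\<Prod>g\<in>Gs - {id}. g q"]) auto
qed

lemma frac_\<Gamma>: "\<exists>p\<in>P. \<exists>d\<in>\<Gamma>. d \<noteq> 0 \<and> x = p / d"
proof -
  obtain p q where pq: "p \<in> P" "q \<in> P" "q \<noteq> 0" "x = p / q" using frac by blast
  obtain q' where q': "q' \<in> P" "q * q' \<in> \<Gamma>" "q * q' \<noteq> 0" using norm_ex pq by blast
  then have "x = (p * q') / (q * q')" using pq by auto
  then show ?thesis using pq q' P_closed(6) by blast
qed

text \<open>Once the denominator of an invariant fraction is invariant, so is its numerator.\<close>

lemma K_eq_Inv: "K = gs.Inv"
proof
  show "K \<subseteq> gs.Inv"
    unfolding K_def \<Gamma>_eq gs.Inv_def using field_autsD(10)[OF alpha_aut] by auto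
  show "gs.Inv \<subseteq> K"
  proof
    fix x assume x: "x \<in> gs.Inv"
    obtain p d where pd: "p \<in> P" "d \<in> \<Gamma>" "d \<noteq> 0" "x = p / d" using frac_\<Gamma> by blast
    then have "p = x * d" by simp
    moreover have "x * d \<in> gs.Inv"
      using pd(2) x subring_typeD(6)[OF gs.subring_Inv] unfolding \<Gamma>_eq by blast
    ultimately have "p \<in> \<Gamma>" using pd(1) unfolding \<Gamma>_eq by simp
    then show "x \<in> K" unfolding K_def using pd by blast
  qed
qed

lemma \<Gamma>_K: "\<Gamma> \<subseteq> K"
  unfolding K_eq_Inv \<Gamma>_eq by auto

lemma range_iota_K: "range \<iota> \<subseteq> K"
  using iota_\<Gamma> \<Gamma>_K by auto

lemma subring_K: "subring K type_ring"
  unfolding K_eq_Inv by (rule gs.subring_Inv)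

lemma inverse_K: "x \<in> K \<Longrightarrow> inverse x \<in> K"
  unfolding K_eq_Inv gs.Inv_def using field_autsD(11)[OF alpha_aut] by auto

lemma subfield_K: "subfield K type_ring"
proof -
  interpret field "type_ring :: 'l ring" by (rule field_from_type_algebra)
  show ?thesis by (rule subfieldI'[OF subring_K]) (auto simp: type_ring_inv inverse_K)
qed

text \<open>Every element of L has a denominator in \<open>\<Gamma>\<close>, so a finite set
  spanning \<open>P\<close> over \<open>\<Gamma>\<close> spans L over \<open>K\<close>.\<close>

lemma finite_dimension_K: "ring.finite_dimension type_ring K UNIV"
proof -
  interpret field "type_ring :: 'l ring" by (rule field_from_type_algebra)
  obtain S where S: "finite S" "P = lspan (lmults \<Gamma>) S" using P_finite_over_\<Gamma> by blast
  obtain Us where Us: "set Us = S" using finite_list[OF S(1)] by blast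
  have [simp]: "set Us \<subseteq> carrier (type_ring :: 'l ring)" by simp
  note sub = Span_subgroup_props[OF subfield_K, of Us, simplified] Span_smult_closed[OF subfield_K, of Us, simplified]
  have "lspan (lmults \<Gamma>) S \<subseteq> Span K Us"
  proof (rule lspan_least)
    fix a u assume "a \<in> lmults \<Gamma>" "u \<in> S"
    then obtain \<gamma> where \<gamma>: "\<gamma> \<in> K" "a = (*) \<gamma>" "u \<in> Span K Us"
      using \<Gamma>_K Span_base_incl[OF subfield_K, of Us] Us unfolding lmults_def by auto
    then show "a u \<in> Span K Us"
      using Span_smult_closed[OF subfield_K _ \<gamma>(1,3)] by simp
  qed (use sub in auto)
  then have P_Span: "P \<subseteq> Span K Us" by (rule ord_eq_le_trans[OF S(2)])
  have "x \<in> Span K Us" for x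
  proof -
    obtain p d where pd: "p \<in> P" "d \<in> \<Gamma>" "d \<noteq> 0" "x = p / d" using frac_\<Gamma> by blast
    then have "x = inverse d * p" by (simp add: field_simps)
    moreover have "inverse d \<in> K" "p \<in> Span K Us" using pd inverse_K \<Gamma>_K P_Span by auto
    ultimately show ?thesis using Span_smult_closed[OF subfield_K, of Us "inverse d" p] by simp
  qed
  then have "Span K Us = UNIV" by blast
  then show ?thesis using Span_finite_dimension[OF subfield_K, of Us] by simp
qed

text \<open>Artin's theorem: \<open>f x\<close> is a root of the polynomial with roots \<open>g x\<close>, so it is one of them.
  A pigeonhole argument along the curve \<open>c \<mapsto> \<Sum>\<^sub>i c\<^sup>i t\<^sub>i\<close> makes \<open>g\<close> independent of \<open>x\<close>.\<close>

lemma field_auts_K: "field_auts K = Gs"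
proof
  show "Gs \<subseteq> field_auts K"
  proof
    fix f assume f: "f \<in> Gs"
    then have "f \<in> field_auts (range \<iota>)" using alpha_aut by auto
    then show "f \<in> field_auts K" using f unfolding field_auts_def K_eq_Inv gs.Inv_def by auto
  qed
  show "field_auts K \<subseteq> Gs"
  proof
    fix f assume fK: "f \<in> field_auts K"
    note F = field_autsD[OF fK]
    have f_aut: "f \<in> field_auts (range \<iota>)" using fK field_auts_mono[OF range_iota_K] by blast
    have ex: "\<exists>h\<in>Gs. f x = h x" for x
    proof -
      define R where "R = rootpoly ({()} \<times> Gs) (\<lambda>(z, h). h x)"
      have fin: "finite ({()} \<times> Gs)" using gs.finite_Gs by simp
      have coeffs: "f (coeff R j) = coeff R j" for j
        using gs.rootpoly_coeff_Inv[of "{()}" "\<lambda>_. x" j] F(14)[of "coeff R j"] unfolding K_eq_Inv R_def by simp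
      have poly_R: "poly R z = (\<Sum>j\<le>degree R. coeff R j * z ^ j)" for z by (rule poly_altdef)
      have "poly R x = 0"
        unfolding R_def rootpoly_def poly_prod
        by (rule prod_zero[OF fin], rule bexI[of _ "((), id)"]) (use gs.id_Gs in auto)
      then have "f (poly R x) = 0" using F(5) by simp
      then have "poly R (f x) = 0"
        unfolding poly_R additive.sum[OF F(3)] by (simp add: F(7,12) coeffs)
      then show ?thesis
        unfolding R_def rootpoly_def poly_prod using fin by (auto simp: prod_zero_iff)
    qed
    obtain ys where ys: "set ys = Y" using finite_list[OF finite_Y] by blast
    define curve where "curve c = (\<Sum>i<length ys. c ^ i * ys ! i)" for c
    have "\<forall>c. \<exists>h. h \<in> Gs \<and> f (curve c) = h (curve c)" using ex by blast
    from choice[OF this] obtain h where h: "\<And>c. h c \<in> Gs \<and> f (curve c) = h c (curve c)" by blast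
    have inf: "infinite (range \<iota>)" using finite_imageD[OF _ inj_iota] infinite_UNIV_char_0 by blast
    have "finite (h ` range \<iota>)" by (rule finite_subset[OF _ gs.finite_Gs]) (use h in auto)
    then obtain c0 where inf': "infinite {c \<in> range \<iota>. h c = h c0}"
      using pigeonhole_infinite[OF inf] by blast
    have hG: "h c0 \<in> Gs" using h by blast
    then have h_aut: "h c0 \<in> field_auts (range \<iota>)" using alpha_aut by auto
    note FH = field_autsD[OF h_aut]
    \<comment> \<open>Its value at \<open>c\<close> is \<open>f (curve c) - h c0 (curve c)\<close>
      when both automorphisms fix \<open>c\<close>, as they do for \<open>c\<close> in k. Infinitely
      many zeros force its coefficients, the differences on the generators, to vanish.\<close>
    define D where "D = (\<Sum>i<length ys. monom (f (ys ! i) - h c0 (ys ! i)) i)"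
    have "poly D c = 0" if c: "c \<in> range \<iota>" "h c = h c0" for c
    proof -
      have "f (curve c) = (\<Sum>i<length ys. c ^ i * f (ys ! i))"
        unfolding curve_def additive.sum[OF F(3)]
        using field_autsD(14)[OF f_aut c(1)] by (simp add: F(7,12))
      moreover have "h c0 (curve c) = (\<Sum>i<length ys. c ^ i * h c0 (ys ! i))"
        unfolding curve_def additive.sum[OF FH(3)] using FH(14)[OF c(1)] by (simp add: FH(7,12))
      moreover have "f (curve c) = h c0 (curve c)" using h[of c] c(2) by simp
      ultimately have "(\<Sum>i<length ys. c ^ i * (f (ys ! i) - h c0 (ys ! i))) = 0"
        by (simp add: right_diff_distrib sum_subtractf)
      then show ?thesis unfolding D_def by (simp add: poly_sum poly_monom mult.commute)
    qed
    then have "{c \<in> range \<iota>. h c = h c0} \<subseteq> {c. poly D c = 0}" by blast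
    then have "infinite {c. poly D c = 0}" using inf' by (rule infinite_super)
    then have "D = 0" using poly_roots_finite[of D] by auto
    have "f y = h c0 y" if "y \<in> Y" for y
    proof -
      have "y \<in> set ys" using that ys by simp
      then obtain i where i: "i < length ys" "y = ys ! i" by (auto simp: in_set_conv_nth)
      have "coeff D i = f (ys ! i) - h c0 (ys ! i)"
        unfolding D_def coeff_sum using i(1) by (simp add: coeff_monom)
      then show ?thesis using \<open>D = 0\<close> i by simp
    qed
    then have "f = h c0" by (rule aut_eqI[OF f_aut h_aut])
    then show "f \<in> Gs" using hG by simp
  qed
qed

lemma finite_galois_K: "finite_galois K H \<alpha>"
  unfolding finite_galois_def
proof (intro conjI subfield_K finite_dimension_K group_H finite_H)
  show "fixed_elems (carrier H) \<alpha> = K" by (simp add: K_eq_Inv Inv_eq)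
  show "\<alpha> \<in> iso H (aut_group K)"
    unfolding iso_def hom_def bij_betw_def
    using inj_alpha by (auto simp: aut_group_def field_auts_K mult_H alpha_comp)
qed

text \<open>The shift by \<open>c = a - b\<close> fixes \<open>K\<close>, so the shifts by all
  multiples of \<open>c\<close> belong to the finite group \<open>Gs\<close> of automorphisms over
  \<open>K\<close>. With \<open>s\<close> injective and Q torsion free this leaves only
  \<open>c = 0\<close>.\<close>

lemma s_separating:
  assumes "\<And>x. x \<in> K \<Longrightarrow> s a x = s b x"
  shows "s a = s b"
proof -
  define c where "c = a - b"
  have "s c x = x" if "x \<in> K" for x
  proof -
    have "s b (s c x) = s b x" using assms[OF that] s_add[of b c] by (simp add: c_def fun_eq_iff)
    then show ?thesis using field_autsD(2)[OF s_aut[of b]] by (auto dest: injD)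
  qed
  then have c: "s c \<in> field_auts K" using s_aut[of c] by (auto simp: field_auts_def)
  have "s (((+) c ^^ j) 0) \<in> field_auts K" for j
  proof (induction j)
    case 0
    have "((+) c ^^ 0) 0 = 0" by simp
    then show ?case using id_field_auts s_0 by metis
  next
    case (Suc j)
    have eq: "s (((+) c ^^ Suc j) 0) = s c \<circ> s (((+) c ^^ j) 0)" by (simp add: s_add)
    show ?case unfolding eq by (rule field_auts_comp[OF c Suc])
  qed
  then have "finite (range (\<lambda>j. s (((+) c ^^ j) 0)))"
    using gs.finite_Gs unfolding field_auts_K by (auto intro: finite_subset)
  then have "\<not> inj (\<lambda>j. s (((+) c ^^ j) 0))" using finite_imageD[of _ UNIV] by blast
  then have "\<not> inj (\<lambda>j. ((+) c ^^ j) 0)" using inj_s by (auto simp: inj_def)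
  then have "c = 0" using torsion_free by blast
  then show ?thesis by (simp add: c_def)
qed

end


section \<open>Group algebras\<close>

lemma algebra_act_supset:
  "finite A \<Longrightarrow> keys f \<subseteq> A \<Longrightarrow> algebra_act g f = (\<Sum>q\<in>A. single (g q) (lookup f q))"
  unfolding algebra_act_def by (rule sum.mono_neutral_left) (auto simp: in_keys_iff)

lemma algebra_act_add: "algebra_act g (f + h) = algebra_act g f + algebra_act g h"
proof -
  note s = algebra_act_supset[where A = "keys f \<union> keys h" and g = g]
  show ?thesis using keys_add[of f h]
    by (simp add: s[of f] s[of h] s[of "f + h"] lookup_add single_add sum.distrib)
qed

lemma algebra_act_zero [simp]: "algebra_act g 0 = 0"
  by (simp add: algebra_act_def)

lemma algebra_act_single: "algebra_act g (single q c) = single (g q) c"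
  by (subst algebra_act_supset[of "{q}"]) auto

lemma algebra_act_comp: "algebra_act g (algebra_act h f) = algebra_act (g \<circ> h) f"
  by (induction f rule: poly_mapping_additive_induct) (auto simp: algebra_act_add algebra_act_single)

lemma algebra_act_id: "algebra_act id f = f"
  by (induction f rule: poly_mapping_additive_induct) (auto simp: algebra_act_add algebra_act_single)

lemma algebra_act_mult:
  assumes "\<And>a b. g (a + b) = g a + g b"
  shows "algebra_act g (f * h) = algebra_act g f * algebra_act g h"
proof (induction f rule: poly_mapping_additive_induct)
  case (single q a)
  show ?case
    by (induction h rule: poly_mapping_additive_induct)
       (auto simp: algebra_act_add algebra_act_single distrib_left mult_single assms)
qed (auto simp: algebra_act_add distrib_right)

context shift_action
begin

lemma H_0: "g \<in> carrier H \<Longrightarrow> g 0 = 0"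
  using add_H[of g 0 0] by simp

lemma finite_ring_auts_algebra_act:
  "finite_ring_auts ((algebra_act :: _ \<Rightarrow> ('q \<Rightarrow>\<^sub>0 'k) \<Rightarrow> _) ` carrier H)" (is "finite_ring_auts ?A")
proof
  show "finite ?A" using finite_H by simp
  show "id \<in> ?A" by (rule image_eqI[of _ _ id]) (auto simp: algebra_act_id id_H fun_eq_iff)
  show "f \<circ> f' \<in> ?A" if "f \<in> ?A" "f' \<in> ?A" for f f'
  proof -
    obtain g h where "g \<in> carrier H" "h \<in> carrier H" "f = algebra_act g" "f' = algebra_act h" using \<open>f \<in> ?A\<close> \<open>f' \<in> ?A\<close> by blast
    then show ?thesis
      by (intro image_eqI[of _ _ "g \<circ> h"]) (auto simp: algebra_act_comp comp_H fun_eq_iff)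
  qed
  show "inj f" if f: "f \<in> ?A" for f
  proof -
    obtain g where g: "g \<in> carrier H" "f = algebra_act g" using f by blast
    obtain h where "h \<circ> g = id" using inv_H[OF g(1)] by blast
    then have "algebra_act h (f x) = x" for x by (simp add: g(2) algebra_act_comp algebra_act_id)
    then show "inj f" by (metis injI)
  qed
  show "f (x + y) = f x + f y" if "f \<in> ?A" for f x y using that by (auto simp: algebra_act_add)
  show "f (x * y) = f x * f y" if f: "f \<in> ?A" for f x y
  proof -
    obtain g where "g \<in> carrier H" "f = algebra_act g" using f by blast
    then show ?thesis using algebra_act_mult[of g x y] add_H by simp
  qed
  show "f 1 = 1" if "f \<in> ?A" for f
    using that by (auto simp: single_one[symmetric] algebra_act_single H_0 simp del: single_one)
qed

lemma group_algebra_generated: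
  "UNIV = generate_ring type_ring (range (single 0) \<union> (\<lambda>e. single e 1) ` E :: ('q \<Rightarrow>\<^sub>0 'k) set)"
proof -
  define R where "R = generate_ring type_ring (range (single 0) \<union> (\<lambda>e. single e 1) ` E :: ('q \<Rightarrow>\<^sub>0 'k) set)"
  have R: "subring R type_ring" unfolding R_def by (rule subring_generate_type)
  have c: "single 0 c \<in> R" for c unfolding R_def by (rule generate_ring.incl) auto
  have e: "single e 1 \<in> R" if "e \<in> E" for e unfolding R_def by (rule generate_ring.incl) (use that in auto)
  have "q \<in> {q. single q (1 :: 'k) \<in> R}" for q
  proof (rule E_induct)
    show "0 \<in> {q. single q (1 :: 'k) \<in> R}" using c[of 1] by (simp del: single_one)
    show "e' + v \<in> {q. single q (1 :: 'k) \<in> R}" if "e' \<in> E" "v \<in> {q. single q (1 :: 'k) \<in> R}" for e' v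
      using subring_typeD(6)[OF R e[OF that(1)], of "single v 1"] that(2) by (simp add: mult_single)
  qed
  then have q: "single q (1 :: 'k) \<in> R" for q by simp
  have "single q a \<in> R" for q a
    using subring_typeD(6)[OF R c[of a] q[of q]] by (simp add: mult_single)
  then have "f \<in> R" for f
    by (induction f rule: poly_mapping_additive_induct) (use subring_typeD[OF R] in auto)
  then show ?thesis unfolding R_def by auto
qed

section \<open>The action on the skew group ring\<close>

definition M :: "('l \<Rightarrow> 'l) set" where "M = range s"

lemma s_M: "s q \<in> M"
  by (simp add: M_def)

sublocale sk: aut_monoid M
proof
  show "id \<in> M" unfolding M_def using s_0 by (metis rangeI)
  show "m \<circ> m' \<in> M" if "m \<in> M" "m' \<in> M" for m m'
    using that unfolding M_def by (auto simp: s_add[symmetric])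
qed (use field_autsD[OF s_aut] in \<open>auto simp: M_def\<close>)

lemmas alphaD = field_autsD[OF alpha_aut]

lemma conj_s: "g \<in> carrier H \<Longrightarrow> \<alpha> g \<circ> s q \<circ> inv_into UNIV (\<alpha> g) = s (g q)"
  using alphaD(1)[of g] by (auto simp: fun_eq_iff alpha_s bij_is_surj surj_f_inv_f)

lemma act_single: "g \<in> carrier H \<Longrightarrow> skew_act \<alpha> g (single (s q) a) = single (s (g q)) (\<alpha> g a)"
  by (simp add: skew_act_single[of \<alpha> g] alphaD conj_s)

lemma act_add: "g \<in> carrier H \<Longrightarrow> skew_act \<alpha> g (u + v) = skew_act \<alpha> g u + skew_act \<alpha> g v"
  using additive.add[OF additive_skew_act[of \<alpha> g]] alphaD(3) by blast

lemma act_zero: "skew_act \<alpha> g 0 = 0"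
  by (simp add: skew_act_def)

lemma act_uminus: "g \<in> carrier H \<Longrightarrow> skew_act \<alpha> g (- u) = - skew_act \<alpha> g u"
  using additive.minus[OF additive_skew_act[of \<alpha> g]] alphaD(3) by blast

lemma act_closed:
  assumes g: "g \<in> carrier H" and u: "u \<in> sk.Sk"
  shows "skew_act \<alpha> g u \<in> sk.Sk"
  using u
proof (induction u rule: sk.Sk_induct)
  case (single m a)
  then obtain q where "m = s q" by (auto simp: M_def)
  then show ?case using sk.Sk_simps(4)[OF s_M] by (simp add: act_single[OF g])
qed (simp_all add: act_zero act_add[OF g] sk.Sk_simps(2) sk.Sk_add)

lemma act_mult:
  "g \<in> carrier H \<Longrightarrow> u \<in> sk.Sk \<Longrightarrow> v \<in> sk.Sk \<Longrightarrow>
    skew_act \<alpha> g (skew_mult u v) = skew_mult (skew_act \<alpha> g u) (skew_act \<alpha> g v)"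
  by (rule sk.skew_act_mult) (auto simp: alphaD M_def conj_s)

lemma act_comp:
  assumes g: "g \<in> carrier H" and h: "h \<in> carrier H" and u: "u \<in> sk.Sk"
  shows "skew_act \<alpha> g (skew_act \<alpha> h u) = skew_act \<alpha> (g \<circ> h) u"
  using u
proof (induction u rule: sk.Sk_induct)
  case (single m a)
  then obtain q where "m = s q" by (auto simp: M_def)
  have "skew_act \<alpha> (g \<circ> h) (single (s q) a) = single (s ((g \<circ> h) q)) (\<alpha> (g \<circ> h) a)"
    by (rule act_single[OF comp_H[OF g h]])
  also have "\<dots> = single (s (g (h q))) (\<alpha> g (\<alpha> h a))" by (simp add: alpha_comp[OF g h])
  finally show ?case unfolding \<open>m = s q\<close> act_single[OF h] act_single[OF g] by (rule sym)
next
  case (add u v)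
  then show ?case by (simp only: act_add[OF g] act_add[OF h] act_add[OF comp_H[OF g h]])
qed (simp add: act_zero)

lemma const_s: "skew_const a = single (s 0) a"
  by (simp add: skew_const_def s_0)

lemma act_const: "g \<in> carrier H \<Longrightarrow> skew_act \<alpha> g (skew_const a) = skew_const (\<alpha> g a)"
  by (simp add: const_s act_single H_0)

text \<open>The skew group ring of \<open>P\<close>, the counterpart of D(k[Q]); its invariants
  \<open>U\<close> are the counterpart of the invariant differential operators.\<close>

definition PM :: "'l skew set" where "PM = {u \<in> sk.Sk. \<forall>m. lookup u m \<in> P}"

definition U :: "'l skew set" where "U = PM \<inter> fixed_elems (carrier H) (skew_act \<alpha>)"

lemma PM_Sk: "u \<in> PM \<Longrightarrow> u \<in> sk.Sk"
  by (simp add: PM_def)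

lemma PM_closed: "0 \<in> PM" "u \<in> PM \<Longrightarrow> v \<in> PM \<Longrightarrow> u + v \<in> PM" "u \<in> PM \<Longrightarrow> - u \<in> PM"
    "u \<in> PM \<Longrightarrow> v \<in> PM \<Longrightarrow> skew_mult u v \<in> PM" "p \<in> P \<Longrightarrow> single (s q) p \<in> PM" "p \<in> P \<Longrightarrow> skew_const p \<in> PM"
proof -
  show "0 \<in> PM" "u \<in> PM \<Longrightarrow> v \<in> PM \<Longrightarrow> u + v \<in> PM" "u \<in> PM \<Longrightarrow> - u \<in> PM"
    using P_closed(2,3,4) sk.Sk_simps(2,3) sk.Sk_add by (simp_all add: PM_def lookup_add)
  show "p \<in> P \<Longrightarrow> single (s q) p \<in> PM" "p \<in> P \<Longrightarrow> skew_const p \<in> PM"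
    using P_closed(2) sk.Sk_simps(4)[OF s_M] by (simp_all add: PM_def const_s lookup_single when_def)
  assume u: "u \<in> PM" and v: "v \<in> PM"
  have mP: "m x \<in> P" if m: "m \<in> keys u" and x: "x \<in> P" for m x
  proof -
    have "m \<in> M" using m u unfolding PM_def sk.Sk_def by auto
    then show ?thesis using s_P x unfolding M_def by auto
  qed
  then have "lookup (skew_mult u v) m \<in> P" for m
    unfolding skew_mult_def lookup_sum lookup_single when_def
    using u v P_closed(2,6) by (intro P_closed(8)) (simp add: PM_def mP)
  then show "skew_mult u v \<in> PM" using sk.skew_mult_closed[of u v] u v by (simp add: PM_def)
qed

lemma act_PM:
  assumes "g \<in> carrier H" "u \<in> PM"
  shows "skew_act \<alpha> g u \<in> PM"
proof -
  have "lookup (skew_act \<alpha> g u) m \<in> P" for m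
    unfolding skew_act_def lookup_sum lookup_single when_def
    using assms alpha_P P_closed(2) by (intro P_closed(8)) (simp add: PM_def)
  then show ?thesis using act_closed[OF assms(1) PM_Sk[OF assms(2)]] by (simp add: PM_def)
qed

lemma UD: "u \<in> U \<Longrightarrow> u \<in> PM" "u \<in> U \<Longrightarrow> u \<in> sk.Sk" "u \<in> U \<Longrightarrow> g \<in> carrier H \<Longrightarrow> skew_act \<alpha> g u = u"
  by (auto simp: U_def PM_def fixed_elems_def)

lemma UI: "u \<in> PM \<Longrightarrow> (\<And>g. g \<in> carrier H \<Longrightarrow> skew_act \<alpha> g u = u) \<Longrightarrow> u \<in> U"
  by (auto simp: U_def fixed_elems_def)

lemma U_closed: "0 \<in> U" "u \<in> U \<Longrightarrow> v \<in> U \<Longrightarrow> u + v \<in> U" "u \<in> U \<Longrightarrow> - u \<in> U"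
    "u \<in> U \<Longrightarrow> v \<in> U \<Longrightarrow> skew_mult u v \<in> U" "\<gamma> \<in> \<Gamma> \<Longrightarrow> skew_const \<gamma> \<in> U"
proof -
  show "0 \<in> U" by (rule UI) (auto simp: act_zero PM_closed)
  show "\<gamma> \<in> \<Gamma> \<Longrightarrow> skew_const \<gamma> \<in> U"
    by (rule UI) (simp_all add: act_const \<Gamma>_def fixed_elems_def PM_closed)
  assume u: "u \<in> U"
  show "- u \<in> U"
    by (rule UI) (simp_all add: act_uminus UD(3)[OF u] PM_closed(3) UD(1)[OF u])
  assume v: "v \<in> U"
  show "u + v \<in> U"
    by (rule UI) (simp_all add: act_add UD(3)[OF u] UD(3)[OF v] PM_closed(2) UD(1)[OF u] UD(1)[OF v])
  show "skew_mult u v \<in> U"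
    by (rule UI)
       (simp_all add: act_mult UD(2,3)[OF u] UD(2,3)[OF v] PM_closed(4) UD(1)[OF u] UD(1)[OF v])
qed

lemma skew_ring_uminus: "u \<in> sk.Sk \<Longrightarrow> \<ominus>\<^bsub>skew_ring M\<^esub> u = - u"
  using abelian_group.minus_equality[OF ring.is_abelian_group[OF sk.ring_skew_ring], of "- u" u]
  by (simp add: sk.Sk_simps)

lemma subring_U: "subring U (skew_ring M)"
proof (rule ring.subringI[OF sk.ring_skew_ring])
  show "\<one>\<^bsub>skew_ring M\<^esub> \<in> U"
    using U_closed(5)[OF \<Gamma>_closed(1)] by (simp add: skew_const_def)
qed (use UD(2) U_closed(2-4) in \<open>auto simp: sk.Sk_simps(1) skew_ring_uminus\<close>)

definition tr :: "'l skew \<Rightarrow> 'l skew" where "tr u = (\<Sum>g\<in>carrier H. skew_act \<alpha> g u)"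

lemma bij_comp_H: "g \<in> carrier H \<Longrightarrow> bij_betw ((\<circ>) g) (carrier H) (carrier H)"
proof -
  assume g: "g \<in> carrier H"
  have inj: "inj_on ((\<circ>) g) (carrier H)"
    by (rule inj_onI) (use bij_H[OF g] in \<open>auto simp: fun_eq_iff bij_is_inj inj_eq\<close>)
  moreover have "(\<circ>) g ` carrier H = carrier H"
    by (rule endo_inj_surj[OF finite_H _ inj]) (use comp_H g in auto)
  ultimately show ?thesis by (simp add: bij_betw_def)
qed

lemma act_sum: "g \<in> carrier H \<Longrightarrow> skew_act \<alpha> g (sum f I) = (\<Sum>i\<in>I. skew_act \<alpha> g (f i))"
  using additive.sum[OF additive_skew_act[of \<alpha> g]] alphaD(3) by blast

lemma tr_U:
  assumes "u \<in> PM"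
  shows "tr u \<in> U"
proof (rule UI)
  have sum_PM: "sum f I \<in> PM" if "\<And>i. i \<in> I \<Longrightarrow> f i \<in> PM" for f :: "('q \<Rightarrow> 'q) \<Rightarrow> 'l skew" and I
    using that by (induction I rule: infinite_finite_induct) (auto intro: PM_closed)
  show "tr u \<in> PM" unfolding tr_def by (rule sum_PM) (rule act_PM[OF _ assms])
  fix g assume g: "g \<in> carrier H"
  have "skew_act \<alpha> g (tr u) = (\<Sum>h\<in>carrier H. skew_act \<alpha> (g \<circ> h) u)"
    unfolding tr_def act_sum[OF g] by (rule sum.cong) (simp_all add: act_comp g PM_Sk[OF assms])
  also have "\<dots> = tr u" unfolding tr_def by (rule sum.reindex_bij_betw[OF bij_comp_H[OF g]])
  finally show "skew_act \<alpha> g (tr u) = tr u" .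
qed

lemma tr_add: "tr (u + v) = tr u + tr v"
  unfolding tr_def sum.distrib[symmetric] by (rule sum.cong) (auto simp: act_add)

lemma tr_mult_left:
  assumes "u \<in> U" "v \<in> PM"
  shows "tr (skew_mult u v) = skew_mult u (tr v)"
proof -
  have "additive (skew_mult u)" using sk.skew_mult_add_right[OF UD(2)[OF assms(1)]] by (simp add: additive_def)
  then have "skew_mult u (tr v) = (\<Sum>g\<in>carrier H. skew_mult u (skew_act \<alpha> g v))"
    unfolding tr_def by (rule additive.sum)
  also have "\<dots> = tr (skew_mult u v)"
    unfolding tr_def by (rule sum.cong) (simp_all add: act_mult UD[OF assms(1)] PM_Sk[OF assms(2)])
  finally show ?thesis by simp
qed

lemma tr_mult_right:
  assumes "u \<in> U" "v \<in> PM"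
  shows "tr (skew_mult v u) = skew_mult (tr v) u"
proof -
  have sum_mult: "skew_mult (sum f I) u = (\<Sum>i\<in>I. skew_mult (f i) u)"
    if "\<And>i. i \<in> I \<Longrightarrow> f i \<in> sk.Sk" for f :: "('q \<Rightarrow> 'q) \<Rightarrow> 'l skew" and I
    using that by (induction I rule: infinite_finite_induct) (auto simp: sk.skew_mult_add_left sk.Sk_sum)
  have "skew_mult (tr v) u = (\<Sum>g\<in>carrier H. skew_mult (skew_act \<alpha> g v) u)"
    unfolding tr_def by (rule sum_mult) (rule act_closed[OF _ PM_Sk[OF assms(2)]])
  also have "\<dots> = tr (skew_mult v u)"
    unfolding tr_def by (rule sum.cong) (simp_all add: act_mult UD[OF assms(1)] PM_Sk[OF assms(2)])
  finally show ?thesis by simp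
qed

lemma U_eq_tr:
  assumes "u \<in> U"
  shows "u = skew_mult (skew_const (\<iota> (inverse (of_nat (card Gs))))) (tr u)"
proof (rule poly_mapping_eqI)
  fix m
  have "tr u = (\<Sum>g\<in>carrier H. u)" unfolding tr_def by (rule sum.cong) (simp_all add: UD(3)[OF assms])
  \<comment> \<open>The trace runs over \<open>carrier H\<close> while the inverse was taken of
    \<open>card Gs\<close>; the two orders agree because \<open>\<alpha>\<close> is
    faithful.\<close>
  then have "lookup (tr u) m = of_nat (card Gs) * lookup u m"
    using card_image[OF inj_alpha] by (simp add: lookup_sum)
  then show "lookup u m = lookup (skew_mult (skew_const (\<iota> (inverse (of_nat (card Gs))))) (tr u)) m"
    using card_Gs_inverse UD(2)[OF tr_U[OF UD(1)[OF assms]]]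
    by (simp add: sk.lookup_const_mult mult.assoc[symmetric])
qed

section \<open>Finite generation of the invariant ring\<close>

text \<open>The embedding of k[Q] into the skew group ring, the counterpart of multiplication
  operators. It is multiplicative because shifts fix k.\<close>

definition \<Phi> :: "('q \<Rightarrow>\<^sub>0 'k) \<Rightarrow> 'l skew" where "\<Phi> f = (\<Sum>q\<in>keys f. single (s q) (\<iota> (lookup f q)))"

lemma \<Phi>_supset:
  "finite A \<Longrightarrow> keys f \<subseteq> A \<Longrightarrow> \<Phi> f = (\<Sum>q\<in>A. single (s q) (\<iota> (lookup f q)))"
  unfolding \<Phi>_def by (rule sum.mono_neutral_left) (auto simp: in_keys_iff iota_0)

lemma \<Phi>_add: "\<Phi> (f + h) = \<Phi> f + \<Phi> h"
proof -
  note s = \<Phi>_supset[where A = "keys f \<union> keys h"]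
  show ?thesis using keys_add[of f h]
    by (simp add: s[of f] s[of h] s[of "f + h"] lookup_add iota_add single_add sum.distrib)
qed

lemma \<Phi>_zero [simp]: "\<Phi> 0 = 0"
  by (simp add: \<Phi>_def)

lemma \<Phi>_uminus: "\<Phi> (- f) = - \<Phi> f"
  using \<Phi>_add[of f "- f"] by (simp add: eq_neg_iff_add_eq_0 add.commute)

lemma \<Phi>_single: "\<Phi> (single q c) = single (s q) (\<iota> c)"
  by (subst \<Phi>_supset[of "{q}"]) auto

lemma \<Phi>_PM: "\<Phi> f \<in> PM"
  by (induction f rule: poly_mapping_additive_induct) (auto simp: \<Phi>_add \<Phi>_single iota_P intro: PM_closed)

lemma s_iota: "s q (\<iota> c) = \<iota> c"
  by (rule field_autsD(14)[OF s_aut]) simp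

lemma \<Phi>_mult: "\<Phi> (f * h) = skew_mult (\<Phi> f) (\<Phi> h)"
proof (induction f rule: poly_mapping_additive_induct)
  case (single q a)
  show ?case
  proof (induction h rule: poly_mapping_additive_induct)
    case (single r b)
    show ?case by (simp add: mult_single \<Phi>_single sk.skew_mult_single s_M s_add iota_mult s_iota)
  next
    case (add u v)
    then show ?case by (simp add: distrib_left \<Phi>_add sk.skew_mult_add_right PM_Sk[OF \<Phi>_PM])
  qed simp
next
  case (add u v)
  then show ?case by (simp add: distrib_right \<Phi>_add sk.skew_mult_add_left PM_Sk[OF \<Phi>_PM])
qed simp

lemma act_\<Phi>: "g \<in> carrier H \<Longrightarrow> skew_act \<alpha> g (\<Phi> f) = \<Phi> (algebra_act g f)"
proof (induction f rule: poly_mapping_additive_induct)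
  case (single q a)
  then show ?case by (simp add: \<Phi>_single act_single algebra_act_single alphaD(14))
qed (auto simp: act_zero act_add algebra_act_add \<Phi>_add)

text \<open>As \<open>P\<close> is finite over \<open>\<Gamma>\<close> and \<open>k[Q]\<close> is finite over a finitely generated ring of invariants, the
  skew group ring is spanned by finitely many elements over \<open>\<Gamma>\<close> on the left and these invariants on
  the right. The trace is linear for both and maps onto \<open>U\<close>.\<close>

theorem U_finitely_generated:
  "\<exists>S. finite S \<and> S \<subseteq> U \<and> generate_ring (skew_ring M) (skew_const ` \<Gamma> \<union> S) = U"
proof -
  interpret ka: finite_ring_auts "(algebra_act :: _ \<Rightarrow> ('q \<Rightarrow>\<^sub>0 'k) \<Rightarrow> _) ` carrier H"
    by (rule finite_ring_auts_algebra_act)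
  have "range (single 0) \<subseteq> ka.Inv"
    by (auto simp: ka.Inv_def algebra_act_single H_0)
  then have "\<exists>T W. finite T \<and> T \<subseteq> UNIV \<inter> ka.Inv \<and> finite W \<and> W \<subseteq> UNIV \<and>
      UNIV = lspan (lmults (generate_ring type_ring (range (single 0) \<union> T))) W"
    by (intro ka.finite_over_invariants[OF group_algebra_generated]) (auto simp: finite_E)
  then obtain T W where T: "finite T" "T \<subseteq> ka.Inv" and W: "finite W"
    and TW: "UNIV = lspan (lmults (generate_ring type_ring (range (single 0) \<union> T))) W" by blast
  define B where "B = generate_ring type_ring (range (single 0) \<union> T)"
  obtain S where S: "finite S" "S \<subseteq> P" "P = lspan (lmults \<Gamma>) S" using P_finite_over_\<Gamma> by blast
  \<comment> \<open>The elements \<open>skew_mult (skew_const p) (\<Phi> w)\<close> with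
    \<open>p\<close> in \<open>S\<close> and \<open>w\<close> in \<open>W\<close> span the skew
    group ring between \<open>\<Gamma>\<close> on the left and \<open>B\<close> on the right. Their
    traces, with the algebra generators \<open>T\<close> of \<open>B\<close>, are the generators
    sought.\<close>
  define S' where "S' = \<Phi> ` T \<union> (\<lambda>(p, w). tr (skew_mult (skew_const p) (\<Phi> w))) ` (S \<times> W)"
  define V where "V = generate_ring (skew_ring M) (skew_const ` \<Gamma> \<union> S')"
  have \<Phi>_T: "\<Phi> f \<in> U" if "f \<in> T" for f
    using that T(2) by (intro UI \<Phi>_PM) (auto simp: act_\<Phi> ka.Inv_def subset_iff)
  have S'_U: "S' \<subseteq> U"
    unfolding S'_def using \<Phi>_T S(2) by (auto intro!: tr_U PM_closed \<Phi>_PM)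
  have V_sub: "V \<subseteq> U"
    unfolding V_def
    by (rule ring.generate_ring_min_subring1[OF sk.ring_skew_ring _ subring_U])
       (use S'_U U_closed(5) UD(2) in \<open>auto simp: sk.Sk_simps(1)\<close>)
  have V_closed: "u + v \<in> V" "skew_mult u v \<in> V" if "u \<in> V" "v \<in> V" for u v
    using generate_ring.eng_add[of u "skew_ring M"] generate_ring.eng_mult[of u "skew_ring M"] that
    unfolding V_def by auto
  have V_uminus: "- u \<in> V" if "u \<in> V" for u
    using generate_ring.a_inv[of u "skew_ring M"] that V_sub UD(2) skew_ring_uminus[of u] unfolding V_def by auto
  have V_\<Gamma>: "skew_const \<gamma> \<in> V" if "\<gamma> \<in> \<Gamma>" for \<gamma>
    unfolding V_def by (rule generate_ring.incl) (use that in auto)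
  have V_S': "x \<in> V" if "x \<in> S'" for x unfolding V_def by (rule generate_ring.incl) (use that in auto)
  have V_0: "0 \<in> V" using V_\<Gamma>[OF \<Gamma>_closed(2)] sk.skew_const_hom(5) by simp
  have \<Phi>_B: "\<Phi> b \<in> V" if "b \<in> B" for b
    using that unfolding B_def
  proof induction
    case one
    then show ?case using V_\<Gamma>[OF \<Gamma>_closed(1)] \<Phi>_single[of 0 1] by (simp add: const_s iota_1)
  next
    case (incl h)
    then show ?case
    proof
      assume "h \<in> range (single 0)"
      then show ?thesis using V_\<Gamma>[OF iota_\<Gamma>] by (auto simp: \<Phi>_single const_s)
    next
      assume "h \<in> T" then show ?thesis by (intro V_S') (simp add: S'_def)
    qed
  qed (simp_all add: \<Phi>_uminus V_uminus \<Phi>_add \<Phi>_mult V_closed)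
  have \<Phi>_B_U: "\<Phi> b \<in> U" if "b \<in> B" for b using \<Phi>_B[OF that] V_sub by blast
  note V_subgroup = V_0 V_closed(1) V_uminus
  \<comment> \<open>Two nested reductions: coefficients in \<open>\<Gamma>\<close> are taken out on
    the left by \<open>tr_mult_left\<close>, coefficients in \<open>B\<close> on the right by
    \<open>tr_mult_right\<close>.\<close>
  have tr_V: "tr (skew_mult (skew_const p) (\<Phi> f)) \<in> V" if p: "p \<in> P" for p f
  proof (rule lspan_vimage[where f = "\<lambda>p. tr (skew_mult (skew_const p) (\<Phi> f))", OF _ _ V_subgroup])
    show "additive (\<lambda>p. tr (skew_mult (skew_const p) (\<Phi> f)))"
      by (simp add: additive_def sk.skew_const_hom(2) sk.skew_mult_add_left sk.Sk_simps tr_add)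
    show "p \<in> lspan (lmults \<Gamma>) S" using p S(3) by simp
    fix a p' assume "a \<in> lmults \<Gamma>" and p': "p' \<in> S"
    then obtain \<gamma> where \<gamma>: "\<gamma> \<in> \<Gamma>" "a = (*) \<gamma>" by (auto simp: lmults_def)
    have PM: "skew_mult (skew_const p') (\<Phi> f) \<in> PM" for f using p' S(2) by (intro PM_closed(4,6) \<Phi>_PM) auto
    have "tr (skew_mult (skew_const p') (\<Phi> f)) \<in> V"
    proof (rule lspan_vimage[where f = "\<lambda>f. tr (skew_mult (skew_const p') (\<Phi> f))", OF _ _ V_subgroup])
      show "additive (\<lambda>f. tr (skew_mult (skew_const p') (\<Phi> f)))"
        by (simp add: additive_def \<Phi>_add sk.skew_mult_add_right sk.Sk_simps tr_add)
      show "f \<in> lspan (lmults B) W" using TW unfolding B_def by blast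
      fix c w assume "c \<in> lmults B" and w: "w \<in> W"
      then obtain b where b: "b \<in> B" "c = (*) b" by (auto simp: lmults_def)
      \<comment> \<open>Commutativity of k[Q] lets \<open>b\<close> move to the right end, where the
        trace is linear for it.\<close>
      have "skew_mult (skew_const p') (\<Phi> (c w)) = skew_mult (skew_mult (skew_const p') (\<Phi> w)) (\<Phi> b)"
        using b by (simp add: mult.commute[of b] \<Phi>_mult sk.skew_mult_assoc sk.Sk_simps PM_Sk[OF \<Phi>_PM])
      moreover have "tr (skew_mult (skew_const p') (\<Phi> w)) \<in> V"
        by (rule V_S') (use w p' in \<open>auto simp: S'_def\<close>)
      ultimately show "tr (skew_mult (skew_const p') (\<Phi> (c w))) \<in> V"
        using tr_mult_right[OF \<Phi>_B_U[OF b(1)] PM] V_closed(2) \<Phi>_B[OF b(1)] by simp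
    qed
    moreover have "skew_mult (skew_const (a p')) (\<Phi> f) = skew_mult (skew_const \<gamma>) (skew_mult (skew_const p') (\<Phi> f))"
      using \<gamma> by (simp add: sk.skew_const_hom sk.skew_mult_assoc sk.Sk_simps PM_Sk[OF \<Phi>_PM])
    ultimately show "tr (skew_mult (skew_const (a p')) (\<Phi> f)) \<in> V"
      using tr_mult_left[OF U_closed(5)[OF \<gamma>(1)] PM] V_closed(2) V_\<Gamma>[OF \<gamma>(1)] by simp
  qed
  have tr_PM: "tr u \<in> V" if "u \<in> PM" for u
  proof -
    have "tr (single m a) \<in> V" if "m \<in> M" "a \<in> P" for m a
    proof -
      obtain q where "m = s q" using \<open>m \<in> M\<close> by (auto simp: M_def)
      then have "single m a = skew_mult (skew_const a) (\<Phi> (single q 1))"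
        by (simp add: \<Phi>_single skew_const_def sk.skew_mult_single sk.id_M iota_1)
      then show ?thesis using tr_V[OF \<open>a \<in> P\<close>] by simp
    qed
    moreover have "tr (sum f I) = (\<Sum>i\<in>I. tr (f i))" for f :: "('l \<Rightarrow> 'l) \<Rightarrow> 'l skew" and I
      by (rule additive.sum) (simp add: additive_def tr_add)
    moreover have "sum f I \<in> V" if "\<And>i. i \<in> I \<Longrightarrow> f i \<in> V" for f :: "('l \<Rightarrow> 'l) \<Rightarrow> 'l skew" and I
      using that by (induction I rule: infinite_finite_induct) (auto simp: V_0 V_closed)
    ultimately have "tr (\<Sum>m\<in>keys u. single m (lookup u m)) \<in> V"
      using \<open>u \<in> PM\<close> by (auto simp: PM_def sk.Sk_def subset_iff)
    then show ?thesis using poly_mapping_expand[of "keys u" u] by simp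
  qed
  have "U \<subseteq> V"
  proof
    fix u assume u: "u \<in> U"
    show "u \<in> V"
      by (subst U_eq_tr[OF u]) (intro V_closed V_\<Gamma> iota_\<Gamma> tr_PM UD(1)[OF u])
  qed
  moreover have "finite S'" unfolding S'_def using T(1) S(1) W by auto
  ultimately show ?thesis using V_sub S'_U unfolding V_def by (intro exI[of _ S']) auto
qed

end


context shift_action
begin

section \<open>Localisation of the invariant ring\<close>

text \<open>A product of individual denominators works for the whole support. The condition is an
  abstract predicate \<open>Q\<close>, so that it applies to denominators on the left and on the
  right.\<close>

lemma common_denominator:
  assumes "finite A" "\<And>m. m \<in> A \<Longrightarrow> \<exists>d\<in>\<Gamma>. d \<noteq> 0 \<and> Q m d"
    and mult: "\<And>m d e. m \<in> A \<Longrightarrow> d \<in> \<Gamma> \<Longrightarrow> Q m d \<Longrightarrow> e \<in> \<Gamma> \<Longrightarrow> Q m (e * d)"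
  shows "\<exists>d\<in>\<Gamma>. d \<noteq> 0 \<and> (\<forall>m\<in>A. Q m d)"
proof -
  have "\<exists>d\<in>\<Gamma>. d \<noteq> 0 \<and> (\<forall>m\<in>B. Q m d)" if "finite B" "B \<subseteq> A" for B
    using that
  proof (induction B)
    case empty show ?case using \<Gamma>_closed(1) by (auto intro!: bexI[of _ 1])
  next
    case (insert m B)
    then obtain d where d: "d \<in> \<Gamma>" "d \<noteq> 0" "\<forall>m\<in>B. Q m d" by auto
    obtain e where e: "e \<in> \<Gamma>" "e \<noteq> 0" "Q m e" using assms(2) insert.prems by auto
    have "Q m (e * d)" using mult[of m e d] e d insert.prems by (simp add: mult.commute)
    moreover have "Q m' (e * d)" if "m' \<in> B" for m' using mult[of m' d e] e d that insert.prems by auto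
    ultimately show ?case using d e \<Gamma>_closed(6) by (intro bexI[of _ "e * d"]) auto
  qed
  then show ?thesis using assms(1) by blast
qed

definition KM :: "'l skew set" where "KM = skew_invariants M H \<alpha>"

lemma KMD: "u \<in> KM \<Longrightarrow> u \<in> sk.Sk" "u \<in> KM \<Longrightarrow> g \<in> carrier H \<Longrightarrow> skew_act \<alpha> g u = u"
  by (auto simp: KM_def skew_invariants_def fixed_elems_def sk.Sk_simps(1))

lemma KMI: "u \<in> sk.Sk \<Longrightarrow> (\<And>g. g \<in> carrier H \<Longrightarrow> skew_act \<alpha> g u = u) \<Longrightarrow> u \<in> KM"
  by (auto simp: KM_def skew_invariants_def fixed_elems_def sk.Sk_simps(1))

lemma KM_closed: "0 \<in> KM" "u \<in> KM \<Longrightarrow> v \<in> KM \<Longrightarrow> u + v \<in> KM" "u \<in> KM \<Longrightarrow> - u \<in> KM"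
    "u \<in> KM \<Longrightarrow> v \<in> KM \<Longrightarrow> skew_mult u v \<in> KM" "c \<in> K \<Longrightarrow> skew_const c \<in> KM"
proof -
  show "0 \<in> KM" by (rule KMI) (auto simp: act_zero sk.Sk_simps)
  show "c \<in> K \<Longrightarrow> skew_const c \<in> KM"
    by (rule KMI) (simp_all add: act_const K_eq_Inv gs.Inv_def sk.Sk_simps)
  assume u: "u \<in> KM"
  show "- u \<in> KM" by (rule KMI) (simp_all add: act_uminus KMD(2)[OF u] sk.Sk_simps KMD(1)[OF u])
  assume v: "v \<in> KM"
  show "u + v \<in> KM"
    by (rule KMI) (simp_all add: act_add KMD(2)[OF u] KMD(2)[OF v] sk.Sk_add KMD(1)[OF u] KMD(1)[OF v])
  show "skew_mult u v \<in> KM"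
    by (rule KMI)
       (simp_all add: act_mult KMD(1,2)[OF u] KMD(1,2)[OF v] sk.skew_mult_closed)
qed

lemma U_KM: "U \<subseteq> KM"
  by (auto intro: KMI UD)

lemma lookup_mult_const_in:
  assumes "u \<in> KM" "d \<in> \<Gamma>" "\<And>m. m \<in> keys u \<Longrightarrow> lookup u m * m d \<in> P"
  shows "skew_mult u (skew_const d) \<in> U"
proof -
  have "lookup u m * m d \<in> P" for m
    using assms(3)[of m] P_closed(2) by (cases "m \<in> keys u") (auto simp: in_keys_iff)
  then have "skew_mult u (skew_const d) \<in> PM"
    using KMD(1)[OF assms(1)] by (simp add: PM_def sk.lookup_mult_const sk.skew_mult_closed sk.Sk_simps)
  moreover have "skew_mult u (skew_const d) \<in> KM" using assms KM_closed(4,5) \<Gamma>_K by blast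
  ultimately show ?thesis by (auto intro: UI KMD(2))
qed

lemma lookup_const_mult_in:
  assumes "u \<in> KM" "d \<in> \<Gamma>" "\<And>m. m \<in> keys u \<Longrightarrow> d * lookup u m \<in> P"
  shows "skew_mult (skew_const d) u \<in> U"
proof -
  have "d * lookup u m \<in> P" for m
    using assms(3)[of m] P_closed(2) by (cases "m \<in> keys u") (auto simp: in_keys_iff)
  then have "skew_mult (skew_const d) u \<in> PM"
    using KMD(1)[OF assms(1)] by (simp add: PM_def sk.lookup_const_mult sk.skew_mult_closed sk.Sk_simps)
  moreover have "skew_mult (skew_const d) u \<in> KM" using assms KM_closed(4,5) \<Gamma>_K by blast
  ultimately show ?thesis by (auto intro: UI KMD(2))
qed

lemma K_Sk: "skew_const ` K \<subseteq> carrier (skew_ring M)" and U_Sk: "U \<subseteq> carrier (skew_ring M)"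
  using UD(2) by (auto simp: sk.Sk_simps)

lemma const_inverse_cancel:
  assumes "d \<noteq> 0" "u \<in> sk.Sk"
  shows "u = skew_mult (skew_const (inverse d)) (skew_mult (skew_const d) u)"
    and "u = skew_mult (skew_mult u (skew_const d)) (skew_const (inverse d))"
  using assms
  by (simp_all add: sk.skew_mult_assoc[symmetric] sk.Sk_simps sk.skew_const_hom(1)[symmetric]
      sk.skew_const_hom(4) sk.skew_mult_one)
     (simp add: sk.skew_mult_assoc sk.Sk_simps sk.skew_const_hom(1)[symmetric] sk.skew_const_hom(4)
      sk.skew_mult_one)

text \<open>A denominator \<open>d\<close> taken in \<open>\<Gamma>\<close> is itself invariant, so
  the product of \<open>d\<close> and \<open>u\<close> is an invariant with coefficients in
  \<open>P\<close>, hence in \<open>U\<close>; multiplying by the inverse of \<open>d\<close>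
  recovers \<open>u\<close>.\<close>

lemma span_K_U: "span_prod (skew_ring M) (skew_const ` K) U = skew_invariants M H \<alpha>"
  unfolding span_prod_lspan(1)[OF sk.ring_skew_ring sk.skew_ring_simps(2,3) K_Sk U_Sk]
    KM_def[symmetric]
proof
  show "lspan ((\<lambda>a b. a \<otimes>\<^bsub>skew_ring M\<^esub> b) ` skew_const ` K) U \<subseteq> KM"
    by (rule lspan_least) (use KM_closed U_KM in auto)
  show "KM \<subseteq> lspan ((\<lambda>a b. a \<otimes>\<^bsub>skew_ring M\<^esub> b) ` skew_const ` K) U"
  proof
    fix u assume u: "u \<in> KM"
    have "\<exists>d\<in>\<Gamma>. d \<noteq> 0 \<and> (\<forall>m\<in>keys u. d * lookup u m \<in> P)"
    proof (rule common_denominator)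
      fix m
      obtain p d where pd: "p \<in> P" "d \<in> \<Gamma>" "d \<noteq> 0" "lookup u m = p / d" using frac_\<Gamma> by blast
      then show "\<exists>d\<in>\<Gamma>. d \<noteq> 0 \<and> d * lookup u m \<in> P" by (intro bexI[of _ d]) auto
    qed (use \<Gamma>_P P_closed(6) in \<open>auto simp: mult.assoc\<close>)
    then obtain d where d: "d \<in> \<Gamma>" "d \<noteq> 0" "\<And>m. m \<in> keys u \<Longrightarrow> d * lookup u m \<in> P" by blast
    have "skew_mult (skew_const d) u \<in> U" using lookup_const_mult_in[OF u d(1,3)] .
    moreover have "inverse d \<in> K" using d \<Gamma>_K inverse_K by blast
    ultimately show "u \<in> lspan ((\<lambda>a b. a \<otimes>\<^bsub>skew_ring M\<^esub> b) ` skew_const ` K) U"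
      using lspan.gen[of "skew_mult (skew_const (inverse d))" _ "skew_mult (skew_const d) u" U]
        const_inverse_cancel(1)[OF d(2) KMD(1)[OF u]] by auto
  qed
qed

lemma span_U_K: "span_prod (skew_ring M) U (skew_const ` K) = skew_invariants M H \<alpha>"
  unfolding span_prod_lspan(2)[OF sk.ring_skew_ring sk.skew_ring_simps(2,3) U_Sk K_Sk]
    KM_def[symmetric]
proof
  show "lspan ((\<lambda>b a. a \<otimes>\<^bsub>skew_ring M\<^esub> b) ` skew_const ` K) U \<subseteq> KM"
    by (rule lspan_least) (use KM_closed U_KM in auto)
  show "KM \<subseteq> lspan ((\<lambda>b a. a \<otimes>\<^bsub>skew_ring M\<^esub> b) ` skew_const ` K) U"
  proof
    fix u assume u: "u \<in> KM"
    have keysM: "keys u \<subseteq> M" using KMD(1)[OF u] by (simp add: sk.Sk_def)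
    have "\<exists>d\<in>\<Gamma>. d \<noteq> 0 \<and> (\<forall>m\<in>keys u. lookup u m * m d \<in> P)"
    proof (rule common_denominator)
      fix m assume "m \<in> keys u"
      then obtain q where q: "m = s q" using keysM by (auto simp: M_def)
      obtain p d where pd: "p \<in> P" "d \<in> P" "d \<noteq> 0" "lookup u m = p / d" using frac by blast
      \<comment> \<open>On the right a constant meets the coefficient at \<open>m\<close> only after
        \<open>m\<close> has acted on it. So the denominator is pulled back by the inverse shift
        before its norm is taken.\<close>
      have "s (- q) d \<in> P" "s (- q) d \<noteq> 0" using s_P pd(2,3) field_autsD(13)[OF s_aut] by auto
      then obtain d' where d': "d' \<in> P" "s (- q) d * d' \<in> \<Gamma>" "s (- q) d * d' \<noteq> 0" using norm_ex by blast
      have "lookup u m * m (s (- q) d * d') = p * s q d'"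
        using pd(3,4) by (simp add: q field_autsD(7)[OF s_aut] s_minus)
      then show "\<exists>d\<in>\<Gamma>. d \<noteq> 0 \<and> lookup u m * m d \<in> P"
        using d' pd(1) s_P P_closed(6) by (intro bexI[of _ "s (- q) d * d'"]) auto
    next
      fix m d e assume m: "m \<in> keys u" and d: "lookup u m * m d \<in> P" and e: "e \<in> \<Gamma>"
      obtain q where q: "m = s q" using m keysM by (auto simp: M_def)
      \<comment> \<open>An extra factor \<open>e\<close> enters as \<open>m e\<close>, which stays
        in \<open>P\<close> because shifts preserve \<open>P\<close>.\<close>
      have "lookup u m * m (e * d) = s q e * (lookup u m * m d)"
        by (simp add: q field_autsD(7)[OF s_aut])
      moreover have "s q e \<in> P" using e \<Gamma>_P s_P by blast
      ultimately show "lookup u m * m (e * d) \<in> P" using P_closed(6)[OF _ d] by metis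
    qed simp
    then obtain d where d: "d \<in> \<Gamma>" "d \<noteq> 0" "\<And>m. m \<in> keys u \<Longrightarrow> lookup u m * m d \<in> P" by blast
    have "skew_mult u (skew_const d) \<in> U" using lookup_mult_const_in[OF u d(1,3)] .
    moreover have "inverse d \<in> K" using d \<Gamma>_K inverse_K by blast
    ultimately show "u \<in> lspan ((\<lambda>b a. a \<otimes>\<^bsub>skew_ring M\<^esub> b) ` skew_const ` K) U"
      using lspan.gen[of "\<lambda>a. skew_mult a (skew_const (inverse d))" _ "skew_mult u (skew_const d)" U]
        const_inverse_cancel(2)[OF d(2) KMD(1)[OF u]] by auto
  qed
qed

lemma eval_act:
  assumes "u \<in> sk.Sk" "g \<in> carrier H"
  shows "\<alpha> g (skew_eval u a) = skew_eval (skew_act \<alpha> g u) (\<alpha> g a)"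
  using assms(1)
proof (induction u rule: sk.Sk_induct)
  case zero show ?case by (simp add: skew_eval_def act_zero alphaD(5)[OF assms(2)])
next
  case (single m c)
  have ev: "skew_eval (single m c) a = c * m a" for m c a
    by (subst skew_eval_supset[of "{m}"]) auto
  obtain q where "m = s q" using single by (auto simp: M_def)
  then show ?case by (simp add: ev act_single assms(2) alphaD(7)[OF assms(2)] alpha_s)
next
  case (add u v)
  then show ?case
    by (simp add: act_add assms(2) additive.add[OF additive_skew_eval] alphaD(6)[OF assms(2)])
qed

text \<open>Evaluation is compatible with the action of G, so an invariant element at an invariant
  point has an invariant value; coefficients and shifts keep the value in \<open>P\<close>.\<close>

lemma eval_U:
  assumes "u \<in> U" "\<gamma> \<in> \<Gamma>"
  shows "skew_eval u \<gamma> \<in> \<Gamma>"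
proof -
  have "m \<gamma> \<in> P" if m: "m \<in> keys u" for m
  proof -
    have "m \<in> M" using m UD(2)[OF assms(1)] by (auto simp: sk.Sk_def)
    then show ?thesis using s_P assms(2) \<Gamma>_P by (auto simp: M_def)
  qed
  then have "skew_eval u \<gamma> \<in> P"
    unfolding skew_eval_def using UD(1)[OF assms(1)]
    by (intro P_closed(8) P_closed(6)) (auto simp: PM_def)
  moreover have "\<alpha> g (skew_eval u \<gamma>) = skew_eval u \<gamma>" if "g \<in> carrier H" for g
    using eval_act[OF UD(2)[OF assms(1)] that] UD(3)[OF assms(1) that] assms(2) that
    by (simp add: \<Gamma>_def fixed_elems_def)
  ultimately show ?thesis by (simp add: \<Gamma>_def fixed_elems_def)
qed

theorem principal_galois_order_U: "principal_galois_order (range \<iota>) \<Gamma> M H \<alpha> U"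
  unfolding principal_galois_order_def galois_ring_def Let_def K_def[symmetric]
proof (intro conjI)
  show "range \<iota> \<subseteq> \<Gamma>" using iota_\<Gamma> by auto
  show "M \<subseteq> field_auts (range \<iota>)" using s_aut by (auto simp: M_def)
  show "\<forall>m\<in>M. \<forall>m'\<in>M. (\<forall>x\<in>K. m x = m' x) \<longrightarrow> m = m'" using s_separating by (auto simp: M_def)
  show "\<forall>g\<in>carrier H. \<forall>m\<in>M. \<alpha> g \<circ> m \<circ> inv_into UNIV (\<alpha> g) \<in> M"
    using conj_s by (auto simp: M_def)
  show "U \<subseteq> skew_invariants M H \<alpha>" using U_KM by (simp add: KM_def)
qed (use noetherian_\<Gamma> finite_galois_K sk.id_M sk.comp_M subring_U U_closed(5) U_finitely_generated
      span_U_K span_K_U eval_U in auto)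

section \<open>The Harish-Chandra property\<close>

abbreviation "RU \<equiv> (skew_ring M)\<lparr>carrier := U\<rparr>"

lemma ring_RU: "ring RU"
  by (rule ring.subring_is_ring[OF sk.ring_skew_ring subring_U])

lemma RU_simps: "u \<otimes>\<^bsub>RU\<^esub> v = skew_mult u v" "u \<oplus>\<^bsub>RU\<^esub> v = u + v" "\<zero>\<^bsub>RU\<^esub> = 0" "\<one>\<^bsub>RU\<^esub> = single id 1"
  by (simp_all add: skew_ring_def)

lemma RU_uminus: "u \<in> U \<Longrightarrow> \<ominus>\<^bsub>RU\<^esub> u = - u"
  using abelian_group.minus_equality[OF ring.is_abelian_group[OF ring_RU], of "- u" u] U_closed(3)
  by (simp add: RU_simps)

lemma subring_const_\<Gamma>: "subring (skew_const ` \<Gamma>) RU"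
proof (rule ring.subringI[OF ring_RU])
  show "\<one>\<^bsub>RU\<^esub> \<in> skew_const ` \<Gamma>"
    unfolding RU_simps sk.skew_const_hom(4)[symmetric] by (rule imageI[OF \<Gamma>_closed(1)])
  show "\<ominus>\<^bsub>RU\<^esub> h \<in> skew_const ` \<Gamma>" if "h \<in> skew_const ` \<Gamma>" for h
    using that by (auto simp: RU_uminus U_closed(5) sk.skew_const_hom(3)[symmetric] \<Gamma>_closed)
qed (auto simp: RU_simps U_closed(5) sk.skew_const_hom(1,2)[symmetric] \<Gamma>_closed)

lemma cring_const_\<Gamma>: "cring (RU\<lparr>carrier := skew_const ` \<Gamma>\<rparr>)"
proof (rule cring.intro[OF ring.subring_is_ring[OF ring_RU subring_const_\<Gamma>]])
  have "ring (RU\<lparr>carrier := skew_const ` \<Gamma>\<rparr>)" by (rule ring.subring_is_ring[OF ring_RU subring_const_\<Gamma>])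
  then show "comm_monoid (RU\<lparr>carrier := skew_const ` \<Gamma>\<rparr>)"
    by (intro monoid.monoid_comm_monoidI ring.is_monoid)
       (auto simp: skew_ring_def sk.skew_const_hom(1)[symmetric] mult.commute)
qed

abbreviation "lact \<gamma> \<equiv> skew_mult (skew_const \<gamma>)"
abbreviation "ract \<gamma> w \<equiv> skew_mult w (skew_const \<gamma>)"

lemma const_mult_iota: "w \<in> sk.Sk \<Longrightarrow> lact (\<iota> c) w = ract (\<iota> c) w"
proof (rule poly_mapping_eqI)
  fix m assume w: "w \<in> sk.Sk"
  show "lookup (lact (\<iota> c) w) m = lookup (ract (\<iota> c) w) m"
  proof (cases "m \<in> keys w")
    case True
    then have "m \<in> M" using w by (auto simp: sk.Sk_def)
    then obtain q where "m = s q" by (auto simp: M_def)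
    then show ?thesis using w by (simp add: sk.lookup_const_mult sk.lookup_mult_const s_iota)
  qed (use w in \<open>simp add: sk.lookup_const_mult sk.lookup_mult_const in_keys_iff\<close>)
qed

text \<open>A single monic relation serves the whole family, as its roots are all conjugates of all
  members. Its coefficients are invariant and lie in \<open>P\<close>.\<close>

lemma P_integral:
  assumes "finite Z" "\<And>z. z \<in> Z \<Longrightarrow> p z \<in> P"
  shows "\<exists>D c. range c \<subseteq> \<Gamma> \<and> (\<forall>z\<in>Z. p z ^ D = - (\<Sum>j<D. c j * p z ^ j))"
proof -
  define F where "F = rootpoly (Z \<times> Gs) (\<lambda>(z, h). h (p z))"
  have fin: "finite (Z \<times> Gs)" using assms(1) gs.finite_Gs by simp
  have "coeff F j \<in> P" for j
    unfolding F_def by (rule rootpoly_coeff_in[OF subring_P _ fin]) (use assms(2) alpha_P in auto)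
  then have "range (coeff F) \<subseteq> \<Gamma>"
    unfolding \<Gamma>_eq using gs.rootpoly_coeff_Inv[OF assms(1), of p] by (auto simp: F_def)
  moreover have "p z ^ card (Z \<times> Gs) = - (\<Sum>j<card (Z \<times> Gs). coeff F j * p z ^ j)" if "z \<in> Z" for z
    using rootpoly_power[OF fin, of "(z, id)" "\<lambda>(z, h). h (p z)"] gs.id_Gs that by (simp add: F_def)
  ultimately show ?thesis by blast
qed

text \<open>On elements with support in \<open>Z\<close>, right multiplication by \<open>\<gamma>\<close> multiplies the coefficient of \<open>m\<close>
  by \<open>m \<gamma>\<close>, so it satisfies the monic polynomial with roots \<open>g (m \<gamma>)\<close>, \<open>g \<in> G\<close>, \<open>m \<in> Z\<close>.\<close>

lemma right_mult_integral:
  assumes Z: "finite Z" "Z \<subseteq> M" and \<gamma>: "\<gamma> \<in> \<Gamma>"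
  shows "\<exists>D c. range c \<subseteq> \<Gamma> \<and> (\<forall>w\<in>{w \<in> sk.Sk. keys w \<subseteq> Z}.
    ract (\<gamma> ^ D) w = - (\<Sum>j<D. lact (c j) (ract (\<gamma> ^ j) w)))"
proof -
  have "\<exists>D c. range c \<subseteq> \<Gamma> \<and> (\<forall>m\<in>Z. m \<gamma> ^ D = - (\<Sum>j<D. c j * m \<gamma> ^ j))"
    by (rule P_integral[OF Z(1)]) (use Z(2) \<gamma> \<Gamma>_P s_P in \<open>auto simp: M_def\<close>)
  then obtain D c where c: "range c \<subseteq> \<Gamma>"
    and eq: "\<forall>m\<in>Z. m \<gamma> ^ D = - (\<Sum>j<D. c j * m \<gamma> ^ j)" by (elim exE conjE)
  have "ract (\<gamma> ^ D) w = - (\<Sum>j<D. lact (c j) (ract (\<gamma> ^ j) w))" if w: "w \<in> sk.Sk" "keys w \<subseteq> Z" for w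
  proof (rule poly_mapping_eqI)
    fix m
    have "lookup w m * m (\<gamma> ^ D) = - (\<Sum>j<D. c j * (lookup w m * m (\<gamma> ^ j)))"
    proof (cases "m \<in> keys w")
      case True
      then have m: "m \<in> Z" "m \<in> M" using w Z(2) by auto
      then obtain q where q: "m = s q" by (auto simp: M_def)
      then show ?thesis
        using bspec[OF eq m(1)] by (simp add: field_autsD(12)[OF s_aut] sum_distrib_left mult.left_commute)
    qed (simp add: in_keys_iff)
    then show "lookup (ract (\<gamma> ^ D) w) m = lookup (- (\<Sum>j<D. lact (c j) (ract (\<gamma> ^ j) w))) m"
      using w(1) by (simp add: sk.lookup_mult_const sk.lookup_const_mult lookup_sum sk.skew_mult_closed sk.Sk_simps)
  qed
  then show ?thesis using c by blast
qed

text \<open>At \<open>m\<close> the left factor \<open>\<gamma>\<close> has to be matched with right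
  factors, which appear there after \<open>m\<close> has acted. So the relation is taken for the
  preimages of \<open>\<gamma>\<close> under the shifts in \<open>Z\<close>; applying
  \<open>m\<close> to it restores \<open>\<gamma>\<close> and turns each \<open>c j\<close> into
  \<open>m (c j)\<close>, which is what right multiplication by \<open>c j\<close>
  contributes.\<close>

lemma left_mult_integral:
  assumes Z: "finite Z" "Z \<subseteq> M" and \<gamma>: "\<gamma> \<in> \<Gamma>"
  shows "\<exists>D c. range c \<subseteq> \<Gamma> \<and> (\<forall>w\<in>{w \<in> sk.Sk. keys w \<subseteq> Z}.
    lact (\<gamma> ^ D) w = - (\<Sum>j<D. ract (c j) (lact (\<gamma> ^ j) w)))"
proof -
  have "\<forall>m\<in>Z. \<exists>q. m = s q" using Z(2) by (auto simp: M_def)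
  then obtain q where q: "\<And>m. m \<in> Z \<Longrightarrow> m = s (q m)" by metis
  have "s (- q m) \<gamma> \<in> P" for m using \<gamma> \<Gamma>_P s_P by auto
  from P_integral[of Z "\<lambda>m. s (- q m) \<gamma>", OF Z(1) this] obtain D c where c: "range c \<subseteq> \<Gamma>"
    and eq: "\<forall>m\<in>Z. s (- q m) \<gamma> ^ D = - (\<Sum>j<D. c j * s (- q m) \<gamma> ^ j)" by (elim exE conjE)
  have "lact (\<gamma> ^ D) w = - (\<Sum>j<D. ract (c j) (lact (\<gamma> ^ j) w))" if w: "w \<in> sk.Sk" "keys w \<subseteq> Z" for w
  proof (rule poly_mapping_eqI)
    fix m
    have "\<gamma> ^ D * lookup w m = - (\<Sum>j<D. \<gamma> ^ j * lookup w m * m (c j))"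
    proof (cases "m \<in> keys w")
      case True
      then have m: "m \<in> Z" using w by auto
      note S = field_autsD[OF s_aut[of "q m"]]
      have "s (q m) (s (- q m) \<gamma> ^ D) = s (q m) (- (\<Sum>j<D. c j * s (- q m) \<gamma> ^ j))" using bspec[OF eq m] by simp
      then have "\<gamma> ^ D = - (\<Sum>j<D. m (c j) * \<gamma> ^ j)"
        using q[OF m] unfolding S(8) additive.sum[OF S(3)] S(7) S(12) s_minus by simp
      then show ?thesis
        by (simp add: sum_distrib_left mult.commute[of "m _"] mult.commute[of _ "lookup w m"] mult.assoc)
    qed (simp add: in_keys_iff)
    then show "lookup (lact (\<gamma> ^ D) w) m = lookup (- (\<Sum>j<D. ract (c j) (lact (\<gamma> ^ j) w))) m"
      using w(1) by (simp add: sk.lookup_mult_const sk.lookup_const_mult lookup_sum sk.skew_mult_closed sk.Sk_simps)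
  qed
  then show ?thesis using c by blast
qed

lemma ring_action_U: "ring_action \<Gamma> U lact" "ring_action \<Gamma> U ract"
proof -
  note simps = sk.skew_const_hom sk.skew_mult_one sk.skew_mult_assoc sk.Sk_simps
    sk.skew_mult_add_left sk.skew_mult_add_right
  show "ring_action \<Gamma> U lact"
    by (rule ring_action.intro) (simp_all add: subring_\<Gamma> U_closed UD(2) simps)
  \<comment> \<open>Right multiplication reverses the order of factors; commutativity of the
    constants undoes this.\<close>
  have comm: "skew_const (\<gamma> * \<delta>) = skew_mult (skew_const \<delta>) (skew_const \<gamma>)" for \<gamma> \<delta> :: 'l
    by (simp add: sk.skew_const_hom(1)[symmetric] mult.commute)
  show "ring_action \<Gamma> U ract"
    by (rule ring_action.intro) (simp_all add: subring_\<Gamma> U_closed UD(2) comm simps)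
qed

text \<open>\<open>B\<close> is the least additive subgroup that contains \<open>u\<close> and is
  stable under both actions. This minimality and the integral relations give both claims by
  \<open>cyclic_bimodule_span\<close>, applied once with left and right exchanged.\<close>

lemma bimodule_finitely_generated:
  assumes u: "u \<in> U"
  defines "B \<equiv> span_prod RU (span_prod RU (skew_const ` \<Gamma>) {u}) (skew_const ` \<Gamma>)"
  shows "\<exists>S. finite S \<and> S \<subseteq> B \<and> span_prod RU (skew_const ` \<Gamma>) S = B"
    and "\<exists>S. finite S \<and> S \<subseteq> B \<and> span_prod RU S (skew_const ` \<Gamma>) = B"
proof -
  interpret UL: ring_action \<Gamma> U lact by (rule ring_action_U(1))
  interpret UR: ring_action \<Gamma> U ract by (rule ring_action_U(2))
  have cU: "skew_const ` \<Gamma> \<subseteq> U" using U_closed(5) by auto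
  have span_L: "span_prod RU (skew_const ` \<Gamma>) S = lspan (lact ` \<Gamma>) S" if "S \<subseteq> U" for S
    using span_prod_lspan(1)[OF ring_RU RU_simps(2,3), of "skew_const ` \<Gamma>" S] cU that
    by (simp add: RU_simps image_image)
  have span_R: "span_prod RU S (skew_const ` \<Gamma>) = lspan (ract ` \<Gamma>) S" if "S \<subseteq> U" for S
    using span_prod_lspan(2)[OF ring_RU RU_simps(2,3), of S "skew_const ` \<Gamma>"] cU that
    by (simp add: RU_simps image_image)
  define Z where "Z = lspan (lact ` \<Gamma>) {u}"
  have Z_U: "Z \<subseteq> U" unfolding Z_def by (rule UL.lspan_W) (use u in simp)
  have B_eq: "B = lspan (ract ` \<Gamma>) Z" unfolding B_def using span_L[of "{u}"] span_R[OF Z_U] u by (simp add: Z_def)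
  have B_U: "B \<subseteq> U" unfolding B_eq by (rule UR.lspan_W[OF Z_U])
  have u_B: "u \<in> B" using UL.lspan_base[of "{u}"] UR.lspan_base[OF Z_U] u unfolding B_eq Z_def by auto
  have B_sub: "0 \<in> B" "\<And>x y. x \<in> B \<Longrightarrow> y \<in> B \<Longrightarrow> x + y \<in> B" "\<And>x. x \<in> B \<Longrightarrow> - x \<in> B"
    unfolding B_eq by (auto intro: lspan.intros)
  have B_right: "ract \<gamma> x \<in> B" if "\<gamma> \<in> \<Gamma>" "x \<in> B" for \<gamma> x
    using UR.lspan_closed[OF Z_U imageI[OF that(1)], of x] that(2) unfolding B_eq by simp
  have comm: "lact \<gamma> (ract \<delta> x) = ract \<delta> (lact \<gamma> x)" if "x \<in> U" for \<gamma> \<delta> x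
    by (simp add: sk.skew_mult_assoc sk.Sk_simps UD(2)[OF that])
  have B_left: "lact \<gamma> x \<in> B" if \<gamma>: "\<gamma> \<in> \<Gamma>" and x: "x \<in> B" for \<gamma> x
    unfolding B_eq
  proof (rule lspan_map[where f = "lact \<gamma>"])
    show "x \<in> lspan (ract ` \<Gamma>) Z" using x B_eq by simp
    fix a z assume a: "a \<in> ract ` \<Gamma>" and z: "z \<in> Z"
    have "lact \<gamma> z \<in> Z"
      using UL.lspan_closed[of "{u}" "lact \<gamma>" z] u z \<gamma> unfolding Z_def by auto
    moreover have "lact \<gamma> (a z) = a (lact \<gamma> z)" using a z Z_U comm by auto
    ultimately show "lact \<gamma> (a z) \<in> lspan (ract ` \<Gamma>) Z" using lspan.gen[OF a] by simp
  qed (simp add: sk.skew_mult_add_right sk.Sk_simps)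
  have B_least: "B \<subseteq> W" if W: "0 \<in> W" "\<And>x y. x \<in> W \<Longrightarrow> y \<in> W \<Longrightarrow> x + y \<in> W" "\<And>x. x \<in> W \<Longrightarrow> - x \<in> W"
    "u \<in> W" "\<And>\<gamma> x. \<gamma> \<in> \<Gamma> \<Longrightarrow> x \<in> W \<Longrightarrow> lact \<gamma> x \<in> W" "\<And>\<gamma> x. \<gamma> \<in> \<Gamma> \<Longrightarrow> x \<in> W \<Longrightarrow> ract \<gamma> x \<in> W" for W
  proof -
    have "Z \<subseteq> W" unfolding Z_def by (rule lspan_least) (use W in auto)
    then show ?thesis unfolding B_eq by (intro lspan_least) (use W in auto)
  qed
  \<comment> \<open>Constants on either side do not enlarge supports, so the relation for the finite
    set \<open>keys u\<close> holds on all of \<open>B\<close>.\<close>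
  have keys_B: "B \<subseteq> {w \<in> sk.Sk. keys w \<subseteq> keys u}"
  proof (rule B_least)
    fix x y assume "x \<in> {w \<in> sk.Sk. keys w \<subseteq> keys u}" "y \<in> {w \<in> sk.Sk. keys w \<subseteq> keys u}"
    then show "x + y \<in> {w \<in> sk.Sk. keys w \<subseteq> keys u}" using keys_add[of x y] by (auto simp: sk.Sk_add)
  qed (use UD(2)[OF u] in \<open>auto simp: sk.Sk_simps sk.skew_mult_closed in_keys_iff sk.lookup_const_mult sk.lookup_mult_const\<close>)
  have keys_u: "finite (keys u)" "keys u \<subseteq> M" using UD(2)[OF u] by (auto simp: sk.Sk_def)
  have BL: "ring_action \<Gamma> B lact" by (rule UL.restrict[OF B_U B_sub B_left])
  have BR: "ring_action \<Gamma> B ract" by (rule UR.restrict[OF B_U B_sub B_right])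
  obtain T where T: "finite T" "\<Gamma> = generate_ring type_ring (range \<iota> \<union> T)"
    using \<Gamma>_finitely_generated by blast
  have central: "lact c x = ract c x" if "c \<in> range \<iota>" "x \<in> B" for c x
    using that const_mult_iota keys_B by auto
  have "\<exists>S. finite S \<and> S \<subseteq> B \<and> lspan (lact ` \<Gamma>) S = B"
  proof (rule cyclic_bimodule_span[OF BL BR _ central T u_B B_least])
    show "\<exists>D c. range c \<subseteq> \<Gamma> \<and> (\<forall>w\<in>B. ract (\<gamma> ^ D) w = - (\<Sum>j<D. lact (c j) (ract (\<gamma> ^ j) w)))"
      if "\<gamma> \<in> \<Gamma>" for \<gamma>
    proof -
      from right_mult_integral[OF keys_u that] obtain D c where "range c \<subseteq> \<Gamma>"
        and "\<forall>w\<in>{w \<in> sk.Sk. keys w \<subseteq> keys u}. ract (\<gamma> ^ D) w = - (\<Sum>j<D. lact (c j) (ract (\<gamma> ^ j) w))"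
        by (elim exE conjE)
      with keys_B show ?thesis by (intro exI[of _ D] exI[of _ c]) auto
    qed
  qed (use comm B_U in auto)
  then obtain S where "finite S" "S \<subseteq> B" "lspan (lact ` \<Gamma>) S = B" by blast
  then show "\<exists>S. finite S \<and> S \<subseteq> B \<and> span_prod RU (skew_const ` \<Gamma>) S = B"
    using span_L[of S] B_U by (intro exI[of _ S]) simp
  have "\<exists>S. finite S \<and> S \<subseteq> B \<and> lspan (ract ` \<Gamma>) S = B"
  proof (rule cyclic_bimodule_span[OF BR BL _ central[symmetric] T u_B B_least])
    show "\<exists>D c. range c \<subseteq> \<Gamma> \<and> (\<forall>w\<in>B. lact (\<gamma> ^ D) w = - (\<Sum>j<D. ract (c j) (lact (\<gamma> ^ j) w)))"
      if "\<gamma> \<in> \<Gamma>" for \<gamma>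
    proof -
      from left_mult_integral[OF keys_u that] obtain D c where "range c \<subseteq> \<Gamma>"
        and "\<forall>w\<in>{w \<in> sk.Sk. keys w \<subseteq> keys u}. lact (\<gamma> ^ D) w = - (\<Sum>j<D. ract (c j) (lact (\<gamma> ^ j) w))"
        by (elim exE conjE)
      with keys_B show ?thesis by (intro exI[of _ D] exI[of _ c]) auto
    qed
  qed (use comm B_U in auto)
  then obtain S where "finite S" "S \<subseteq> B" "lspan (ract ` \<Gamma>) S = B" by blast
  then show "\<exists>S. finite S \<and> S \<subseteq> B \<and> span_prod RU S (skew_const ` \<Gamma>) = B"
    using span_R[of S] B_U by (intro exI[of _ S]) simp
qed

theorem harish_chandra_\<Gamma>: "harish_chandra_subalgebra RU (skew_const ` range \<iota>) (skew_const ` \<Gamma>)"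
  unfolding harish_chandra_subalgebra_def Let_def
proof (intro conjI ballI allI impI)
  show "ring RU" by (rule ring_RU)
  show "subring (skew_const ` \<Gamma>) RU" by (rule subring_const_\<Gamma>)
  show "cring (RU\<lparr>carrier := skew_const ` \<Gamma>\<rparr>)" by (rule cring_const_\<Gamma>)
  show "skew_const ` range \<iota> \<subseteq> skew_const ` \<Gamma>" using iota_\<Gamma> by auto
  fix u assume "u \<in> carrier RU"
  then have u: "u \<in> U" by simp
  show "\<exists>S. finite S \<and> S \<subseteq> span_prod RU (span_prod RU (skew_const ` \<Gamma>) {u}) (skew_const ` \<Gamma>) \<and>
      span_prod RU (skew_const ` \<Gamma>) S = span_prod RU (span_prod RU (skew_const ` \<Gamma>) {u}) (skew_const ` \<Gamma>)"
    by (rule bimodule_finitely_generated(1)[OF u])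
  show "\<exists>S. finite S \<and> S \<subseteq> span_prod RU (span_prod RU (skew_const ` \<Gamma>) {u}) (skew_const ` \<Gamma>) \<and>
      span_prod RU S (skew_const ` \<Gamma>) = span_prod RU (span_prod RU (skew_const ` \<Gamma>) {u}) (skew_const ` \<Gamma>)"
    by (rule bimodule_finitely_generated(2)[OF u])
qed (use ext1_quot_module_vanishes[OF cring_const_\<Gamma>] in blast)

end


section \<open>Extension to the field of fractions\<close>

text \<open>The description copies the one in \<open>field_act\<close>, so that the two agree by
  unfolding.\<close>

definition frac_ext :: "'l::field set \<Rightarrow> ('l \<Rightarrow> 'l) \<Rightarrow> 'l \<Rightarrow> 'l"
  where "frac_ext P \<sigma> l = (THE y. \<exists>p\<in>P. \<exists>q\<in>P. q \<noteq> 0 \<and> l = p / q \<and> y = \<sigma> p / \<sigma> q)"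

text \<open>Both maps are controlled on \<open>P\<close> only. The inverse \<open>\<sigma>'\<close>
  keeps denominators nonzero, which makes the extension well defined and injective, and it supplies
  preimages of fractions.\<close>

lemma frac_ext_aut:
  fixes P :: "'l::field set"
  assumes P: "subring P type_ring" and frac: "\<And>x. \<exists>p\<in>P. \<exists>q\<in>P. q \<noteq> 0 \<and> x = p / q"
    and closed: "\<And>p. p \<in> P \<Longrightarrow> \<sigma> p \<in> P" "\<And>p. p \<in> P \<Longrightarrow> \<sigma>' p \<in> P"
    and inv: "\<And>p. p \<in> P \<Longrightarrow> \<sigma> (\<sigma>' p) = p" "\<And>p. p \<in> P \<Longrightarrow> \<sigma>' (\<sigma> p) = p"
    and add: "\<And>p q. p \<in> P \<Longrightarrow> q \<in> P \<Longrightarrow> \<sigma> (p + q) = \<sigma> p + \<sigma> q"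
    and mult: "\<And>p q. p \<in> P \<Longrightarrow> q \<in> P \<Longrightarrow> \<sigma> (p * q) = \<sigma> p * \<sigma> q"
    and one: "\<sigma> 1 = 1" and F: "F \<subseteq> P" "\<And>c. c \<in> F \<Longrightarrow> \<sigma> c = c"
  shows "frac_ext P \<sigma> \<in> field_auts F" and "\<And>p. p \<in> P \<Longrightarrow> frac_ext P \<sigma> p = \<sigma> p"
proof -
  note PD = subring_typeD[OF P]
  have zero: "\<sigma> 0 = 0" using add[OF PD(2) PD(2)] by (metis add_0 add_cancel_right_right)
  have nonzero: "\<sigma> p \<noteq> 0" if "p \<in> P" "p \<noteq> 0" for p
    using inv(2)[OF that(1)] inv(2)[OF PD(2)] zero that(2) by metis
  have eq: "frac_ext P \<sigma> (p / q) = \<sigma> p / \<sigma> q" if pq: "p \<in> P" "q \<in> P" "q \<noteq> 0" for p q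
    unfolding frac_ext_def
  proof (rule the_equality)
    show "\<exists>p'\<in>P. \<exists>q'\<in>P. q' \<noteq> 0 \<and> p / q = p' / q' \<and> \<sigma> p / \<sigma> q = \<sigma> p' / \<sigma> q'" using pq by blast
    fix y assume "\<exists>p'\<in>P. \<exists>q'\<in>P. q' \<noteq> 0 \<and> p / q = p' / q' \<and> y = \<sigma> p' / \<sigma> q'"
    then obtain p' q' where p'q': "p' \<in> P" "q' \<in> P" "q' \<noteq> 0" "p / q = p' / q'" "y = \<sigma> p' / \<sigma> q'" by blast
    then have "p * q' = p' * q" using pq(3) by (simp add: frac_eq_eq)
    then have "\<sigma> p * \<sigma> q' = \<sigma> p' * \<sigma> q" using pq p'q' by (simp add: mult[symmetric])
    then show "y = \<sigma> p / \<sigma> q" using p'q' nonzero pq by (simp add: frac_eq_eq)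
  qed
  show on_P: "frac_ext P \<sigma> p = \<sigma> p" if "p \<in> P" for p
    using eq[OF that PD(1)] one by simp
  have f_add: "frac_ext P \<sigma> (x + y) = frac_ext P \<sigma> x + frac_ext P \<sigma> y"
    and f_mult: "frac_ext P \<sigma> (x * y) = frac_ext P \<sigma> x * frac_ext P \<sigma> y" for x y
  proof -
    obtain a b where ab: "a \<in> P" "b \<in> P" "b \<noteq> 0" "x = a / b" using frac by blast
    obtain c d where cd: "c \<in> P" "d \<in> P" "d \<noteq> 0" "y = c / d" using frac by blast
    have b0: "\<sigma> b \<noteq> 0" and d0: "\<sigma> d \<noteq> 0" using nonzero ab cd by auto
    have "x + y = (a * d + c * b) / (b * d)" using ab cd by (simp add: field_simps)
    moreover have "frac_ext P \<sigma> ((a * d + c * b) / (b * d)) = \<sigma> (a * d + c * b) / \<sigma> (b * d)"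
      by (rule eq) (use ab cd PD in auto)
    moreover have "\<sigma> (a * d + c * b) / \<sigma> (b * d) = \<sigma> a / \<sigma> b + \<sigma> c / \<sigma> d"
      using ab cd PD(6) b0 d0 by (simp add: add mult field_simps)
    ultimately show "frac_ext P \<sigma> (x + y) = frac_ext P \<sigma> x + frac_ext P \<sigma> y"
      using eq[OF ab(1-3)] eq[OF cd(1-3)] by (simp only: ab(4) cd(4))
    have "x * y = (a * c) / (b * d)" using ab cd by simp
    moreover have "frac_ext P \<sigma> ((a * c) / (b * d)) = \<sigma> (a * c) / \<sigma> (b * d)"
      by (rule eq) (use ab cd PD in auto)
    moreover have "\<sigma> (a * c) / \<sigma> (b * d) = (\<sigma> a / \<sigma> b) * (\<sigma> c / \<sigma> d)"
      using ab cd by (simp add: mult)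
    ultimately show "frac_ext P \<sigma> (x * y) = frac_ext P \<sigma> x * frac_ext P \<sigma> y"
      using eq[OF ab(1-3)] eq[OF cd(1-3)] by (simp only: ab(4) cd(4))
  qed
  have "inj (frac_ext P \<sigma>)"
  proof (rule injI)
    fix x y assume "frac_ext P \<sigma> x = frac_ext P \<sigma> y"
    then have 0: "frac_ext P \<sigma> (x - y) = 0" using f_add[of "x - y" y] by simp
    obtain a b where ab: "a \<in> P" "b \<in> P" "b \<noteq> 0" "x - y = a / b" using frac by blast
    then have "\<sigma> a / \<sigma> b = 0" using 0 eq by simp
    then have "a = 0" using nonzero ab by auto
    then show "x = y" using ab by simp
  qed
  moreover have "\<exists>y. x = frac_ext P \<sigma> y" for x
  proof -
    obtain a b where ab: "a \<in> P" "b \<in> P" "b \<noteq> 0" "x = a / b" using frac by blast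
    have "\<sigma>' b \<noteq> 0" using inv(1)[OF ab(2)] zero ab(3) by metis
    then have "frac_ext P \<sigma> (\<sigma>' a / \<sigma>' b) = x" using eq closed(2) inv(1) ab by simp
    then show ?thesis by metis
  qed
  ultimately show "frac_ext P \<sigma> \<in> field_auts F"
    unfolding field_auts_def bij_def surj_def using f_add f_mult on_P[OF PD(1)] one on_P F by auto
qed

lemma generate_field_frac:
  fixes V :: "'l::field set"
  assumes "generate_field type_ring V = UNIV"
  defines "P \<equiv> generate_ring type_ring V"
  shows "\<exists>p\<in>P. \<exists>q\<in>P. q \<noteq> 0 \<and> x = p / q"
proof -
  note PD = subring_typeD[OF subring_generate_type[of V], folded P_def]
  have "x \<in> generate_field type_ring V" using assms(1) by simp
  then show ?thesis
  proof induction
    case one then show ?case using PD(1) by (auto intro!: bexI[of _ 1])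
  next
    case (incl h)
    then have "h \<in> P" unfolding P_def by (rule generate_ring.incl)
    then show ?case using PD(1) by (intro bexI[of _ h] bexI[of _ 1]) auto
  next
    case (a_inv h)
    then obtain p q where pq: "p \<in> P" "q \<in> P" "q \<noteq> 0" "h = p / q" by blast
    then have "\<ominus>\<^bsub>type_ring\<^esub> h = (- p) / q" by simp
    then show ?case using pq PD(3) by blast
  next
    case (m_inv h)
    then obtain p q where pq: "p \<in> P" "q \<in> P" "q \<noteq> 0" "h = p / q" by blast
    moreover from this have "inv\<^bsub>type_ring\<^esub> h = q / p" using m_inv(2) by (simp add: type_ring_inv)
    moreover have "p \<noteq> 0" using pq m_inv(2) by auto
    ultimately show ?case by blast
  next
    case (eng_add h1 h2)
    then obtain p q p' q' where pq: "p \<in> P" "q \<in> P" "q \<noteq> 0" "h1 = p / q" "p' \<in> P" "q' \<in> P" "q' \<noteq> 0" "h2 = p' / q'" by blast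
    have "h1 \<oplus>\<^bsub>type_ring\<^esub> h2 = (p * q' + p' * q) / (q * q')" using pq by (simp add: field_simps)
    moreover have "p * q' + p' * q \<in> P" "q * q' \<in> P" "q * q' \<noteq> 0" using pq PD by auto
    ultimately show ?case by blast
  next
    case (eng_mult h1 h2)
    then obtain p q p' q' where pq: "p \<in> P" "q \<in> P" "q \<noteq> 0" "h1 = p / q" "p' \<in> P" "q' \<in> P" "q' \<noteq> 0" "h2 = p' / q'" by blast
    have "h1 \<otimes>\<^bsub>type_ring\<^esub> h2 = (p * p') / (q * q')" using pq by simp
    moreover have "p * p' \<in> P" "q * q' \<in> P" "q * q' \<noteq> 0" using pq PD by auto
    ultimately show ?case by blast
  qed
qed

section \<open>The ring of differential operators\<close>

lemma scalar_linearD: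
  assumes "scalar_linear \<kappa> D"
  shows "additive D" "D (f + h) = D f + D h" "D (f - h) = D f - D h" "D 0 = 0" "D (\<kappa> c * f) = \<kappa> c * D f"
proof -
  show add: "additive D" "D (f + h) = D f + D h" using assms by (auto simp: scalar_linear_def additive_def)
  show "D (f - h) = D f - D h" "D 0 = 0" using additive.diff[OF add(1)] additive.zero[OF add(1)] by auto
  show "D (\<kappa> c * f) = \<kappa> c * D f" using assms by (auto simp: scalar_linear_def)
qed

lemma diffop_order_linear: "diffop_order \<kappa> r D \<Longrightarrow> scalar_linear \<kappa> D"
  by (cases r) auto

lemma diffop_order_zero: "diffop_order \<kappa> r (\<lambda>_. 0)"
  by (induction r) (auto simp: scalar_linear_def)

lemma diffop_order_mult: "diffop_order \<kappa> 0 (\<lambda>f. a * f)"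
  by (auto simp: scalar_linear_def algebra_simps)

lemma diffop_order_add:
  "diffop_order \<kappa> r D \<Longrightarrow> diffop_order \<kappa> r D' \<Longrightarrow> diffop_order \<kappa> r (\<lambda>f. D f + D' f)"
proof (induction r arbitrary: D D')
  case 0 then show ?case by (auto simp: scalar_linear_def algebra_simps)
next
  case (Suc r)
  have "diffop_order \<kappa> r (\<lambda>f. (D (a * f) + D' (a * f)) - a * (D f + D' f))" for a
  proof -
    have "diffop_order \<kappa> r (\<lambda>f. (D (a * f) - a * D f) + (D' (a * f) - a * D' f))"
      by (rule Suc.IH) (use Suc.prems in auto)
    then show ?thesis by (simp add: algebra_simps)
  qed
  moreover have "scalar_linear \<kappa> (\<lambda>f. D f + D' f)"
    using Suc.prems by (auto simp: scalar_linear_def algebra_simps)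
  ultimately show ?case by simp
qed

lemma diffop_order_Suc: "diffop_order \<kappa> r D \<Longrightarrow> diffop_order \<kappa> (Suc r) D"
proof (induction r arbitrary: D)
  case 0 then show ?case by (simp add: diffop_order_zero[of \<kappa> 0, simplified])
next
  case (Suc r) then show ?case by auto
qed

lemma diffop_order_le: "r \<le> r' \<Longrightarrow> diffop_order \<kappa> r D \<Longrightarrow> diffop_order \<kappa> r' D"
  by (induction r' rule: dec_induct) (auto intro: diffop_order_Suc simp del: diffop_order.simps)

text \<open>The commutator of D D' with \<open>a\<close> is D [D', a] + [D, a] D', and both terms
  have smaller total order. An operator of order zero has zero commutators and is split off, as
  there is no smaller order to pass to.\<close>

lemma diffop_order_comp:
  "diffop_order \<kappa> r D \<Longrightarrow> diffop_order \<kappa> r' D' \<Longrightarrow> diffop_order \<kappa> (r + r') (D \<circ> D')"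
proof (induction "r + r'" arbitrary: r r' D D')
  case 0
  then have D: "scalar_linear \<kappa> D" "\<And>a f. D (a * f) = a * D f"
    and D': "scalar_linear \<kappa> D'" "\<And>a f. D' (a * f) = a * D' f" by auto
  have "scalar_linear \<kappa> (D \<circ> D')" using D D' by (auto simp: scalar_linear_def)
  then show ?case using 0 D(2) D'(2) by (simp add: comp_def)
next
  case (Suc N)
  note D = diffop_order_linear[OF Suc.prems(1)] and D' = diffop_order_linear[OF Suc.prems(2)]
  have lin: "scalar_linear \<kappa> (D \<circ> D')" using D D' by (auto simp: scalar_linear_def)
  have "diffop_order \<kappa> N (\<lambda>f. (D \<circ> D') (a * f) - a * (D \<circ> D') f)" for a
  proof -
    define C where "C f = D (a * f) - a * D f" for f
    define C' where "C' f = D' (a * f) - a * D' f" for f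
    have eq: "(D \<circ> D') (a * f) - a * (D \<circ> D') f = (D \<circ> C') f + (C \<circ> D') f" for f
      by (simp add: C_def C'_def scalar_linearD[OF D])
    have "diffop_order \<kappa> N (D \<circ> C')"
    proof (cases r')
      case 0
      then have "D \<circ> C' = (\<lambda>_. 0)" using Suc.prems(2) scalar_linearD(4)[OF D] by (simp add: C'_def fun_eq_iff)
      then show ?thesis by (simp add: diffop_order_zero)
    next
      case (Suc m)
      then have "diffop_order \<kappa> m C'" using Suc.prems(2) unfolding C'_def by simp
      then have "diffop_order \<kappa> (r + m) (D \<circ> C')" using Suc.hyps Suc Suc.prems(1) by simp
      then show ?thesis using Suc.hyps(2) Suc by simp
    qed
    moreover have "diffop_order \<kappa> N (C \<circ> D')"
    proof (cases r)
      case 0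
      then have "C \<circ> D' = (\<lambda>_. 0)" using Suc.prems(1) by (simp add: C_def fun_eq_iff)
      then show ?thesis by (simp add: diffop_order_zero)
    next
      case (Suc m)
      then have "diffop_order \<kappa> m C" using Suc.prems(1) unfolding C_def by simp
      then have "diffop_order \<kappa> (m + r') (C \<circ> D')" using Suc.hyps Suc Suc.prems(2) by simp
      then show ?thesis using Suc.hyps(2) Suc by simp
    qed
    ultimately show ?thesis unfolding eq by (rule diffop_order_add)
  qed
  then show ?case using lin by (simp add: Suc.hyps(2)[symmetric] comp_def)
qed

lemma diffops_simps:
  "D \<in> carrier (diffop_ring \<kappa>) \<longleftrightarrow> (\<exists>r. diffop_order \<kappa> r D)"
  "D \<otimes>\<^bsub>diffop_ring \<kappa>\<^esub> D' = D \<circ> D'" "D \<oplus>\<^bsub>diffop_ring \<kappa>\<^esub> D' = (\<lambda>f. D f + D' f)" "\<one>\<^bsub>diffop_ring \<kappa>\<^esub> = id"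
  by (auto simp: diffop_ring_def)

lemma diffops_closed:
  "(\<lambda>f. a * f) \<in> carrier (diffop_ring \<kappa>)"
  "D \<in> carrier (diffop_ring \<kappa>) \<Longrightarrow> D' \<in> carrier (diffop_ring \<kappa>) \<Longrightarrow> D \<circ> D' \<in> carrier (diffop_ring \<kappa>)"
  "D \<in> carrier (diffop_ring \<kappa>) \<Longrightarrow> D' \<in> carrier (diffop_ring \<kappa>) \<Longrightarrow> (\<lambda>f. D f + D' f) \<in> carrier (diffop_ring \<kappa>)"
proof -
  show "(\<lambda>f. a * f) \<in> carrier (diffop_ring \<kappa>)" unfolding diffops_simps using diffop_order_mult by blast
  assume "D \<in> carrier (diffop_ring \<kappa>)" "D' \<in> carrier (diffop_ring \<kappa>)"
  then obtain r r' where r: "diffop_order \<kappa> r D" "diffop_order \<kappa> r' D'" unfolding diffops_simps by blast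
  show "D \<circ> D' \<in> carrier (diffop_ring \<kappa>)" unfolding diffops_simps using diffop_order_comp[OF r] by blast
  have "diffop_order \<kappa> (max r r') (\<lambda>f. D f + D' f)"
    by (rule diffop_order_add) (use r in \<open>auto intro: diffop_order_le[rotated] simp del: diffop_order.simps\<close>)
  then show "(\<lambda>f. D f + D' f) \<in> carrier (diffop_ring \<kappa>)" unfolding diffops_simps by blast
qed

text \<open>The commutator of g.D with \<open>a\<close> is g.[D, h a], where \<open>h\<close> is the
  inverse of \<open>g\<close>; hence the action preserves the order.\<close>

lemma diffop_act_carrier:
  assumes g: "bij g" "\<And>a b. g (a + b) = g a + g b" and D: "D \<in> carrier torus_diffops"
  shows "diffop_act g D \<in> carrier torus_diffops"
proof -
  define h where "h = inv_into UNIV g"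
  have gh: "g (h x) = x" "h (g x) = x" for x using g(1) by (auto simp: h_def bij_is_surj surj_f_inv_f bij_is_inj)
  have h_add: "h (a + b) = h a + h b" for a b using gh g(2) by metis
  have h0: "h 0 = 0" "g 0 = 0" using h_add[of 0 0] g(2)[of 0 0] by auto
  have inv: "algebra_act g (algebra_act h f) = f" for f
    using gh algebra_act_id[of f] by (simp add: algebra_act_comp fun_eq_iff comp_def id_def)
  have diff: "algebra_act g (f - f') = algebra_act g f - algebra_act g f'" for f f'
    using algebra_act_add[of g "f - f'" f'] by simp
  obtain r where "diffop_order group_algebra_const r D" using D unfolding diffops_simps by blast
  then have "diffop_order group_algebra_const r (diffop_act g D)"
  proof (induction r arbitrary: D)
    case 0
    then have D: "scalar_linear group_algebra_const D" "\<And>a f. D (a * f) = a * D f" by auto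
    have "scalar_linear group_algebra_const (diffop_act g D)"
      using D by (auto simp: scalar_linear_def diffop_act_def h_def[symmetric] algebra_act_add
          algebra_act_mult g(2) h_add algebra_act_single h0)
    moreover have "diffop_act g D (a * f) - a * diffop_act g D f = 0" for a f
      by (simp add: diffop_act_def h_def[symmetric] algebra_act_mult h_add g(2) D(2) inv)
    ultimately show ?case by simp
  next
    case (Suc r)
    have lin: "scalar_linear group_algebra_const D" using Suc.prems by simp
    have "scalar_linear group_algebra_const (diffop_act g D)"
      using lin by (auto simp: scalar_linear_def diffop_act_def h_def[symmetric] algebra_act_add
          algebra_act_mult g(2) h_add algebra_act_single h0)
    moreover have "diffop_order group_algebra_const r (\<lambda>f. diffop_act g D (a * f) - a * diffop_act g D f)" for a
    proof -
      have "(\<lambda>f. diffop_act g D (a * f) - a * diffop_act g D f) =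
          diffop_act g (\<lambda>f. D (algebra_act h a * f) - algebra_act h a * D f)"
        by (simp add: fun_eq_iff diffop_act_def h_def[symmetric] algebra_act_mult h_add g(2) diff inv)
      moreover have "diffop_order group_algebra_const r (\<lambda>f. D (algebra_act h a * f) - algebra_act h a * D f)"
        using Suc.prems by simp
      ultimately show ?thesis using Suc.IH by simp
    qed
    ultimately show ?case by simp
  qed
  then show ?thesis unfolding diffops_simps by blast
qed


section \<open>The torus\<close>

lemma group_type_group: "group (type_group :: 'q::ab_group_add monoid)"
  by (rule groupI) (auto simp: type_group_def add.assoc intro: exI[of _ "- _"])

locale torus =
  fixes n :: nat
    and \<beta> :: "(nat \<Rightarrow>\<^sub>0 int) \<Rightarrow> 'q::ab_group_add"
    and G :: "('q \<Rightarrow> 'q) set"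
    and \<iota> :: "'k::field_char_0 \<Rightarrow> 'l::field"
    and t :: "nat \<Rightarrow> 'l"
    and \<phi> :: "(('q \<Rightarrow>\<^sub>0 'k) \<Rightarrow> ('q \<Rightarrow>\<^sub>0 'k)) \<Rightarrow> 'l skew"
    and P :: "'l set"
  defines "P \<equiv> poly_subring \<iota> n t"
  assumes beta: "\<beta> \<in> iso (free_Abelian_group {..<n}) type_group"
    and G: "subgroup G (AutoGroup type_group)" and finite_G: "finite G"
    and rff: "rational_function_field \<iota> n t"
    and ident: "torus_identification \<iota> n t \<beta> \<phi>"
    and stable: "\<And>g p. g \<in> G \<Longrightarrow> p \<in> P \<Longrightarrow> transported_act \<phi> g (skew_const p) \<in> skew_const ` P"
begin

abbreviation "F \<equiv> free_Abelian_group {..<n}"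
abbreviation "coord \<equiv> coordinate n \<beta>"
abbreviation "DO \<equiv> carrier (torus_diffops :: (('q \<Rightarrow>\<^sub>0 'k) \<Rightarrow> ('q \<Rightarrow>\<^sub>0 'k)) ring)"
abbreviation "Y \<equiv> t ` {..<n}"

definition vec :: "'q \<Rightarrow> nat \<Rightarrow>\<^sub>0 int" where "vec = inv_into (carrier F) \<beta>"

lemma beta_bij: "bij_betw \<beta> (carrier F) UNIV"
  and beta_add: "keys a \<subseteq> {..<n} \<Longrightarrow> keys b \<subseteq> {..<n} \<Longrightarrow> \<beta> (a + b) = \<beta> a + \<beta> b"
  using beta by (auto simp: iso_def hom_def type_group_def)

lemma beta_vec: "\<beta> (vec q) = q" and keys_vec: "keys (vec q) \<subseteq> {..<n}"
proof -
  have q: "q \<in> \<beta> ` carrier F" using beta_bij by (simp add: bij_betw_def)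
  show "\<beta> (vec q) = q" unfolding vec_def by (rule f_inv_into_f[OF q])
  show "keys (vec q) \<subseteq> {..<n}" using inv_into_into[OF q] unfolding vec_def by simp
qed

lemma vec_beta: "keys z \<subseteq> {..<n} \<Longrightarrow> vec (\<beta> z) = z"
  unfolding vec_def by (rule inv_into_f_f) (use beta_bij in \<open>auto simp: bij_betw_def\<close>)

lemma beta_zero: "\<beta> 0 = 0"
  using beta_add[of 0 0] by simp

lemma beta_uminus: "keys a \<subseteq> {..<n} \<Longrightarrow> \<beta> (- a) = - \<beta> a"
  using beta_add[of a "- a"] beta_zero by (simp add: eq_neg_iff_add_eq_0 add.commute)

lemma beta_diff: "keys a \<subseteq> {..<n} \<Longrightarrow> keys b \<subseteq> {..<n} \<Longrightarrow> \<beta> (a - b) = \<beta> a - \<beta> b"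
  using beta_add[of a "- b"] beta_uminus[of b] by simp

lemma vec_add: "vec (a + b) = vec a + vec b"
proof -
  have "keys (vec a + vec b) \<subseteq> {..<n}" using keys_add[of "vec a" "vec b"] keys_vec by blast
  then show ?thesis using vec_beta[of "vec a + vec b"] beta_add[OF keys_vec keys_vec, of a b] by (simp add: beta_vec)
qed

lemma coord_eq: "coord i q = lookup (vec q) i"
  by (simp add: coordinate_def vec_def)

lemma coord_add: "coord i (a + b) = coord i a + coord i b"
  by (simp add: coord_eq vec_add lookup_add)

lemma coord_zero: "coord i 0 = 0" and coord_diff: "coord i (a - b) = coord i a - coord i b"
  using coord_add[of i 0 0] coord_add[of i "a - b" b] by simp_all

lemma coord_inj:
  assumes "\<And>i. i < n \<Longrightarrow> coord i a = coord i b"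
  shows "a = b"
proof -
  have out: "lookup (vec c) i = 0" if "\<not> i < n" for c i
  proof -
    have "i \<notin> keys (vec c)" using keys_vec[of c] that by auto
    then show ?thesis by (simp add: in_keys_iff)
  qed
  have "lookup (vec a) i = lookup (vec b) i" for i
    using assms[of i] out by (cases "i < n") (simp_all add: coord_eq)
  then have "vec a = vec b" by (rule poly_mapping_eqI)
  then show ?thesis using beta_vec by metis
qed

lemma frag_keys: "i < n \<Longrightarrow> keys (frag_of i) \<subseteq> {..<n}"
  by (simp add: keys_frag_of)

lemma coord_frag: "i < n \<Longrightarrow> coord j (\<beta> (frag_of i)) = (if j = i then 1 else 0)"
  by (simp add: coord_eq vec_beta frag_keys)

sublocale frac_generated \<iota> Y P
proof
  show P: "P = generate_ring type_ring (range \<iota> \<union> Y)" by (simp add: P_def poly_subring_def)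
  have "generate_field type_ring (range \<iota> \<union> Y) = UNIV" using rff by (simp add: rational_function_field_def)
  from generate_field_frac[OF this] show "\<exists>p\<in>P. \<exists>q\<in>P. q \<noteq> 0 \<and> x = p / q" for x unfolding P .
qed (use rff in \<open>auto simp: rational_function_field_def ring_hom_def\<close>)

lemma t_P: "i < n \<Longrightarrow> t i \<in> P"
  by (rule Y_P) simp

definition XM :: "'q \<Rightarrow> ('q \<Rightarrow>\<^sub>0 'k) \<Rightarrow> ('q \<Rightarrow>\<^sub>0 'k)" where "XM q = (\<lambda>f. single q 1 * f)"

lemma XM_DO: "XM q \<in> DO"
  unfolding XM_def by (rule diffops_closed)

lemma XM_add: "XM (a + b) = XM a \<circ> XM b"
  by (simp add: XM_def fun_eq_iff mult_single mult.assoc[symmetric])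

lemma XM_zero: "XM 0 = id"
  by (simp add: XM_def fun_eq_iff)

lemma XM_inverse: "XM q (XM (- q) f) = f" "XM (- q) (XM q f) = f"
  by (simp_all add: XM_def mult_single mult.assoc[symmetric])

lemma scalar_DO: "(\<lambda>f. group_algebra_const c * f) \<in> DO"
  by (rule diffops_closed)

section \<open>The operators t_i as differential operators\<close>

lemma torus_deriv_supset:
  "finite A \<Longrightarrow> keys f \<subseteq> A \<Longrightarrow> torus_deriv n \<beta> i f =
    (\<Sum>q\<in>A. single (q - \<beta> (frag_of i)) (of_int (coord i q) * lookup f q))"
  unfolding torus_deriv_def by (rule sum.mono_neutral_left) (auto simp: in_keys_iff)

lemma torus_t_add: "torus_t n \<beta> i (f + h) = torus_t n \<beta> i f + torus_t n \<beta> i (h :: 'q \<Rightarrow>\<^sub>0 'k)"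
proof -
  have "torus_deriv n \<beta> i (f + h) = torus_deriv n \<beta> i f + torus_deriv n \<beta> i h" for f h :: "'q \<Rightarrow>\<^sub>0 'k"
  proof -
    note s = torus_deriv_supset[where A = "keys f \<union> keys h"]
    show ?thesis using keys_add[of f h]
      by (simp add: s[of f] s[of h] s[of "f + h"] lookup_add distrib_left single_add sum.distrib)
  qed
  then show ?thesis by (simp add: torus_t_def distrib_left)
qed

lemma torus_t_zero: "torus_t n \<beta> i (0 :: 'q \<Rightarrow>\<^sub>0 'k) = 0"
  using torus_t_add[of i 0 0] by simp

lemma torus_t_single:
  "i < n \<Longrightarrow> torus_t n \<beta> i (single q c) = single q (of_int (coord i q + 1) * (c :: 'k))"
  by (simp add: torus_t_def torus_var_def mult_single,
      subst torus_deriv_supset[of "{\<beta> (frag_of i) + q}"])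
     (auto simp: coord_add coord_frag add.commute)

text \<open>The operator t_i is the Euler derivation x_i d/dx_i plus the identity. So
  \<open>torus_t n \<beta> i a - a\<close> is the derivation applied to \<open>a\<close>, and the
  commutator of t_i with \<open>a\<close> is multiplication by it; t_i has order at most
  one.\<close>

lemma torus_t_leibniz:
  assumes i: "i < n"
  shows "torus_t n \<beta> i (a * f) = a * torus_t n \<beta> i f + (torus_t n \<beta> i a - a) * (f :: 'q \<Rightarrow>\<^sub>0 'k)"
proof (induction a rule: poly_mapping_additive_induct)
  case zero show ?case by (simp add: torus_t_zero)
next
  case (add u v) then show ?case by (simp add: distrib_right torus_t_add algebra_simps)
next
  case (single p x)
  show ?case
  proof (induction f rule: poly_mapping_additive_induct)
    case zero show ?case by (simp add: torus_t_zero)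
  next
    case (add u v) then show ?case by (simp add: distrib_left torus_t_add algebra_simps)
  next
    case (single q y)
    show ?case
      by (simp add: mult_single torus_t_single[OF i] coord_add single_add[symmetric] single_diff[symmetric] algebra_simps)
  qed
qed

lemma torus_t_DO:
  assumes i: "i < n"
  shows "torus_t n \<beta> i \<in> DO"
proof -
  have "scalar_linear group_algebra_const (torus_t n \<beta> i :: ('q \<Rightarrow>\<^sub>0 'k) \<Rightarrow> _)"
    by (simp add: scalar_linear_def torus_t_add torus_t_leibniz[OF i] torus_t_single[OF i] coord_zero)
  moreover have "diffop_order group_algebra_const 0 (\<lambda>f. torus_t n \<beta> i (a * f) - a * torus_t n \<beta> i f)"
    for a :: "'q \<Rightarrow>\<^sub>0 'k"
    unfolding torus_t_leibniz[OF i] add_diff_cancel_left' by (rule diffop_order_mult)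
  ultimately have "diffop_order group_algebra_const (Suc 0) (torus_t n \<beta> i :: ('q \<Rightarrow>\<^sub>0 'k) \<Rightarrow> _)" by simp
  then show ?thesis unfolding diffops_simps by blast
qed

text \<open>On x^r the eigenvalue drops from r_i + 1 to r_i - q_i + 1. This is the shift rule for
  the t_i, seen on differential operators.\<close>

lemma torus_t_conj:
  assumes i: "i < n"
  shows "XM q \<circ> torus_t n \<beta> i \<circ> XM (- q) = (\<lambda>f. torus_t n \<beta> i f + group_algebra_const (- of_int (coord i q)) * f)"
proof
  fix f
  show "(XM q \<circ> torus_t n \<beta> i \<circ> XM (- q)) f = torus_t n \<beta> i f + group_algebra_const (- of_int (coord i q)) * f"
  proof (induction f rule: poly_mapping_additive_induct)
    case zero show ?case by (simp add: XM_def torus_t_zero)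
  next
    case (add u v) then show ?case by (simp add: XM_def torus_t_add algebra_simps)
  next
    case (single r c)
    show ?case
      by (simp add: XM_def mult_single torus_t_single[OF i] single_add[symmetric])
         (simp add: coord_diff algebra_simps)
  qed
qed

section \<open>The identification with the skew group ring\<close>

abbreviation "MM \<equiv> shifts \<iota> n t"

definition PS :: "'l skew set" where "PS = carrier (poly_skew_ring \<iota> n t)"

lemma PS_iff: "u \<in> PS \<longleftrightarrow> keys u \<subseteq> MM \<and> (\<forall>m. lookup u m \<in> P)"
  by (simp add: PS_def poly_skew_ring_def skew_ring_def P_def)

lemma phi_iso: "\<phi> \<in> ring_iso torus_diffops (poly_skew_ring \<iota> n t)"
  using ident by (simp add: torus_identification_def)

lemma phi_bij: "bij_betw \<phi> DO PS"
  and phi_mult: "D \<in> DO \<Longrightarrow> D' \<in> DO \<Longrightarrow> \<phi> (D \<circ> D') = skew_mult (\<phi> D) (\<phi> D')"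
  and phi_add: "D \<in> DO \<Longrightarrow> D' \<in> DO \<Longrightarrow> \<phi> (\<lambda>f. D f + D' f) = \<phi> D + \<phi> D'"
  and phi_one: "\<phi> id = single id 1"
  using phi_iso
  by (simp_all add: ring_iso_def ring_hom_def PS_def[symmetric] diffops_simps)
     (simp_all add: poly_skew_ring_def skew_ring_def diffops_simps)

lemma phi_scalar: "\<phi> (\<lambda>f. group_algebra_const c * f) = skew_const (\<iota> c)"
  and phi_var: "i < n \<Longrightarrow> \<phi> (XM (\<beta> (frag_of i))) = single (shift \<iota> n t (frag_of i)) 1"
  and phi_var_inv: "i < n \<Longrightarrow> \<phi> (XM (- \<beta> (frag_of i))) = single (shift \<iota> n t (- frag_of i)) 1"
  and phi_t: "i < n \<Longrightarrow> \<phi> (torus_t n \<beta> i) = skew_const (t i)"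
  using ident by (auto simp: torus_identification_def torus_var_def torus_var_inv_def XM_def)

definition psi :: "'l skew \<Rightarrow> ('q \<Rightarrow>\<^sub>0 'k) \<Rightarrow> ('q \<Rightarrow>\<^sub>0 'k)" where "psi = inv_into DO \<phi>"

lemma psi_DO: "u \<in> PS \<Longrightarrow> psi u \<in> DO" and phi_psi: "u \<in> PS \<Longrightarrow> \<phi> (psi u) = u"
  and psi_phi: "D \<in> DO \<Longrightarrow> psi (\<phi> D) = D" and phi_PS: "D \<in> DO \<Longrightarrow> \<phi> D \<in> PS"
  unfolding psi_def
  by (use phi_bij in \<open>auto simp: bij_betw_def intro: inv_into_into f_inv_into_f[of u \<phi> DO]\<close>)

lemma psi_eqI: "D \<in> DO \<Longrightarrow> \<phi> D = u \<Longrightarrow> psi u = D"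
  using psi_phi by auto

lemma id_DO: "id \<in> DO"
  using XM_DO[of 0] XM_zero by simp

text \<open>Nothing is known yet about the shifts, not even that the descriptions defining them are
  met. That \<open>id\<close> is one of them is read off from \<open>\<phi> id\<close>, the unit,
  which lies in the target of \<open>\<phi>\<close>.\<close>

lemma id_MM: "id \<in> MM"
  using phi_PS[OF id_DO] unfolding phi_one PS_iff by simp

lemma const_PS: "p \<in> P \<Longrightarrow> skew_const p \<in> PS"
  using id_MM P_closed(2) by (auto simp: PS_iff skew_const_def lookup_single when_def)

text \<open>Computed from the definition, because \<open>MM\<close> is not yet known to consist of
  automorphisms.\<close>

lemma const_mult: "skew_mult (skew_const a) (skew_const b) = skew_const (a * b)"
  by (subst skew_mult_supset[of "{id}" _ "{id}"]) (auto simp: skew_const_def)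

lemma const_add: "skew_const (a + b) = skew_const a + skew_const b"
  by (simp add: skew_const_def single_add)

lemma const_inj: "skew_const a = skew_const b \<longleftrightarrow> a = b"
  unfolding skew_const_def by (metis lookup_single_eq)

lemma lookup_const: "lookup (skew_const a) id = a"
  by (simp add: skew_const_def)

section \<open>Automorphisms of differential operators and of the coefficients\<close>

text \<open>Both conjugation by a monomial and the action of \<open>g \<in> G\<close> are of this kind.\<close>

definition DO_hom :: "((('q \<Rightarrow>\<^sub>0 'k) \<Rightarrow> ('q \<Rightarrow>\<^sub>0 'k)) \<Rightarrow> ('q \<Rightarrow>\<^sub>0 'k) \<Rightarrow> ('q \<Rightarrow>\<^sub>0 'k)) \<Rightarrow> bool"
  where "DO_hom C \<longleftrightarrow> (\<forall>D\<in>DO. C D \<in> DO) \<and> C id = id \<and>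
    (\<forall>D\<in>DO. \<forall>D'\<in>DO. C (D \<circ> D') = C D \<circ> C D' \<and> C (\<lambda>f. D f + D' f) = (\<lambda>f. C D f + C D' f)) \<and>
    (\<forall>c. C (\<lambda>f. group_algebra_const c * f) = (\<lambda>f. group_algebra_const c * f))"

definition transp :: "((('q \<Rightarrow>\<^sub>0 'k) \<Rightarrow> ('q \<Rightarrow>\<^sub>0 'k)) \<Rightarrow> ('q \<Rightarrow>\<^sub>0 'k) \<Rightarrow> ('q \<Rightarrow>\<^sub>0 'k)) \<Rightarrow> 'l skew \<Rightarrow> 'l skew"
  where "transp C u = \<phi> (C (psi u))"

text \<open>Reading off the coefficient at \<open>id\<close> follows \<open>field_act\<close>; it
  loses nothing once \<open>transp C\<close> sends constants from \<open>P\<close> to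
  constants.\<close>

definition coeff_act :: "((('q \<Rightarrow>\<^sub>0 'k) \<Rightarrow> ('q \<Rightarrow>\<^sub>0 'k)) \<Rightarrow> ('q \<Rightarrow>\<^sub>0 'k) \<Rightarrow> ('q \<Rightarrow>\<^sub>0 'k)) \<Rightarrow> 'l \<Rightarrow> 'l"
  where "coeff_act C p = lookup (transp C (skew_const p)) id"

lemma PS_closed: "u \<in> PS \<Longrightarrow> v \<in> PS \<Longrightarrow> u + v \<in> PS" "u \<in> PS \<Longrightarrow> v \<in> PS \<Longrightarrow> skew_mult u v \<in> PS"
proof -
  assume u: "u \<in> PS" and v: "v \<in> PS"
  have "u + v = \<phi> (\<lambda>f. psi u f + psi v f)" "skew_mult u v = \<phi> (psi u \<circ> psi v)"
    using u v by (simp_all add: phi_add phi_mult psi_DO phi_psi)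
  then show "u + v \<in> PS" "skew_mult u v \<in> PS"
    using u v by (simp_all add: phi_PS diffops_closed psi_DO)
qed

lemma transp_hom:
  assumes C: "DO_hom C" and u: "u \<in> PS" and v: "v \<in> PS"
  shows "transp C u \<in> PS" "transp C (u + v) = transp C u + transp C v"
    "transp C (skew_mult u v) = skew_mult (transp C u) (transp C v)"
proof -
  have C_DO: "C D \<in> DO" if "D \<in> DO" for D using C that by (auto simp: DO_hom_def)
  show "transp C u \<in> PS" unfolding transp_def using C_DO phi_PS psi_DO u by simp
  have "psi (u + v) = (\<lambda>f. psi u f + psi v f)"
    by (rule psi_eqI) (use u v in \<open>simp_all add: diffops_closed psi_DO phi_add phi_psi\<close>)
  moreover have "C (\<lambda>f. psi u f + psi v f) = (\<lambda>f. C (psi u) f + C (psi v) f)"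
    using C u v psi_DO by (auto simp: DO_hom_def)
  ultimately show "transp C (u + v) = transp C u + transp C v"
    unfolding transp_def using phi_add[OF C_DO C_DO, OF psi_DO psi_DO, OF u v] by simp
  have "psi (skew_mult u v) = psi u \<circ> psi v"
    by (rule psi_eqI) (use u v in \<open>simp_all add: diffops_closed psi_DO phi_mult phi_psi\<close>)
  moreover have "C (psi u \<circ> psi v) = C (psi u) \<circ> C (psi v)"
    using C u v psi_DO unfolding DO_hom_def by blast
  ultimately show "transp C (skew_mult u v) = skew_mult (transp C u) (transp C v)"
    unfolding transp_def using phi_mult[OF C_DO C_DO, OF psi_DO psi_DO, OF u v] by simp
qed

lemma transp_phi: "D \<in> DO \<Longrightarrow> transp C (\<phi> D) = \<phi> (C D)"
  by (simp add: transp_def psi_phi)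

lemma transp_scalar: "DO_hom C \<Longrightarrow> transp C (skew_const (\<iota> c)) = skew_const (\<iota> c)"
  using transp_phi[OF scalar_DO, of C c] by (simp add: phi_scalar DO_hom_def)

text \<open>Mutually inverse homomorphisms of differential operators that both keep \<open>P\<close>
  inside the constants give mutually inverse ring homomorphisms of \<open>P\<close> over k, and
  these extend to fractions.\<close>

lemma coeff_act_aut:
  assumes C: "DO_hom C" and C': "DO_hom C'"
    and inv: "\<And>D. D \<in> DO \<Longrightarrow> C (C' D) = D" "\<And>D. D \<in> DO \<Longrightarrow> C' (C D) = D"
    and P: "\<And>p. p \<in> P \<Longrightarrow> transp C (skew_const p) \<in> skew_const ` P"
      "\<And>p. p \<in> P \<Longrightarrow> transp C' (skew_const p) \<in> skew_const ` P"
  shows "\<And>p. p \<in> P \<Longrightarrow> coeff_act C p \<in> P"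
    and "\<And>p. p \<in> P \<Longrightarrow> transp C (skew_const p) = skew_const (coeff_act C p)"
    and "frac_ext P (coeff_act C) \<in> field_auts (range \<iota>)"
    and "\<And>p. p \<in> P \<Longrightarrow> frac_ext P (coeff_act C) p = coeff_act C p"
proof -
  have act: "coeff_act C p \<in> P \<and> transp C (skew_const p) = skew_const (coeff_act C p)" if p: "p \<in> P" for p
    using P(1)[OF p] by (auto simp: coeff_act_def lookup_const)
  have act': "coeff_act C' p \<in> P \<and> transp C' (skew_const p) = skew_const (coeff_act C' p)" if p: "p \<in> P" for p
    using P(2)[OF p] by (auto simp: coeff_act_def lookup_const)
  show "\<And>p. p \<in> P \<Longrightarrow> coeff_act C p \<in> P"
    and "\<And>p. p \<in> P \<Longrightarrow> transp C (skew_const p) = skew_const (coeff_act C p)" using act by auto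
  have DO: "C D \<in> DO" "C' D \<in> DO" if "D \<in> DO" for D using C C' that by (auto simp: DO_hom_def)
  have inv1: "transp C (transp C' u) = u" "transp C' (transp C u) = u" if "u \<in> PS" for u
    using that by (simp_all add: transp_def psi_phi psi_DO DO inv phi_psi)
  have add: "coeff_act C (p + q) = coeff_act C p + coeff_act C q"
    and mult: "coeff_act C (p * q) = coeff_act C p * coeff_act C q" if pq: "p \<in> P" "q \<in> P" for p q
  proof -
    have "skew_const (coeff_act C (p + q)) = skew_const (coeff_act C p + coeff_act C q)"
      using act[OF pq(1)] act[OF pq(2)] act[OF P_closed(4)[OF pq]] transp_hom(2)[OF C const_PS const_PS, OF pq]
      by (simp add: const_add)
    then show "coeff_act C (p + q) = coeff_act C p + coeff_act C q" by (simp add: const_inj)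
    have "skew_const (coeff_act C (p * q)) = skew_const (coeff_act C p * coeff_act C q)"
      using act[OF pq(1)] act[OF pq(2)] act[OF P_closed(6)[OF pq]] transp_hom(3)[OF C const_PS const_PS, OF pq]
      by (simp add: const_mult)
    then show "coeff_act C (p * q) = coeff_act C p * coeff_act C q" by (simp add: const_inj)
  qed
  have scalar: "coeff_act C (\<iota> c) = \<iota> c" for c
    by (simp add: coeff_act_def transp_scalar[OF C] lookup_const)
  have inverse: "coeff_act C (coeff_act C' p) = p" "coeff_act C' (coeff_act C p) = p" if p: "p \<in> P" for p
  proof -
    have "skew_const (coeff_act C (coeff_act C' p)) = skew_const p"
      using act[of "coeff_act C' p"] act'[OF p] inv1(1)[OF const_PS[OF p]] by metis
    then show "coeff_act C (coeff_act C' p) = p" by (simp add: const_inj)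
    have "skew_const (coeff_act C' (coeff_act C p)) = skew_const p"
      using act'[of "coeff_act C p"] act[OF p] inv1(2)[OF const_PS[OF p]] by metis
    then show "coeff_act C' (coeff_act C p) = p" by (simp add: const_inj)
  qed
  note ext = frac_ext_aut[OF subring_P frac, of "coeff_act C" "coeff_act C'" "range \<iota>"]
  show "frac_ext P (coeff_act C) \<in> field_auts (range \<iota>)"
    by (rule ext(1)) (use act act' add mult inverse scalar scalar[of 1] iota_P in \<open>auto simp: iota_1\<close>)
  show "frac_ext P (coeff_act C) p = coeff_act C p" if "p \<in> P" for p
    by (rule ext(2)[OF _ _ _ _ _ _ _ _ _ that])
       (use act act' add mult inverse scalar scalar[of 1] iota_P in \<open>auto simp: iota_1\<close>)
qed

definition cj :: "'q \<Rightarrow> (('q \<Rightarrow>\<^sub>0 'k) \<Rightarrow> ('q \<Rightarrow>\<^sub>0 'k)) \<Rightarrow> ('q \<Rightarrow>\<^sub>0 'k) \<Rightarrow> ('q \<Rightarrow>\<^sub>0 'k)"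
  where "cj q D = XM q \<circ> D \<circ> XM (- q)"

lemma DO_hom_cj: "DO_hom (cj q)"
  unfolding DO_hom_def
proof (intro conjI ballI allI)
  show "cj q D \<in> DO" if "D \<in> DO" for D
    unfolding cj_def using that XM_DO by (intro diffops_closed)
qed (auto simp: cj_def fun_eq_iff XM_inverse, auto simp: XM_def distrib_left mult.left_commute mult_single mult.assoc[symmetric])

lemma cj_inverse: "cj q (cj (- q) D) = D" "cj (- q) (cj q D) = D"
  by (auto simp: cj_def fun_eq_iff XM_inverse XM_inverse[of "- q", simplified])

lemma transp_cj_t:
  assumes i: "i < n"
  shows "transp (cj q) (skew_const (t i)) = skew_const (t i - of_int (coord i q))"
proof -
  have "transp (cj q) (skew_const (t i)) = \<phi> (cj q (torus_t n \<beta> i))"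
    using transp_phi[OF torus_t_DO[OF i]] phi_t[OF i] by metis
  also have "cj q (torus_t n \<beta> i) = (\<lambda>f. torus_t n \<beta> i f + group_algebra_const (- of_int (coord i q)) * f)"
    unfolding cj_def by (rule torus_t_conj[OF i])
  also have "\<phi> \<dots> = skew_const (t i) + skew_const (\<iota> (- of_int (coord i q)))"
    using phi_add[OF torus_t_DO[OF i] scalar_DO] by (simp add: phi_t[OF i] phi_scalar)
  finally show ?thesis by (simp add: const_add[symmetric] iota_uminus iota_of_int)
qed

text \<open>For G stability of \<open>P\<close> is a hypothesis; for conjugation by a monomial it
  follows, since the elements with the property form a subring containing k and each t_i, the latter
  being sent to t_i - q_i.\<close>

lemma transp_cj_P:
  assumes "p \<in> P"
  shows "transp (cj q) (skew_const p) \<in> skew_const ` P"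
proof -
  note hom = transp_hom[OF DO_hom_cj, OF const_PS const_PS] and scalar = transp_scalar[OF DO_hom_cj, of q]
  define R where "R = {p \<in> P. transp (cj q) (skew_const p) \<in> skew_const ` P}"
  have add: "x + y \<in> R" and mult: "x * y \<in> R" if xy: "x \<in> R" "y \<in> R" for x y
  proof -
    obtain x' y' where x': "x' \<in> P" "transp (cj q) (skew_const x) = skew_const x'"
      and y': "y' \<in> P" "transp (cj q) (skew_const y) = skew_const y'" using xy unfolding R_def by auto
    have "x \<in> P" "y \<in> P" using xy by (auto simp: R_def)
    then show "x + y \<in> R" "x * y \<in> R"
      using hom(2,3)[of x y q] x' y' P_closed(4,6) by (auto simp: R_def const_add[symmetric] const_mult)
  qed
  have iota: "\<iota> c \<in> R" for c using scalar iota_P by (auto simp: R_def)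
  have "subring R type_ring"
    unfolding subring_type_iff using add mult iota[of 1] mult[OF iota[of "- 1"]] by (auto simp: iota_1 iota_uminus)
  moreover have "range \<iota> \<union> Y \<subseteq> R"
    using iota t_P transp_cj_t P_closed(5)[OF t_P of_int_P] by (auto simp: R_def)
  ultimately have "P \<subseteq> R" unfolding P_gen by (rule generate_type_least)
  then show ?thesis using assms by (auto simp: R_def)
qed

definition s :: "'q \<Rightarrow> 'l \<Rightarrow> 'l" where "s q = shift \<iota> n t (vec q)"

text \<open>The shift exists because it is conjugation by a monomial, transported to \<open>k[t\<^sub>1,\<dots>,t\<^sub>n]\<close>.\<close>

lemma shift_spec:
  assumes "\<And>j. j < n \<Longrightarrow> lookup v j = coord j q"
  shows "shift \<iota> n t v = s q" "s q \<in> field_auts (range \<iota>)" "j < n \<Longrightarrow> s q (t j) = t j - of_int (coord j q)"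
proof -
  let ?f = "frac_ext P (coeff_act (cj q))"
  have inv: "cj q (cj (- q) D) = D" "cj (- q) (cj q D) = D" for D by (rule cj_inverse)+
  note ext = coeff_act_aut[OF DO_hom_cj DO_hom_cj inv transp_cj_P transp_cj_P]
  have f: "?f \<in> field_auts (range \<iota>)" by (rule ext(3))
  have ft: "?f (t j) = t j - of_int (coord j q)" if "j < n" for j
    using ext(4)[OF _ _ t_P[OF that]] by (simp add: coeff_act_def transp_cj_t[OF that] lookup_const)
  \<comment> \<open>Only coordinates below \<open>n\<close> enter the description, so any
    \<open>w\<close> that agrees with \<open>q\<close> there defines the same automorphism.\<close>
  have "shift \<iota> n t w = ?f" if w: "\<And>j. j < n \<Longrightarrow> lookup w j = coord j q" for w
    unfolding shift_def
  proof (rule the_equality)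
    show "?f \<in> field_auts (range \<iota>) \<and> (\<forall>j<n. ?f (t j) = t j - of_int (lookup w j))" using f ft w by simp
    fix f' assume "f' \<in> field_auts (range \<iota>) \<and> (\<forall>j<n. f' (t j) = t j - of_int (lookup w j))"
    then show "f' = ?f" using f ft w by (intro aut_eqI) auto
  qed
  then have "shift \<iota> n t v = ?f" "s q = ?f" using assms by (auto simp: s_def coord_eq)
  then show "shift \<iota> n t v = s q" "s q \<in> field_auts (range \<iota>)" "j < n \<Longrightarrow> s q (t j) = t j - of_int (coord j q)"
    using f ft by auto
qed

lemma s_aut: "s q \<in> field_auts (range \<iota>)" and s_t: "j < n \<Longrightarrow> s q (t j) = t j - of_int (coord j q)"
  using shift_spec[of "vec q" q] by (auto simp: coord_eq)

lemma shift_beta: "keys z \<subseteq> {..<n} \<Longrightarrow> shift \<iota> n t z = s (\<beta> z)"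
  by (rule shift_spec(1)) (simp add: coord_eq vec_beta)

lemma MM_eq: "MM = range s"
proof
  show "MM \<subseteq> range s" unfolding shifts_def using shift_beta by auto
  show "range s \<subseteq> MM" unfolding shifts_def s_def using keys_vec by auto
qed

lemma s_of_int: "s q (of_int k) = of_int k"
  using field_autsD(14)[OF s_aut, of "of_int k" q] iota_of_int[of k] by (metis rangeI)

lemma s_add: "s (a + b) = s a \<circ> s b"
proof (rule aut_eqI[OF s_aut field_auts_comp[OF s_aut s_aut]])
  fix y assume "y \<in> Y"
  then show "s (a + b) y = (s a \<circ> s b) y"
    by (auto simp: s_t field_autsD(9)[OF s_aut] s_of_int coord_add)
qed

text \<open>Coordinates are compared as integers in k: its characteristic is zero and it embeds in
  L.\<close>

lemma inj_s: "inj s"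
proof (rule injI, rule coord_inj)
  fix a b i assume "s a = s b" "i < n"
  then have "of_int (coord i a) = (of_int (coord i b) :: 'l)" using s_t[of i a] s_t[of i b] by simp
  then have "\<iota> (of_int (coord i a)) = \<iota> (of_int (coord i b))" by (simp add: iota_of_int)
  then have "(of_int (coord i a) :: 'k) = of_int (coord i b)" by (rule injD[OF inj_iota])
  then show "coord i a = coord i b" by simp
qed

lemma s_P: "p \<in> P \<Longrightarrow> s q p \<in> P"
proof -
  note S = field_autsD[OF s_aut[of q]]
  assume "p \<in> P"
  then show ?thesis
    unfolding P_gen
  proof induction
    case (incl h)
    then show ?case using S(14) iota_P s_t P_closed(5)[OF t_P of_int_P] by (auto simp: P_gen[symmetric])
  qed (auto simp: S(4,6,7,8) intro: generate_ring.intros subring_typeD[OF subring_generate_type])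
qed

lemma s_zero: "s 0 = id"
  using shift_spec(1)[of 0 0] by (intro aut_eqI[OF s_aut id_field_auts]) (auto simp: s_t coord_zero)

sublocale mm: aut_monoid MM
  by (unfold_locales, unfold MM_eq)
     (use field_autsD[OF s_aut] s_zero in \<open>auto simp: s_add[symmetric] intro: range_eqI[of _ _ 0]\<close>)

lemma s_MM: "s q \<in> MM"
  by (simp add: MM_eq)

lemma phi_X: "\<phi> (XM q) = single (s q) 1"
proof -
  \<comment> \<open>The induction over a free abelian group proceeds by differences, so
    \<open>z\<close> and its negative are treated together.\<close>
  have "keys z \<subseteq> {..<n} \<Longrightarrow> keys z \<subseteq> {..<n} \<and>
      \<phi> (XM (\<beta> z)) = single (s (\<beta> z)) 1 \<and> \<phi> (XM (- \<beta> z)) = single (s (- \<beta> z)) 1" for z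
  proof (induction z rule: frag_induction)
    case zero
    show ?case by (simp only: beta_zero minus_zero XM_zero phi_one s_zero keys_zero empty_subsetI simp_thms)
  next
    case (one i)
    then show ?case
      using phi_var[of i] phi_var_inv[of i] shift_beta[of "frag_of i"] shift_beta[of "- frag_of i"] frag_keys[of i]
      by (simp add: beta_uminus)
  next
    case (diff a b)
    have mult: "\<phi> (XM (q + r)) = single (s (q + r)) 1"
      if "\<phi> (XM q) = single (s q) 1" "\<phi> (XM r) = single (s r) 1" for q r
      using phi_mult[OF XM_DO XM_DO, of q r] that
      by (simp add: XM_add[symmetric] mm.skew_mult_single s_MM s_add[symmetric] field_autsD(4)[OF s_aut])
    have "keys (a - b) \<subseteq> {..<n}" using diff keys_diff[of a b] by blast
    then show ?case
      using diff mult[of "\<beta> a" "- \<beta> b"] mult[of "\<beta> b" "- \<beta> a"] by (simp add: beta_diff)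
  qed
  from this[OF keys_vec[of q]] show ?thesis by (simp add: beta_vec)
qed

end


section \<open>The action of G on differential operators and its transport to L\<close>

lemma diffop_act_comp:
  assumes "bij g" "bij h"
  shows "diffop_act (g \<circ> h) D = diffop_act g (diffop_act h D)"
  by (simp add: fun_eq_iff diffop_act_def algebra_act_comp o_inv_distrib[OF assms])

lemma diffop_act_id: "diffop_act id D = D"
  by (rule ext) (simp only: diffop_act_def inv_id algebra_act_id)

lemma algebra_act_inv:
  assumes "bij g"
  shows "algebra_act g (algebra_act (inv_into UNIV g) f) = f" "algebra_act (inv_into UNIV g) (algebra_act g f) = f"
proof -
  have "g \<circ> inv_into UNIV g = id" "inv_into UNIV g \<circ> g = id"
    using assms by (auto simp: fun_eq_iff bij_is_surj surj_f_inv_f bij_is_inj)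
  then show "algebra_act g (algebra_act (inv_into UNIV g) f) = f" "algebra_act (inv_into UNIV g) (algebra_act g f) = f"
    unfolding algebra_act_comp by (simp_all only: algebra_act_id)
qed

context torus
begin

abbreviation "H \<equiv> (AutoGroup (type_group :: 'q monoid))\<lparr>carrier := G\<rparr>"

definition \<alpha> :: "('q \<Rightarrow> 'q) \<Rightarrow> 'l \<Rightarrow> 'l" where "\<alpha> g = frac_ext P (coeff_act (diffop_act g))"

lemma transported_act_eq: "transported_act \<phi> g = transp (diffop_act g)"
  by (simp add: fun_eq_iff transported_act_def transp_def psi_def)

lemma field_act_eq: "field_act \<iota> n t \<phi> = \<alpha>"
  by (simp add: fun_eq_iff field_act_def \<alpha>_def frac_ext_def coeff_act_def transported_act_eq P_def Let_def)

lemma G_Bij: "g \<in> G \<Longrightarrow> g \<in> Bij UNIV" and G_bij: "g \<in> G \<Longrightarrow> bij g"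
  and G_add: "g \<in> G \<Longrightarrow> g (a + b) = g a + g b"
  using subgroup.subset[OF G]
  by (auto simp: AutoGroup_def auto_def BijGroup_def Bij_def hom_def type_group_def)

lemma group_H: "group H"
  by (rule subgroup.subgroup_is_group[OF G group.AutoGroup[OF group_type_group]])

lemma mult_H: "g \<in> G \<Longrightarrow> h \<in> G \<Longrightarrow> g \<otimes>\<^bsub>H\<^esub> h = g \<circ> h"
  using G_Bij by (simp add: AutoGroup_def BijGroup_def type_group_def compose_def fun_eq_iff)

lemma one_H: "\<one>\<^bsub>H\<^esub> = id"
  by (simp add: AutoGroup_def BijGroup_def type_group_def fun_eq_iff)

lemma comp_G: "g \<in> G \<Longrightarrow> h \<in> G \<Longrightarrow> g \<circ> h \<in> G"
  using subgroup.m_closed[OF G, of g h] mult_H[of g h] by simp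

lemma inv_G: "g \<in> G \<Longrightarrow> \<exists>h\<in>G. g \<circ> h = id \<and> h \<circ> g = id"
proof -
  assume g: "g \<in> G"
  have "inv\<^bsub>H\<^esub> g \<in> carrier H" "g \<otimes>\<^bsub>H\<^esub> inv\<^bsub>H\<^esub> g = \<one>\<^bsub>H\<^esub>" "inv\<^bsub>H\<^esub> g \<otimes>\<^bsub>H\<^esub> g = \<one>\<^bsub>H\<^esub>"
    using g group.inv_closed[OF group_H] group.r_inv[OF group_H] group.l_inv[OF group_H] by auto
  then show ?thesis using mult_H g one_H by (intro bexI[of _ "inv\<^bsub>H\<^esub> g"]) auto
qed

lemma DO_hom_act:
  assumes g: "g \<in> G"
  shows "DO_hom (diffop_act g)"
  unfolding DO_hom_def
proof (intro conjI ballI allI)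
  note inv = algebra_act_inv[OF G_bij[OF g]]
  show "diffop_act g D \<in> DO" if "D \<in> DO" for D
    by (rule diffop_act_carrier[OF G_bij[OF g] G_add[OF g] that])
  show "diffop_act g id = id" by (simp add: fun_eq_iff diffop_act_def inv)
  show "diffop_act g (D \<circ> D') = diffop_act g D \<circ> diffop_act g D'" for D D'
    by (simp add: fun_eq_iff diffop_act_def inv)
  show "diffop_act g (\<lambda>f. D f + D' f) = (\<lambda>f. diffop_act g D f + diffop_act g D' f)" for D D'
    by (simp add: fun_eq_iff diffop_act_def algebra_act_add)
  have "g 0 = 0" using G_add[OF g, of 0 0] by simp
  then show "diffop_act g (\<lambda>f. group_algebra_const c * f) = (\<lambda>f. group_algebra_const c * f)" for c
    by (simp add: fun_eq_iff diffop_act_def algebra_act_mult G_add[OF g] algebra_act_single inv)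
qed

text \<open>The stability hypothesis applies to \<open>g\<close> and to its inverse in
  \<open>G\<close>, so their transported actions are mutually inverse on \<open>P\<close>.\<close>

lemma act_facts:
  assumes g: "g \<in> G"
  shows "\<And>p. p \<in> P \<Longrightarrow> \<alpha> g p \<in> P"
    and "\<And>p. p \<in> P \<Longrightarrow> transp (diffop_act g) (skew_const p) = skew_const (\<alpha> g p)"
    and "\<alpha> g \<in> field_auts (range \<iota>)"
proof -
  obtain h where h: "h \<in> G" "g \<circ> h = id" "h \<circ> g = id" using inv_G[OF g] by blast
  have inv: "diffop_act g (diffop_act h D) = D" "diffop_act h (diffop_act g D) = D" for D
    using diffop_act_comp[OF G_bij[OF g] G_bij[OF h(1)], of D] diffop_act_comp[OF G_bij[OF h(1)] G_bij[OF g], of D]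
    unfolding h(2,3) diffop_act_id by simp_all
  have stable': "transp (diffop_act g) (skew_const p) \<in> skew_const ` P" if "g \<in> G" "p \<in> P" for g p
    using stable[OF that] by (simp add: transported_act_eq)
  note aut = coeff_act_aut[OF DO_hom_act[OF g] DO_hom_act[OF h(1)] inv stable'[OF g] stable'[OF h(1)]]
  show "\<alpha> g \<in> field_auts (range \<iota>)" unfolding \<alpha>_def by (rule aut(3))
  fix p assume p: "p \<in> P"
  have eq: "\<alpha> g p = coeff_act (diffop_act g) p" unfolding \<alpha>_def by (rule aut(4)) (use p in auto)
  show "\<alpha> g p \<in> P" unfolding eq by (rule aut(1)) (use p in auto)
  show "transp (diffop_act g) (skew_const p) = skew_const (\<alpha> g p)" unfolding eq by (rule aut(2)) (use p in auto)
qed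

lemma alpha_comp:
  assumes g: "g \<in> G" and h: "h \<in> G"
  shows "\<alpha> (g \<circ> h) = \<alpha> g \<circ> \<alpha> h"
proof (rule aut_eqI[OF act_facts(3)[OF comp_G[OF g h]] field_auts_comp[OF act_facts(3)[OF g] act_facts(3)[OF h]]])
  fix y assume "y \<in> Y"
  then obtain i where i: "i < n" "y = t i" by auto
  note i = i(1) and y = i(2)
  have "transp (diffop_act (g \<circ> h)) (skew_const (t i)) = transp (diffop_act g) (transp (diffop_act h) (skew_const (t i)))"
    unfolding transp_def diffop_act_comp[OF G_bij[OF g] G_bij[OF h]]
    using DO_hom_act[OF h] psi_DO[OF const_PS[OF t_P[OF i]]] by (simp add: psi_phi DO_hom_def)
  then have "skew_const (\<alpha> (g \<circ> h) (t i)) = skew_const (\<alpha> g (\<alpha> h (t i)))"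
    using act_facts(2)[OF comp_G[OF g h] t_P[OF i]] act_facts(2)[OF h t_P[OF i]]
      act_facts(2)[OF g act_facts(1)[OF h t_P[OF i]]] by simp
  then show "\<alpha> (g \<circ> h) y = (\<alpha> g \<circ> \<alpha> h) y" by (simp add: const_inj y)
qed

lemma act_XM:
  assumes g: "g \<in> G"
  shows "diffop_act g (XM q) = XM (g q)"
  by (simp add: fun_eq_iff diffop_act_def XM_def algebra_act_mult G_add[OF g] algebra_act_single
      algebra_act_inv[OF G_bij[OF g]])

lemma transp_XM: "g \<in> G \<Longrightarrow> transp (diffop_act g) (single (s q) 1) = single (s (g q)) 1"
  using transp_phi[OF XM_DO, of "diffop_act g" q] by (simp add: phi_X act_XM)

lemma single_eq: "single (s q) p = skew_mult (skew_const p) (single (s q) 1)"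
  by (simp add: skew_const_def mm.skew_mult_single mm.id_M)

lemma single_PS: "single (s q) 1 \<in> PS"
  using phi_PS[OF XM_DO, of q] by (simp add: phi_X)

lemma transp_single:
  assumes g: "g \<in> G" and p: "p \<in> P"
  shows "transp (diffop_act g) (single (s q) p) = single (s (g q)) (\<alpha> g p)"
  unfolding single_eq[of q p] single_eq[of "g q" "\<alpha> g p"]
    transp_hom(3)[OF DO_hom_act[OF g] const_PS[OF p] single_PS]
  by (simp add: act_facts(2)[OF g p] transp_XM[OF g])

text \<open>The transported action is applied to the rule that moves a generator past the shift
  \<open>s q\<close>; comparing coefficients at \<open>s (g q)\<close> gives the identity on
  \<open>Y\<close>.\<close>

lemma alpha_s:
  assumes g: "g \<in> G"
  shows "\<alpha> g (s q x) = s (g q) (\<alpha> g x)"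
proof -
  have "\<alpha> g \<circ> s q = s (g q) \<circ> \<alpha> g"
  proof (rule aut_eqI[OF field_auts_comp[OF act_facts(3)[OF g] s_aut] field_auts_comp[OF s_aut act_facts(3)[OF g]]])
    fix y assume y: "y \<in> Y"
    note tP = Y_P[OF y]
    have mult: "skew_mult (single (s r) 1) (skew_const p) = single (s r) (s r p)" for r p
      by (simp add: skew_const_def mm.skew_mult_single s_MM)
    have "transp (diffop_act g) (skew_mult (single (s q) 1) (skew_const y)) =
        skew_mult (single (s (g q)) 1) (skew_const (\<alpha> g y))"
      unfolding transp_hom(3)[OF DO_hom_act[OF g] single_PS const_PS[OF tP]]
      by (simp add: act_facts(2)[OF g tP] transp_XM[OF g])
    then have "single (s (g q)) (\<alpha> g (s q y)) = single (s (g q)) (s (g q) (\<alpha> g y))"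
      unfolding mult transp_single[OF g s_P[OF tP]] .
    from injD[OF inj_single this] show "(\<alpha> g \<circ> s q) y = (s (g q) \<circ> \<alpha> g) y" by simp
  qed
  from fun_cong[OF this, of x] show ?thesis by simp
qed

text \<open>The negatives are included so that \<open>E\<close> generates Q as a monoid.\<close>

definition E :: "'q set" where "E = (\<lambda>i. \<beta> (frag_of i)) ` {..<n} \<union> (\<lambda>i. - \<beta> (frag_of i)) ` {..<n}"

lemma E_induct:
  assumes "0 \<in> V" and step: "\<And>e v. e \<in> E \<Longrightarrow> v \<in> V \<Longrightarrow> e + v \<in> V"
  shows "q \<in> V"
proof -
  \<comment> \<open>Strengthened to translations of all of \<open>V\<close> by both signs, which
    makes the difference step a composition of two translations.\<close>
  have "keys z \<subseteq> {..<n} \<Longrightarrow> keys z \<subseteq> {..<n} \<and> (\<forall>v\<in>V. \<beta> z + v \<in> V \<and> - \<beta> z + v \<in> V)" for z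
  proof (induction z rule: frag_induction)
    case zero then show ?case by (simp add: beta_zero)
  next
    case (one i)
    then have "\<beta> (frag_of i) \<in> E" "- \<beta> (frag_of i) \<in> E" by (auto simp: E_def)
    then show ?case using step[of "\<beta> (frag_of i)"] step[of "- \<beta> (frag_of i)"] one by (simp add: keys_frag_of)
  next
    case (diff a b)
    then have "keys (a - b) \<subseteq> {..<n}" using keys_diff[of a b] by blast
    moreover have "\<beta> (a - b) + v \<in> V \<and> - \<beta> (a - b) + v \<in> V" if v: "v \<in> V" for v
    proof -
      have "\<beta> a + (- \<beta> b + v) \<in> V" "\<beta> b + (- \<beta> a + v) \<in> V" using diff v by blast+
      then show ?thesis using diff by (simp add: beta_diff algebra_simps)
    qed
    ultimately show ?case by blast
  qed
  from this[OF keys_vec[of q]] have "q + 0 \<in> V" using assms(1) unfolding beta_vec by blast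
  then show ?thesis by simp
qed

text \<open>A nonzero coordinate of \<open>q\<close> is multiplied by \<open>j\<close>, so the
  multiples of \<open>q\<close> are distinct.\<close>

lemma torsion_free:
  fixes q :: 'q
  assumes "q \<noteq> 0"
  shows "inj (\<lambda>j. ((+) q ^^ j) 0)"
proof (rule injI)
  fix j k assume eq: "((+) q ^^ j) 0 = ((+) q ^^ k) 0"
  obtain i where i: "coord i q \<noteq> 0" using coord_inj[of q 0] assms by (auto simp: coord_zero)
  have "coord i (((+) q ^^ j) 0) = int j * coord i q" for j
    by (induction j) (simp_all add: coord_zero coord_add algebra_simps)
  then have "int j * coord i q = int k * coord i q" using eq by metis
  then show "j = k" using i by simp
qed

section \<open>Comparison of the transported action with the action on the skew ring\<close>

sublocale sa: shift_action \<iota> Y P H \<alpha> s E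
proof (rule shift_action.intro[OF frac_generated_axioms shift_action_axioms.intro])
  show "q \<in> V" if "0 \<in> V" "\<And>e v. e \<in> E \<Longrightarrow> v \<in> V \<Longrightarrow> e + v \<in> V" for q V
    using E_induct that by blast
  show "finite E" by (simp add: E_def)
qed (use group_H finite_G mult_H one_H G_add act_facts alpha_comp s_aut s_add inj_s s_P
      alpha_s torsion_free in auto)

text \<open>Both actions are additive and send the monomial with coefficient \<open>p\<close> at
  \<open>s q\<close> to the one with coefficient \<open>\<alpha> g p\<close> at
  \<open>s (g q)\<close>. So the action coming from differential operators is the one prescribed for
  the Galois ring.\<close>

lemma transp_eq_skew_act:
  assumes g: "g \<in> G" and u: "u \<in> PS"
  shows "transp (diffop_act g) u = skew_act \<alpha> g u"
proof -
  have P: "m \<in> MM" "lookup u m \<in> P" if "m \<in> keys u" for m using u that by (auto simp: PS_iff)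
  have single: "single m p \<in> PS \<and> transp (diffop_act g) (single m p) = skew_act \<alpha> g (single m p)"
    if "m \<in> MM" "p \<in> P" for m p
  proof -
    obtain q where q: "m = s q" using \<open>m \<in> MM\<close> by (auto simp: MM_eq)
    have "single (s q) p \<in> PS" unfolding single_eq[of q p] by (rule PS_closed(2)[OF const_PS[OF that(2)] single_PS])
    then show ?thesis using transp_single[OF g that(2)] sa.act_single[of g q p] g q by simp
  qed
  \<comment> \<open>Membership of the partial sums in \<open>PS\<close> is carried along, since
    \<open>transp\<close> is known to be additive only there.\<close>
  have "(\<Sum>m\<in>A. single m (lookup u m)) \<in> PS \<and> transp (diffop_act g) (\<Sum>m\<in>A. single m (lookup u m)) =
      skew_act \<alpha> g (\<Sum>m\<in>A. single m (lookup u m))" if "finite A" "A \<subseteq> keys u" for A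
    using that
  proof (induction A)
    case empty
    have "(0 :: 'l skew) \<in> PS" using P_closed(2) by (simp add: PS_iff)
    moreover from this have "transp (diffop_act g) 0 = 0"
      using transp_hom(2)[OF DO_hom_act[OF g], of 0 0] by simp
    ultimately show ?case by (simp add: sa.act_zero)
  next
    case (insert m A)
    then show ?case
      using single[of m "lookup u m"] P[of m] PS_closed(1) transp_hom(2)[OF DO_hom_act[OF g]] sa.act_add[of g] g
      by simp
  qed
  from this[of "keys u"] show ?thesis using poly_mapping_expand[of "keys u" u] by simp
qed

lemma MM_eq_sa: "MM = sa.M"
  by (simp add: sa.M_def MM_eq)

text \<open>\<open>\<phi>\<close> is bijective and intertwines the two actions, so fixed elements
  correspond to fixed elements.\<close>

lemma image_invariants: "\<phi> ` torus_diffop_invariants G = sa.U"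
proof -
  have PM: "sa.PM = PS"
    by (auto simp: sa.PM_def sa.sk.Sk_def PS_iff MM_eq_sa)
  have "diffop_act g D = D \<longleftrightarrow> skew_act \<alpha> g (\<phi> D) = \<phi> D" if "g \<in> G" "D \<in> DO" for g D
  proof -
    have "\<phi> (diffop_act g D) = skew_act \<alpha> g (\<phi> D)"
      using transp_phi[OF that(2), of "diffop_act g"] transp_eq_skew_act[OF that(1) phi_PS[OF that(2)]] by simp
    moreover have "diffop_act g D \<in> DO" using DO_hom_act[OF that(1)] that(2) by (simp add: DO_hom_def)
    ultimately show ?thesis using that(2) psi_phi by metis
  qed
  then have inv: "D \<in> torus_diffop_invariants G \<longleftrightarrow> D \<in> DO \<and> \<phi> D \<in> sa.U" for D
    unfolding torus_diffop_invariants_def sa.U_def PM fixed_elems_def using phi_PS by auto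
  show ?thesis
  proof
    show "\<phi> ` torus_diffop_invariants G \<subseteq> sa.U" using inv by auto
    show "sa.U \<subseteq> \<phi> ` torus_diffop_invariants G"
    proof
      fix u assume u: "u \<in> sa.U"
      then have "u \<in> PS" unfolding sa.U_def PM by simp
      then have "psi u \<in> torus_diffop_invariants G" using u by (simp add: inv psi_DO phi_psi)
      then show "u \<in> \<phi> ` torus_diffop_invariants G" using phi_psi[OF \<open>u \<in> PS\<close>] by (metis imageI)
    qed
  qed
qed

lemma \<Gamma>_eq_sa: "P \<inter> fixed_elems G \<alpha> = sa.\<Gamma>"
  by (simp add: sa.\<Gamma>_def)

end

theorem theorem4p8:
  fixes n :: nat
    and \<beta> :: "(nat \<Rightarrow>\<^sub>0 int) \<Rightarrow> 'q::ab_group_add"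
    and G :: "('q \<Rightarrow> 'q) set"
    and \<iota> :: "'k::{alg_closed_field, field_char_0} \<Rightarrow> 'l::field"
    and t :: "nat \<Rightarrow> 'l"
    and \<phi> :: "(('q \<Rightarrow>\<^sub>0 'k) \<Rightarrow> ('q \<Rightarrow>\<^sub>0 'k)) \<Rightarrow> 'l skew"
  defines "P \<equiv> poly_subring \<iota> n t"
    and "\<alpha> \<equiv> field_act \<iota> n t \<phi>"
    and "M \<equiv> shifts \<iota> n t"
  defines "U \<equiv> \<phi> ` torus_diffop_invariants G"
    and "\<Gamma> \<equiv> P \<inter> fixed_elems G \<alpha>"
  assumes "\<beta> \<in> iso (free_Abelian_group {..<n}) type_group"
    and "subgroup G (AutoGroup type_group)" and "finite G"
    and "rational_function_field \<iota> n t"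
    and "torus_identification \<iota> n t \<beta> \<phi>"
    and "\<And>g p. g \<in> G \<Longrightarrow> p \<in> P \<Longrightarrow> transported_act \<phi> g (skew_const p) \<in> skew_const ` P"
  shows "principal_galois_order (range \<iota>) \<Gamma> M ((AutoGroup type_group)\<lparr>carrier := G\<rparr>) \<alpha> U
    \<and> harish_chandra_subalgebra ((skew_ring M)\<lparr>carrier := U\<rparr>)
          (skew_const ` range \<iota>) (skew_const ` \<Gamma>)"
proof -
  interpret T: torus n \<beta> G \<iota> t \<phi> P
    by (rule torus.intro) (use assms(6-11) in \<open>simp_all add: P_def\<close>)
  show ?thesis
    using T.sa.principal_galois_order_U T.sa.harish_chandra_\<Gamma>
    unfolding T.\<Gamma>_eq_sa[symmetric] T.MM_eq_sa[symmetric] T.image_invariants[symmetric]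
    by (simp add: \<Gamma>_def U_def M_def \<alpha>_def T.field_act_eq)
qed

end
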